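(* Let $\mathbb K$ be $\mathbb R$ or $\mathbb C$, let $n\ge 3$ and $d\geq 1$. There exists a Zariski open and dense subset $\mathcal U(d,n)$ of $A(d,n)$, which does not intersect $A(d-1,n)$, such that each $f\in\mathcal U(d,n)$ is irreducible and its zero locus $Z(f)\subset\mathbb K^n$ is non-singular and conic at $\infty$. Therefore each connected component of $Z(f)$ is Lipschitz normally embedded (LNE). In particular, when $\mathbb K=\mathbb C$, the hypersurface $Z(f)$ is LNE.
   Context: Smooth means $C^\infty$. $A(d,n)$ is the finite-dimensional $\mathbb K$-vector space of polynomials in $\mathbb K[x_1,\ldots,x_n]$ of degree $\le d$; $Z(f)$ is the zero set of $f$ in $\mathbb K^n$. A sub-variety is non-singular if it has no singular points. Put $m=\dim_{\mathbb R}\mathbb K^n$; $\mathbb K^n$ is identified with Euclidean $\mathbb R^m$ (real and imaginary parts of the coordinates if $\mathbb K=\mathbb C$). **LNE.** For $S\subset\mathbb R^m$, $d^S_{\rm in}(x,x')$ is the infimum of the lengths of rectifiable paths lying in $S$ joining $x$ and $x'$; $S$ is LNE if there is $L>0$ with $d^S_{\rm in}(x,x')\le L|x-x'|$ for all $x,x'\in S$. **p-sub-manifolds.** A subset $N$ of a smooth manifold with boundary $(P,\partial P)$ is a p-sub-manifold of $P$ if it is a smooth embedded sub-manifold with (possibly empty) boundary $\partial N$, with $\partial N=N\cap\partial P$, and $T_xN+T_x\partial P=T_xP$ for every $x\in\partial N$. **Conic at infinity.** Let $\overline{\mathbf M}=[0,\infty)\times\mathbb S^{m-1}$ and let $\beta:(0,\infty)\times\mathbb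 S^{m-1}\to\mathbb R^m\setminus 0$, $\beta(r,u)=u/r$. The space $\overline{\mathbb R^m}$ is the compactification of $\mathbb R^m$ as a manifold with boundary obtained by identifying $\mathbb R^m\setminus 0$ with the interior of $\overline{\mathbf M}$ via $\beta$; its boundary is $0\times\mathbb S^{m-1}$. For $Y\subset\mathbb R^m$, let $\overline Y$ be its closure in $\overline{\mathbb R^m}$ and let $0\times Y^\infty=\overline Y\cap(0\times\mathbb S^{m-1})$. The set $Y$ is conic at $\infty$ if either $Y$ is bounded, or the germ of $\overline Y$ along $0\times Y^\infty$ is non-empty and is the germ of a smooth p-sub-manifold of $\overline{\mathbb R^m}$. *)

theory Defs
  imports
    "HOL-Analysis.Analysis"
    "HOL-Library.Poly_Mapping"
    "HOL-Computational_Algebra.Factorial_Ring"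
begin

section \<open>Polynomials and affine algebraic sets\<close>

text \<open>
  Polynomials with coefficients in \<open>'a\<close> and variables indexed by \<open>'n\<close>: finitely supported
  functions on monomials, a monomial being a finitely supported exponent function. The ring
  structure is the convolution product of \<open>Poly_Mapping\<close>.
\<close>

type_synonym ('n, 'a) mpoly = "('n \<Rightarrow>\<^sub>0 nat) \<Rightarrow>\<^sub>0 'a"

definition monomial_value :: "('n \<Rightarrow> 'a::comm_semiring_1) \<Rightarrow> ('n \<Rightarrow>\<^sub>0 nat) \<Rightarrow> 'a" where
  "monomial_value x m = (\<Prod>i\<in>Poly_Mapping.keys m. x i ^ Poly_Mapping.lookup m i)"

definition peval :: "('n \<Rightarrow> 'a::comm_semiring_1) \<Rightarrow> ('n, 'a) mpoly \<Rightarrow> 'a" where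
  "peval x p = (\<Sum>m\<in>Poly_Mapping.keys p. Poly_Mapping.lookup p m * monomial_value x m)"

definition monomial_degree :: "('n \<Rightarrow>\<^sub>0 nat) \<Rightarrow> nat" where
  "monomial_degree m = (\<Sum>i\<in>Poly_Mapping.keys m. Poly_Mapping.lookup m i)"

definition polys_le :: "nat \<Rightarrow> ('n, 'a::zero) mpoly set" where
  "polys_le d = {p. \<forall>m\<in>Poly_Mapping.keys p. monomial_degree m \<le> d}"

definition zero_locus :: "('n::finite, 'a::comm_semiring_1) mpoly \<Rightarrow> ('a ^ 'n) set" where
  "zero_locus p = {x. peval (($) x) p = 0}"


subsection \<open>The Zariski topology on a space of polynomials\<close>

text \<open>
  \<open>polys_le d\<close> is a finite-dimensional vector space with the coefficients as linear coordinates.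
  A polynomial function on it is a polynomial \<open>P\<close> whose variables are indexed by the monomials,
  evaluated at the coefficient function of \<open>p\<close>; variables indexed by monomials of degree
  greater than \<open>d\<close> take the value \<open>0\<close>. The closed sets are the common zero loci of families
  of polynomial functions.
\<close>

definition zariski_closed :: "nat \<Rightarrow> ('n, 'a::idom) mpoly set \<Rightarrow> bool" where
  "zariski_closed d C \<longleftrightarrow>
    (\<exists>S :: ('n \<Rightarrow>\<^sub>0 nat, 'a) mpoly set.
      C = {p \<in> polys_le d. \<forall>P\<in>S. peval (Poly_Mapping.lookup p) P = 0})"

definition zariski_topology :: "nat \<Rightarrow> ('n, 'a::idom) mpoly topology" where
  "zariski_topology d =
    topology (\<lambda>U. U \<subseteq> polys_le d \<and> zariski_closed d (polys_le d - U))"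

lemma monomial_value_superset:
  assumes "finite A" "Poly_Mapping.keys m \<subseteq> A"
  shows "monomial_value x m = (\<Prod>i\<in>A. x i ^ Poly_Mapping.lookup m i)"
  unfolding monomial_value_def
  by (rule prod.mono_neutral_left) (use assms in \<open>auto simp: in_keys_iff\<close>)

lemma monomial_value_add: "monomial_value x (m + n) = monomial_value x m * monomial_value x n"
  using keys_add[of m n]
  by (simp add: monomial_value_superset[of "Poly_Mapping.keys m \<union> Poly_Mapping.keys n"]
      lookup_add power_add prod.distrib)

lemma peval_superset:
  assumes "finite A" "Poly_Mapping.keys p \<subseteq> A"
  shows "peval x p = (\<Sum>m\<in>A. Poly_Mapping.lookup p m * monomial_value x m)"
  unfolding peval_def
  by (rule sum.mono_neutral_left) (use assms in \<open>auto simp: in_keys_iff\<close>)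

lemma peval_zero [simp]: "peval x 0 = 0"
  by (simp add: peval_def)

lemma peval_single [simp]: "peval x (Poly_Mapping.single m c) = c * monomial_value x m"
  by (simp add: peval_def)

lemma peval_one [simp]: "peval x 1 = 1"
  using peval_single[of x 0 1] by (simp add: monomial_value_def del: peval_single)

lemma peval_add: "peval x (p + q) = peval x p + peval x q"
  using keys_add[of p q]
  by (simp add: peval_superset[of "Poly_Mapping.keys p \<union> Poly_Mapping.keys q"]
      lookup_add distrib_right sum.distrib)

lemma update_eq_add_single:
  assumes "a \<notin> Poly_Mapping.keys f"
  shows "Poly_Mapping.update a b f = f + Poly_Mapping.single a b"
  by (rule poly_mapping_eqI)
     (use assms in \<open>auto simp: lookup_update lookup_add lookup_single when_def in_keys_iff\<close>)

lemma peval_mult: "peval x (p * q) = peval x p * peval x q"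
proof -
  have single: "peval x (Poly_Mapping.single m a * q)
      = peval x (Poly_Mapping.single m a) * peval x q" for m a
  proof (induction q rule: update_induct)
    case const
    then show ?case by simp
  next
    case (update f n b)
    have "peval x (Poly_Mapping.single m a * Poly_Mapping.single n b)
        = peval x (Poly_Mapping.single m a) * peval x (Poly_Mapping.single n b)"
      by (simp add: mult_single monomial_value_add mult_ac)
    with update show ?case
      by (simp only: update_eq_add_single[OF update.hyps(1)] distrib_left peval_add)
  qed
  show ?thesis
  proof (induction p rule: update_induct)
    case const
    then show ?case by simp
  next
    case (update f n b)
    then show ?case
      by (simp only: update_eq_add_single[OF update.hyps(1)] distrib_right peval_add single)
  qed
qed

lemma istopology_zariski:
  "istopology (\<lambda>U :: ('n, 'a::idom) mpoly set. U \<subseteq> polys_le d \<and> zariski_closed d (polys_le d - U))"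
proof -
  have Int: "zariski_closed d (polys_le d - U \<inter> V)"
    if U: "zariski_closed d (polys_le d - U)" and V: "zariski_closed d (polys_le d - V)"
    for U V :: "('n, 'a) mpoly set"
  proof -
    from U V obtain S T :: "('n \<Rightarrow>\<^sub>0 nat, 'a) mpoly set" where
      S: "polys_le d - U = {p \<in> polys_le d. \<forall>P\<in>S. peval (Poly_Mapping.lookup p) P = 0}" and
      T: "polys_le d - V = {p \<in> polys_le d. \<forall>P\<in>T. peval (Poly_Mapping.lookup p) P = 0}"
      unfolding zariski_closed_def by auto
    have "polys_le d - U \<inter> V = (polys_le d - U) \<union> (polys_le d - V)"
      by blast
    also have "\<dots> = {p \<in> polys_le d. \<forall>P\<in>{P * Q | P Q. P \<in> S \<and> Q \<in> T}.
        peval (Poly_Mapping.lookup p) P = 0}"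
      (is "_ = ?R")
    proof (intro equalityI subsetI)
      fix p assume "p \<in> (polys_le d - U) \<union> (polys_le d - V)"
      then show "p \<in> ?R"
        unfolding S T by (auto simp: peval_mult)
    next
      fix p assume p: "p \<in> ?R"
      show "p \<in> (polys_le d - U) \<union> (polys_le d - V)"
      proof (rule ccontr)
        assume "\<not> ?thesis"
        moreover have "p \<in> polys_le d"
          using p by blast
        ultimately obtain P Q where PQ: "P \<in> S" "Q \<in> T"
          "peval (Poly_Mapping.lookup p) P \<noteq> 0" "peval (Poly_Mapping.lookup p) Q \<noteq> 0"
          unfolding S T by auto
        from p PQ(1,2) have "peval (Poly_Mapping.lookup p) (P * Q) = 0"
          by blast
        with PQ(3,4) show False
          by (simp add: peval_mult)
      qed
    qed
    finally show ?thesis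
      unfolding zariski_closed_def by blast
  qed
  have Union: "zariski_closed d (polys_le d - \<Union>K)"
    if K: "\<forall>U\<in>K. zariski_closed d (polys_le d - U)" for K :: "('n, 'a) mpoly set set"
  proof -
    from K have "\<forall>U\<in>K. \<exists>S :: ('n \<Rightarrow>\<^sub>0 nat, 'a) mpoly set.
        polys_le d - U = {p \<in> polys_le d. \<forall>P\<in>S. peval (Poly_Mapping.lookup p) P = 0}"
      unfolding zariski_closed_def .
    from bchoice[OF this] obtain S :: "('n, 'a) mpoly set \<Rightarrow> ('n \<Rightarrow>\<^sub>0 nat, 'a) mpoly set" where
      S: "\<forall>U\<in>K. polys_le d - U = {p \<in> polys_le d. \<forall>P\<in>S U. peval (Poly_Mapping.lookup p) P = 0}"
      by blast
    have "polys_le d - \<Union>K = {p \<in> polys_le d. \<forall>U\<in>K. p \<in> polys_le d - U}"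
      by blast
    also have "\<dots> = {p \<in> polys_le d. \<forall>P\<in>\<Union>(S ` K). peval (Poly_Mapping.lookup p) P = 0}"
    proof (rule Collect_cong)
      fix p
      have "p \<in> polys_le d - U \<longleftrightarrow> p \<in> polys_le d \<and> (\<forall>P\<in>S U. peval (Poly_Mapping.lookup p) P = 0)"
        if "U \<in> K" for U
        using S that by blast
      then show "p \<in> polys_le d \<and> (\<forall>U\<in>K. p \<in> polys_le d - U) \<longleftrightarrow>
          p \<in> polys_le d \<and> (\<forall>P\<in>\<Union>(S ` K). peval (Poly_Mapping.lookup p) P = 0)"
        by auto
    qed
    finally show ?thesis
      unfolding zariski_closed_def by blast
  qed
  show ?thesis
    unfolding istopology_def
  proof (intro conjI allI impI)
    fix K :: "('n, 'a) mpoly set set"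
    assume K: "\<forall>U\<in>K. U \<subseteq> polys_le d \<and> zariski_closed d (polys_le d - U)"
    from K show "\<Union>K \<subseteq> polys_le d"
      by blast
    from K show "zariski_closed d (polys_le d - \<Union>K)"
      by (intro Union) simp
  next
    fix U V :: "('n, 'a) mpoly set"
    assume UV: "U \<subseteq> polys_le d \<and> zariski_closed d (polys_le d - U)"
      "V \<subseteq> polys_le d \<and> zariski_closed d (polys_le d - V)"
    from UV show "U \<inter> V \<subseteq> polys_le d"
      by blast
    from UV show "zariski_closed d (polys_le d - U \<inter> V)"
      by (intro Int) simp_all
  qed
qed

lemma openin_zariski_topology:
  "openin (zariski_topology d) U \<longleftrightarrow> U \<subseteq> polys_le d \<and> zariski_closed d (polys_le d - U)"
  unfolding zariski_topology_def topology_inverse'[OF istopology_zariski] ..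

lemma topspace_zariski_topology:
  "topspace (zariski_topology d :: ('n, 'a::idom) mpoly topology) = polys_le d"
proof -
  have "zariski_closed d ({} :: ('n, 'a) mpoly set)"
    unfolding zariski_closed_def by (rule exI[of _ "{1}"]) simp
  then have "openin (zariski_topology d) (polys_le d :: ('n, 'a) mpoly set)"
    by (simp add: openin_zariski_topology)
  then show ?thesis
    by (meson openin_subset openin_topspace openin_zariski_topology subset_antisym)
qed


subsection \<open>Singular points\<close>

definition vanishing_ideal :: "('a::field ^ 'n) set \<Rightarrow> ('n::finite, 'a) mpoly set" where
  "vanishing_ideal X = {p. \<forall>x\<in>X. peval (($) x) p = 0}"

text \<open>
  Formal partial derivative. When the variable \<open>i\<close> does not occur in \<open>m\<close>, the subtraction of
  exponents truncates, but the coefficient is then \<open>0\<close>.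
\<close>

definition pderivative :: "'n \<Rightarrow> ('n, 'a::comm_semiring_1) mpoly \<Rightarrow> ('n, 'a) mpoly" where
  "pderivative i p = (\<Sum>m\<in>Poly_Mapping.keys p.
      Poly_Mapping.single (m - Poly_Mapping.single i 1)
        (of_nat (Poly_Mapping.lookup m i) * Poly_Mapping.lookup p m))"

definition gradient :: "('n::finite, 'a::comm_semiring_1) mpoly \<Rightarrow> 'a ^ 'n \<Rightarrow> 'a ^ 'n" where
  "gradient p x = (\<chi> i. peval (($) x) (pderivative i p))"

text \<open>
  The rank at \<open>x\<close> of the Jacobian matrix of any system of generators of the vanishing ideal
  of \<open>X\<close> (for \<open>x \<in> X\<close>, the span of the gradients does not depend on the generators). A point of
  \<open>X\<close> is singular if this rank is smaller there than the largest rank attained on \<open>X\<close>, which for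
  an irreducible \<open>X\<close> is the codimension of \<open>X\<close>.
\<close>

definition jacobian_rank :: "('a::field ^ 'n::finite) set \<Rightarrow> 'a ^ 'n \<Rightarrow> nat" where
  "jacobian_rank X x = vec.dim ((\<lambda>p. gradient p x) ` vanishing_ideal X)"

definition singular_points :: "('a::field ^ 'n::finite) set \<Rightarrow> ('a ^ 'n) set" where
  "singular_points X = {x \<in> X. \<exists>y\<in>X. jacobian_rank X x < jacobian_rank X y}"

definition nonsingular_variety :: "('a::field ^ 'n::finite) set \<Rightarrow> bool" where
  "nonsingular_variety X \<longleftrightarrow> singular_points X = {}"


section \<open>Lipschitz normally embedded sets\<close>

definition path_length :: "(real \<Rightarrow> 'e::metric_space) \<Rightarrow> ennreal" where
  "path_length \<gamma> = (SUP (t, k) \<in> {(t :: nat \<Rightarrow> real, k :: nat). mono t \<and> range t \<subseteq> {0..1}}.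
      \<Sum>i<k. ennreal (dist (\<gamma> (t i)) (\<gamma> (t (Suc i)))))"

definition rectifiable_path :: "(real \<Rightarrow> 'e::metric_space) \<Rightarrow> bool" where
  "rectifiable_path \<gamma> \<longleftrightarrow> path \<gamma> \<and> path_length \<gamma> < \<infinity>"

text \<open>The value is \<open>\<infinity>\<close> if no rectifiable path in \<open>S\<close> joins the two points.\<close>

definition inner_dist :: "'e::metric_space set \<Rightarrow> 'e \<Rightarrow> 'e \<Rightarrow> ennreal" where
  "inner_dist S x y = (INF \<gamma> \<in> {\<gamma>. rectifiable_path \<gamma> \<and> path_image \<gamma> \<subseteq> S \<and>
      pathstart \<gamma> = x \<and> pathfinish \<gamma> = y}. path_length \<gamma>)"

definition LNE :: "'e::metric_space set \<Rightarrow> bool" where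
  "LNE S \<longleftrightarrow> (\<exists>L>0. \<forall>x\<in>S. \<forall>y\<in>S. inner_dist S x y \<le> ennreal (L * dist x y))"


section \<open>Smooth sub-manifolds with boundary of Euclidean spaces\<close>

text \<open>
  \<open>Ck_on k U f\<close> is meant for open \<open>U\<close>; on finite-dimensional spaces continuity of all iterated
  directional derivatives up to order \<open>k\<close> is continuity of the derivatives up to order \<open>k\<close>.
\<close>

primrec Ck_on :: "nat \<Rightarrow> 'a::euclidean_space set \<Rightarrow> ('a \<Rightarrow> 'b::euclidean_space) \<Rightarrow> bool" where
  "Ck_on 0 U f \<longleftrightarrow> continuous_on U f"
| "Ck_on (Suc k) U f \<longleftrightarrow> (\<forall>x\<in>U. f differentiable (at x)) \<and>
     (\<forall>v. Ck_on k U (\<lambda>x. frechet_derivative f (at x) v))"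

definition smooth_on :: "'a::euclidean_space set \<Rightarrow> ('a \<Rightarrow> 'b::euclidean_space) \<Rightarrow> bool" where
  "smooth_on U f \<longleftrightarrow> (\<forall>k. Ck_on k U f)"

definition ambient_chart :: "'a::euclidean_space set \<Rightarrow> ('a \<Rightarrow> 'a) \<Rightarrow> bool" where
  "ambient_chart W \<phi> \<longleftrightarrow> open W \<and> open (\<phi> ` W) \<and> inj_on \<phi> W \<and>
     smooth_on W \<phi> \<and> smooth_on (\<phi> ` W) (inv_into W \<phi>)"

text \<open>
  \<open>N\<close> is an embedded \<open>k\<close>-dimensional sub-manifold with boundary \<open>B\<close> of the ambient Euclidean
  space: in local coordinates \<open>N\<close> is a \<open>k\<close>-dimensional linear subspace near points of \<open>N - B\<close>,
  and a closed half of one near points of \<open>B\<close>, these being sent to the boundary of the half-space.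
\<close>

definition submanifold_with_boundary ::
    "nat \<Rightarrow> 'a::euclidean_space set \<Rightarrow> 'a set \<Rightarrow> bool" where
  "submanifold_with_boundary k N B \<longleftrightarrow> B \<subseteq> N \<and>
     (\<forall>x\<in>N - B. \<exists>W \<phi> V. ambient_chart W \<phi> \<and> x \<in> W \<and> subspace V \<and> dim V = k \<and>
        \<phi> ` (N \<inter> W) = \<phi> ` W \<inter> V) \<and>
     (\<forall>x\<in>B. \<exists>W \<phi> V \<nu>. ambient_chart W \<phi> \<and> x \<in> W \<and> subspace V \<and> dim V = k \<and>
        \<nu> \<in> V \<and> \<nu> \<noteq> 0 \<and> \<nu> \<bullet> \<phi> x = 0 \<and>
        \<phi> ` (N \<inter> W) = \<phi> ` W \<inter> {y \<in> V. 0 \<le> \<nu> \<bullet> y})"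

text \<open>
  The tangent space at a point of a sub-manifold with boundary: the span of the one-sided
  velocities of curves in it. At a boundary point these velocities fill a half-space, whose span
  is the full tangent space.
\<close>

definition tangent_space :: "'a::euclidean_space set \<Rightarrow> 'a \<Rightarrow> 'a set" where
  "tangent_space N x = span {v. \<exists>\<gamma> :: real \<Rightarrow> 'a. \<gamma> 0 = x \<and> \<gamma> ` {0..} \<subseteq> N \<and>
      (\<gamma> has_vector_derivative v) (at 0 within {0..})}"

text \<open>
  \<open>N\<close> is a p-sub-manifold of dimension \<open>k\<close> of the manifold with boundary \<open>(P, dP)\<close>, itself
  embedded in a Euclidean space. As \<open>P\<close> is embedded, the embedded sub-manifolds of \<open>P\<close> are the
  embedded sub-manifolds of the ambient space that are contained in \<open>P\<close>.
\<close>

definition p_submanifold ::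
    "nat \<Rightarrow> 'a::euclidean_space set \<Rightarrow> 'a set \<Rightarrow> 'a set \<Rightarrow> bool" where
  "p_submanifold k N P dP \<longleftrightarrow> N \<subseteq> P \<and> submanifold_with_boundary k N (N \<inter> dP) \<and>
     (\<forall>x\<in>N \<inter> dP. {a + b | a b. a \<in> tangent_space N x \<and> b \<in> tangent_space dP x}
        = tangent_space P x)"


section \<open>Sets that are conic at infinity\<close>

text \<open>
  The compactification is the union of the origin and \<open>M_bar\<close>. Only germs along subsets of the
  boundary matter below, so we work in the open subset \<open>M_bar\<close>, which is closed in
  \<open>real \<times> 'e\<close>: closures in \<open>M_bar\<close> are closures in \<open>real \<times> 'e\<close>.
\<close>

definition M_bar :: "(real \<times> 'e::euclidean_space) set" where
  "M_bar = {0..} \<times> sphere 0 1"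

definition M_bdry :: "(real \<times> 'e::euclidean_space) set" where
  "M_bdry = {0} \<times> sphere 0 1"

definition infinity_chart :: "real \<times> 'e::euclidean_space \<Rightarrow> 'e" where
  "infinity_chart = (\<lambda>(r, u). u /\<^sub>R r)"

definition closure_infinity :: "'e::euclidean_space set \<Rightarrow> (real \<times> 'e) set" where
  "closure_infinity Y = closure {p \<in> {0<..} \<times> sphere 0 1. infinity_chart p \<in> Y}"

text \<open>
  The germ of the closure along its trace on the boundary is non-empty exactly when this trace is,
  and it is the germ of \<open>N\<close> if the two sets agree in a neighbourhood \<open>W\<close> of the trace.
\<close>

definition conic_at_infinity :: "'e::euclidean_space set \<Rightarrow> bool" where
  "conic_at_infinity Y \<longleftrightarrow> bounded Y \<or>
     (closure_infinity Y \<inter> M_bdry \<noteq> {} \<and>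
      (\<exists>k N W. p_submanifold k N M_bar M_bdry \<and> open W \<and> closure_infinity Y \<inter> M_bdry \<subseteq> W \<and>
         closure_infinity Y \<inter> W = N \<inter> W))"

end

theory Submission
  imports Defs "HOL-Computational_Algebra.Polynomial"
begin

text \<open>
The reals and the complex numbers are treated together, as a field \<open>'k\<close> of the classes
\<open>real_normed_field\<close> and \<open>euclidean_space\<close>, up to the connectedness of complex hypersurfaces. For a polynomial \<open>f\<close> of degree at most \<open>d\<close>
with coefficients \<open>c m\<close>, let \<open>F(\<mu>, z)\<close> be the sum of the terms \<open>c m * \<mu> ^ (d - deg m) * z ^ m\<close>. Call
\<open>f\<close> nondegenerate if at every zero \<open>(\<mu>, z) \<noteq> 0\<close> of \<open>F\<close> some partial derivative of \<open>F\<close> with respect to a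
coordinate of \<open>z\<close> is nonzero. At \<open>\<mu> = 1\<close> this says that the affine hypersurface is smooth, at
\<open>\<mu> = 0\<close> that it is smooth at infinity and transverse to the hyperplane at infinity. The geometric
assertions of the theorem follow from nondegeneracy, together with genericity in the case of
connectedness.

\<^item> Genericity. A polynomial map from a space of parameters to a space with more coordinates has its
image in a hypersurface, because monomials of bounded exponents in the coordinates outnumber the
monomials that they can produce in the parameters (\<open>polynomial_image_in_hypersurface\<close>). Degenerate
polynomials are images of such maps: vanishing of \<open>F\<close> and of its derivatives at a point can be solved
for one more coefficient than the point has coordinates (\<open>pivot_elimination\<close>). So are products
of two polynomials of positive degrees, by a count of monomials that uses three variables
(\<open>card_monomials_le_add_less\<close>). The complement \<open>U\<close> of these hypersurfaces is dense because two
nonzero polynomials have a common non-zero on a line.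

\<^item> Non-singularity. The gradient of \<open>f\<close> is nonzero on the zero locus, and every polynomial that vanishes
there is constant along the smooth curves that the implicit function theorem provides, so its
gradient is a multiple of that of \<open>f\<close> (\<open>gradient_parallel\<close>). This argument with curves works over
the reals and over the complex numbers alike.

\<^item> Conic structure. In the coordinates \<open>(r, u)\<close> at infinity the zero locus is given by \<open>F(r, u) = 0\<close> and
\<open>|u| = 1\<close>. At \<open>r = 0\<close> these equations are independent of each other and of \<open>r\<close>, since by Euler's
relation the radial direction is tangent to \<open>F = 0\<close> but not to the sphere (\<open>cone_chart\<close>).

\<^item> Lipschitz normal embedding. Normalizing the homogeneous coordinates \<open>(1, x)\<close> to the unit sphere
places all of the zero locus in one compact set on which the implicit function theorem applies
uniformly, including at infinity. Hence points whose distance is small relative to the norm of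
\<open>(1, x)\<close> are joined by paths of proportional length (\<open>uniformly_locally_joined\<close>). Since the zero
locus is asymptotically conical, a far point can be moved towards the origin in geometric steps
(\<open>step_towards_origin\<close>), and a compact part remains (\<open>LNE_of_descent\<close>).

\<^item> Connectedness over the complex numbers. The same compactness, applied to a family of nondegenerate
polynomials, shows that connectedness of the zero locus is locally constant in the family
(\<open>all_joined_nearby\<close>). In the complex pencil through \<open>f\<close> and the Fermat polynomial only finitely many
members are degenerate, and a path can avoid them. The Fermat hypersurface is connected by explicit
paths.
\<close>

section \<open>Calculus of smooth maps\<close>

lemma Ck_on_cong:
  assumes "open U" "\<And>x. x \<in> U \<Longrightarrow> f x = g x" "Ck_on k U f"
  shows "Ck_on k U g"
  using assms(2,3)
proof (induction k arbitrary: f g)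
  case 0
  then show ?case by (auto cong: continuous_on_cong)
next
  case (Suc k)
  have iff: "(f has_derivative f') (at x) \<longleftrightarrow> (g has_derivative f') (at x)" if "x \<in> U" for x f'
    using Suc.prems(1) assms(1) that
    by (metis has_derivative_transform_within_open)
  then have eq: "frechet_derivative f (at x) = frechet_derivative g (at x)" if "x \<in> U" for x
    using that unfolding frechet_derivative_def by simp
  have "Ck_on k U (\<lambda>x. frechet_derivative g (at x) v)" for v
    by (rule Suc.IH[of "\<lambda>x. frechet_derivative f (at x) v"]) (use eq Suc.prems in auto)
  moreover have "g differentiable (at x)" if "x \<in> U" for x
    using iff[OF that] Suc.prems(2) that unfolding Ck_on.simps differentiable_def by blast
  ultimately show ?case by auto
qed

lemma Ck_on_subset: "Ck_on k U f \<Longrightarrow> V \<subseteq> U \<Longrightarrow> Ck_on k V f"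
  by (induction k arbitrary: f) (auto intro: continuous_on_subset)

lemma Ck_on_SucI:
  assumes "open U" "\<And>x. x \<in> U \<Longrightarrow> (f has_derivative f' x) (at x)"
    "\<And>v. Ck_on k U (\<lambda>x. f' x v)"
  shows "Ck_on (Suc k) U f"
proof -
  have "Ck_on k U (\<lambda>x. frechet_derivative f (at x) v)" for v
    by (rule Ck_on_cong[OF assms(1) _ assms(3)[of v]])
       (use assms(2) frechet_derivative_at in metis)
  then show ?thesis
    using assms(2) by (auto simp: differentiable_def)
qed

lemma Ck_on_SucD:
  assumes "Ck_on (Suc k) U f" "x \<in> U"
  shows "(f has_derivative frechet_derivative f (at x)) (at x)"
  using assms frechet_derivative_works by auto

lemma Ck_on_imp_continuous_on: "Ck_on k U f \<Longrightarrow> continuous_on U f"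
  by (cases k) (auto intro!: continuous_at_imp_continuous_on differentiable_imp_continuous_within)

lemma Ck_on_Suc_imp: "Ck_on (Suc k) U f \<Longrightarrow> Ck_on k U f"
proof (induction k arbitrary: f)
  case 0
  then show ?case using Ck_on_imp_continuous_on[of "Suc 0" U f] by (simp del: Ck_on.simps(2))
next
  case (Suc k)
  then show ?case by simp
qed

lemma Ck_on_const: "open U \<Longrightarrow> Ck_on k U (\<lambda>x. c)"
proof (induction k arbitrary: c)
  case (Suc k)
  show ?case by (rule Ck_on_SucI[where f' = "\<lambda>x v. 0"]) (use Suc in auto)
qed simp

lemma Ck_on_bounded_linear:
  assumes "open U" "bounded_linear f"
  shows "Ck_on k U f"
proof (cases k)
  case 0
  then show ?thesis using assms linear_continuous_on by auto
next
  case (Suc l)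
  show ?thesis unfolding Suc
    by (rule Ck_on_SucI[where f' = "\<lambda>x. f"])
       (use assms bounded_linear_imp_has_derivative Ck_on_const in auto)
qed

lemma Ck_on_add:
  assumes "open U" "Ck_on k U f" "Ck_on k U g"
  shows "Ck_on k U (\<lambda>x. f x + g x)"
  using assms(2,3)
proof (induction k arbitrary: f g)
  case 0 then show ?case by (auto intro: continuous_intros)
next
  case (Suc k)
  show ?case
    by (rule Ck_on_SucI[OF assms(1),
          where f' = "\<lambda>x v. frechet_derivative f (at x) v + frechet_derivative g (at x) v"])
       (use Suc in \<open>auto intro!: has_derivative_add simp: frechet_derivative_works[symmetric]\<close>)
qed

lemma Ck_on_bounded_linear_compose:
  assumes "open U" "bounded_linear L" "Ck_on k U f"
  shows "Ck_on k U (\<lambda>x. L (f x))"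
  using assms(3)
proof (induction k arbitrary: f)
  case 0 then show ?case
    using assms(2) by (auto intro: bounded_linear.continuous_on)
next
  case (Suc k)
  show ?case
    by (rule Ck_on_SucI[OF assms(1), where f' = "\<lambda>x v. L (frechet_derivative f (at x) v)"])
       (use Suc assms(2) in \<open>auto intro!: bounded_linear.has_derivative[OF assms(2)]
          simp: frechet_derivative_works[symmetric]\<close>)
qed

lemma Ck_on_bilinear:
  assumes "open U" "bounded_bilinear B" "Ck_on k U f" "Ck_on k U g"
  shows "Ck_on k U (\<lambda>x. B (f x) (g x))"
  using assms(3,4)
proof (induction k arbitrary: f g)
  case 0 then show ?case using assms(2) by (auto intro: bounded_bilinear.continuous_on)
next
  case (Suc k)
  show ?case
  proof (rule Ck_on_SucI[OF assms(1), where f' = "\<lambda>x v. B (f x) (frechet_derivative g (at x) v)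
       + B (frechet_derivative f (at x) v) (g x)"])
    show "((\<lambda>x. B (f x) (g x)) has_derivative (\<lambda>v. B (f x) (frechet_derivative g (at x) v)
       + B (frechet_derivative f (at x) v) (g x))) (at x)" if "x \<in> U" for x
      using that Suc.prems by (intro bounded_bilinear.FDERIV[OF assms(2)] Ck_on_SucD[of k U])
    show "Ck_on k U (\<lambda>x. B (f x) (frechet_derivative g (at x) v)
       + B (frechet_derivative f (at x) v) (g x))" for v
      using Suc.prems
      by (intro Ck_on_add[OF assms(1)] Suc.IH Ck_on_Suc_imp[OF Suc.prems(1)]
          Ck_on_Suc_imp[OF Suc.prems(2)]) auto
  qed
qed

lemma Ck_on_sum:
  assumes "open U" "\<And>i. i \<in> I \<Longrightarrow> Ck_on k U (f i)"
  shows "Ck_on k U (\<lambda>x. \<Sum>i\<in>I. f i x)"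
  using assms(2)
  by (induction I rule: infinite_finite_induct) (auto intro: Ck_on_add Ck_on_const assms(1))

lemma Ck_on_mult:
  fixes f :: "'a::euclidean_space \<Rightarrow> 'k::{euclidean_space, real_normed_algebra}"
  shows "open U \<Longrightarrow> Ck_on k U f \<Longrightarrow> Ck_on k U g \<Longrightarrow> Ck_on k U (\<lambda>x. f x * g x)"
  by (rule Ck_on_bilinear[OF _ bounded_bilinear_mult])

lemma Ck_on_prod:
  fixes f :: "'i \<Rightarrow> 'a::euclidean_space \<Rightarrow> 'k::{euclidean_space, real_normed_field}"
  assumes "open U" "\<And>i. i \<in> I \<Longrightarrow> Ck_on k U (f i)"
  shows "Ck_on k U (\<lambda>x. \<Prod>i\<in>I. f i x)"
  using assms(2)
  by (induction I rule: infinite_finite_induct) (auto intro: Ck_on_mult Ck_on_const assms(1))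

lemma Ck_on_power:
  fixes f :: "'a::euclidean_space \<Rightarrow> 'k::{euclidean_space, real_normed_field}"
  assumes "open U" "Ck_on k U f"
  shows "Ck_on k U (\<lambda>x. f x ^ e)"
  by (induction e) (auto intro: Ck_on_mult Ck_on_const assms)

text \<open>
The derivative of \<open>1 / f\<close> is a product of \<open>1 / f\<close>, the derivative of \<open>f\<close> and \<open>1 / f\<close>, so regularity
of \<open>1 / f\<close> improves by one order at each step of the induction.
\<close>
lemma Ck_on_inverse:
  fixes f :: "'a::euclidean_space \<Rightarrow> 'k::{euclidean_space, real_normed_field}"
  assumes "open U" "Ck_on k U f" "\<And>x. x \<in> U \<Longrightarrow> f x \<noteq> 0"
  shows "Ck_on k U (\<lambda>x. inverse (f x))"
  using assms(2)
proof (induction k)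
  case 0 then show ?case using assms(3) by (auto intro: continuous_intros)
next
  case (Suc k)
  show ?case
  proof (rule Ck_on_SucI[OF assms(1), where f' =
        "\<lambda>x v. - (inverse (f x) * frechet_derivative f (at x) v * inverse (f x))"])
    show "((\<lambda>x. inverse (f x)) has_derivative
        (\<lambda>v. - (inverse (f x) * frechet_derivative f (at x) v * inverse (f x)))) (at x)"
      if "x \<in> U" for x
      using that by (intro Deriv.has_derivative_inverse Ck_on_SucD[OF Suc.prems] assms(3))
    have "Ck_on k U (\<lambda>x. inverse (f x))"
      using Suc Ck_on_Suc_imp by blast
    then have "Ck_on k U (\<lambda>x. inverse (f x) * frechet_derivative f (at x) v * inverse (f x))" for v
      using Suc.prems assms(1) by (auto intro!: Ck_on_mult)
    then show "Ck_on k U (\<lambda>x. - (inverse (f x) * frechet_derivative f (at x) v * inverse (f x)))" for v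
      by (rule Ck_on_bounded_linear_compose[OF assms(1) bounded_linear_minus[OF bounded_linear_ident]])
  qed
qed

text \<open>
Written in an orthonormal basis, the chain rule expresses a directional derivative of the
composition as a sum of products of maps of one order less, to which the induction applies.
\<close>
lemma Ck_on_compose:
  fixes f :: "'a::euclidean_space \<Rightarrow> 'b::euclidean_space" and g :: "'b \<Rightarrow> 'c::euclidean_space"
  assumes "open U" "open V" "f ` U \<subseteq> V" "Ck_on k U f" "Ck_on k V g"
  shows "Ck_on k U (\<lambda>x. g (f x))"
  using assms(4,5)
proof (induction k arbitrary: g)
  case 0 then show ?case
    using assms(3) by (auto intro: continuous_on_compose2)
next
  case (Suc k)
  have lin: "linear (frechet_derivative g (at (f x)))" if "x \<in> U" for x
    using Ck_on_SucD[OF Suc.prems(2)] assms(3) that has_derivative_linear by blast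
  show ?case
  proof (rule Ck_on_SucI[OF assms(1), where f' =
        "\<lambda>x v. \<Sum>b\<in>Basis. (frechet_derivative f (at x) v \<bullet> b) *\<^sub>R frechet_derivative g (at (f x)) b"])
    fix x assume x: "x \<in> U"
    have "((g \<circ> f) has_derivative frechet_derivative g (at (f x)) \<circ> frechet_derivative f (at x)) (at x)"
      using x assms(3) by (intro diff_chain_at Ck_on_SucD[OF Suc.prems(1)] Ck_on_SucD[OF Suc.prems(2)]) auto
    moreover have "(frechet_derivative g (at (f x)) \<circ> frechet_derivative f (at x)) v =
      (\<Sum>b\<in>Basis. (frechet_derivative f (at x) v \<bullet> b) *\<^sub>R frechet_derivative g (at (f x)) b)" for v
    proof -
      have "frechet_derivative g (at (f x)) (\<Sum>b\<in>Basis. (frechet_derivative f (at x) v \<bullet> b) *\<^sub>R b)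
        = (\<Sum>b\<in>Basis. (frechet_derivative f (at x) v \<bullet> b) *\<^sub>R frechet_derivative g (at (f x)) b)"
        using lin[OF x] by (simp add: linear_sum linear_cmul)
      then show ?thesis by (simp add: euclidean_representation)
    qed
    ultimately show "((\<lambda>x. g (f x)) has_derivative (\<lambda>v. \<Sum>b\<in>Basis.
        (frechet_derivative f (at x) v \<bullet> b) *\<^sub>R frechet_derivative g (at (f x)) b)) (at x)"
      by (simp add: o_def)
  next
    fix v
    show "Ck_on k U (\<lambda>x. \<Sum>b\<in>Basis. (frechet_derivative f (at x) v \<bullet> b) *\<^sub>R
        frechet_derivative g (at (f x)) b)"
    proof (intro Ck_on_sum[OF assms(1)] Ck_on_bilinear[OF assms(1) bounded_bilinear_scaleR])
      fix b :: 'b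
      show "Ck_on k U (\<lambda>x. frechet_derivative f (at x) v \<bullet> b)"
        by (rule Ck_on_bounded_linear_compose[OF assms(1) bounded_linear_inner_left])
           (use Suc.prems in auto)
      show "Ck_on k U (\<lambda>x. frechet_derivative g (at (f x)) b)"
        by (rule Suc.IH[OF Ck_on_Suc_imp[OF Suc.prems(1)]]) (use Suc.prems(2) in auto)
    qed
  qed
qed

lemma smooth_on_compose:
  assumes "open U" "open V" "f ` U \<subseteq> V" "smooth_on U f" "smooth_on V g"
  shows "smooth_on U (\<lambda>x. g (f x))"
  using assms unfolding smooth_on_def by (blast intro: Ck_on_compose)

lemma smooth_on_derivative:
  assumes "smooth_on U f"
  shows "x \<in> U \<Longrightarrow> (f has_derivative frechet_derivative f (at x)) (at x)"
    "smooth_on U (\<lambda>x. frechet_derivative f (at x) v)"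
  using assms Ck_on_SucD[of 0 U f x] Ck_on.simps(2) unfolding smooth_on_def by blast+

section \<open>Straightening the level sets of a function\<close>

text \<open>
The inverse function theorem for the map that overwrites the coordinate \<open>\<pi> x\<close> by the value \<open>G x\<close>;
\<open>\<iota>\<close> inserts a coordinate and \<open>\<pi>\<close> reads it. As the derivative of \<open>G\<close> is linear over \<open>'k\<close> along \<open>\<iota>\<close>,
the linearized equation is solved by a single division in \<open>'k\<close>. The derivative of the inverse \<open>g\<close> is
therefore an explicit rational expression in derivatives of \<open>G\<close> at \<open>g y\<close>, from which \<open>g\<close> inherits
its smoothness by induction on the order.
\<close>
lemma straightening_chart:
  fixes G :: "'a::euclidean_space \<Rightarrow> 'k::{euclidean_space, real_normed_field}"
    and \<iota> :: "'k \<Rightarrow> 'a" and \<pi> :: "'a \<Rightarrow> 'k"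
  assumes G: "open U" "smooth_on U G" and x0: "x0 \<in> U"
    and lin: "bounded_linear \<iota>" "bounded_linear \<pi>" and retr: "\<And>k. \<pi> (\<iota> k) = k"
    and klin: "\<And>x k. x \<in> U \<Longrightarrow> frechet_derivative G (at x) (\<iota> k)
                 = k * frechet_derivative G (at x) (\<iota> 1)"
    and nz: "frechet_derivative G (at x0) (\<iota> 1) \<noteq> 0"
  obtains W g where "W \<subseteq> U" "x0 \<in> W"
    "ambient_chart W (\<lambda>x. x + \<iota> (G x - \<pi> x))"
    "\<forall>x\<in>W. g (x + \<iota> (G x - \<pi> x)) = x"
    "smooth_on ((\<lambda>x. x + \<iota> (G x - \<pi> x)) ` W) g"
    "\<forall>y\<in>(\<lambda>x. x + \<iota> (G x - \<pi> x)) ` W. g y \<in> W"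
    "\<forall>y\<in>(\<lambda>x. x + \<iota> (G x - \<pi> x)) ` W. g y + \<iota> (G (g y) - \<pi> (g y)) = y"
    "\<forall>y\<in>(\<lambda>x. x + \<iota> (G x - \<pi> x)) ` W. \<forall>w. frechet_derivative g (at y) w =
       w - \<iota> (\<pi> w) + \<iota> ((\<pi> w - frechet_derivative G (at (g y)) (w - \<iota> (\<pi> w)))
          * inverse (frechet_derivative G (at (g y)) (\<iota> 1)))"
proof -
  define \<phi> where "\<phi> x = x + \<iota> (G x - \<pi> x)" for x
  define D where "D x = frechet_derivative G (at x)" for x
  define q where "q x = D x (\<iota> 1)" for x
  have DG: "(G has_derivative D x) (at x)" if "x \<in> U" for x
    using smooth_on_derivative(1)[OF G(2) that] unfolding D_def .
  have Dsm: "smooth_on U (\<lambda>x. D x v)" for v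
    using smooth_on_derivative(2)[OF G(2)] unfolding D_def .
  have Dlin: "bounded_linear (D x)" if "x \<in> U" for x
    using DG[OF that] has_derivative_bounded_linear by blast
  define \<phi>' where "\<phi>' x v = v + \<iota> (D x v - \<pi> v)" for x v
  have D\<phi>: "(\<phi> has_derivative \<phi>' x) (at x)" if "x \<in> U" for x
    unfolding \<phi>_def \<phi>'_def using DG[OF that] lin
    by (auto intro!: derivative_eq_intros bounded_linear.has_derivative[OF lin(1)]
        bounded_linear_imp_has_derivative)
  have \<phi>lin: "bounded_linear (\<phi>' x)" if "x \<in> U" for x
    using D\<phi>[OF that] has_derivative_bounded_linear by blast
  have qcont: "continuous_on U q"
    using Dsm unfolding q_def smooth_on_def using Ck_on_imp_continuous_on by blast
  define U1 where "U1 = {x \<in> U. q x \<noteq> 0}"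
  have U1: "open U1" "x0 \<in> U1" "U1 \<subseteq> U"
  proof -
    have "U1 = U \<inter> q -` (- {0})" unfolding U1_def by auto
    then show "open U1" using continuous_open_preimage[OF qcont G(1)] by auto
    show "x0 \<in> U1" "U1 \<subseteq> U" using x0 nz unfolding U1_def q_def D_def by auto
  qed
  \<comment> \<open>The solution \<open>v\<close> of \<open>\<phi>' x v = w\<close>: the part of \<open>w\<close> outside the range of \<open>\<iota>\<close> is kept, and the
    component along \<open>\<iota>\<close> follows from the equation \<open>D x v = \<pi> w\<close>.\<close>
  define \<psi> where "\<psi> x w = w - \<iota> (\<pi> w) + \<iota> ((\<pi> w - D x (w - \<iota> (\<pi> w))) * inverse (q x))" for x w
  have D\<iota>: "D x (\<iota> k) = k * q x" if "x \<in> U" for x k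
    unfolding D_def q_def by (rule klin[OF that])
  note L = linear_add linear_diff
  have lin': "linear \<iota>" "linear \<pi>" by (rule bounded_linear.linear, rule lin)+
  have Dl: "linear (D x)" if "x \<in> U" for x by (rule bounded_linear.linear[OF Dlin[OF that]])
  have inv1: "\<psi> x (\<phi>' x v) = v" if "x \<in> U1" for x v
  proof -
    have x: "x \<in> U" "q x \<noteq> 0" using that U1_def by auto
    have p: "\<pi> (\<phi>' x v) = D x v"
      unfolding \<phi>'_def by (simp add: L[OF lin'(2)] L[OF lin'(1)] retr)
    have w: "\<phi>' x v - \<iota> (\<pi> (\<phi>' x v)) = v - \<iota> (\<pi> v)"
      unfolding p unfolding \<phi>'_def by (simp add: L[OF lin'(1)])
    have "\<psi> x (\<phi>' x v) = v - \<iota> (\<pi> v) + \<iota> ((D x v - D x (v - \<iota> (\<pi> v))) * inverse (q x))"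
      unfolding \<psi>_def w unfolding p ..
    also have "\<dots> = v" using x by (simp add: L[OF Dl[OF x(1)]] D\<iota> mult.assoc)
    finally show ?thesis .
  qed
  have inv2: "\<phi>' x (\<psi> x w) = w" if "x \<in> U1" for x w
  proof -
    have x: "x \<in> U" "q x \<noteq> 0" using that U1_def by auto
    define r where "r = (\<pi> w - D x (w - \<iota> (\<pi> w))) * inverse (q x)"
    have "D x (\<psi> x w) = D x (w - \<iota> (\<pi> w)) + r * q x"
      unfolding \<psi>_def r_def[symmetric] using x by (simp add: L(1)[OF Dl[OF x(1)]] D\<iota>)
    also have "\<dots> = \<pi> w" unfolding r_def using x by (simp add: mult.assoc)
    finally have 1: "D x (\<psi> x w) = \<pi> w" .
    have 2: "\<pi> (\<psi> x w) = r"
      unfolding \<psi>_def r_def[symmetric] by (simp add: L[OF lin'(2)] retr)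
    show ?thesis unfolding \<phi>'_def 1 2
      unfolding \<psi>_def r_def[symmetric] by (simp add: L[OF lin'(1)])
  qed
  define F where "F x = Blinfun (\<phi>' x)" for x
  have Fapp: "blinfun_apply (F x) = \<phi>' x" if "x \<in> U" for x
    unfolding F_def using \<phi>lin[OF that] bounded_linear_Blinfun_apply by blast
  have contF: "continuous_on U1 F"
  proof (rule continuous_on_blinfun_componentwise)
    fix i :: 'a assume "i \<in> Basis"
    have "continuous_on U1 (\<lambda>x. D x i)"
      using Dsm U1(3) unfolding smooth_on_def
      by (meson Ck_on_imp_continuous_on continuous_on_subset)
    then have "continuous_on U1 (\<lambda>x. \<phi>' x i)"
      unfolding \<phi>'_def by (intro continuous_intros bounded_linear.continuous_on[OF lin(1)])
    then show "continuous_on U1 (\<lambda>x. blinfun_apply (F x) i)"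
      by (rule continuous_on_eq) (use U1(3) Fapp in auto)
  qed
  have \<psi>lin: "bounded_linear (\<psi> x0)"
  proof -
    have w: "bounded_linear (\<lambda>w. w - \<iota> (\<pi> w))"
      by (intro bounded_linear_sub bounded_linear_ident bounded_linear_compose[OF lin(1) lin(2)])
    show ?thesis unfolding \<psi>_def
      by (intro bounded_linear_add w bounded_linear_compose[OF lin(1)] bounded_linear_mult_const
          bounded_linear_sub lin(2) bounded_linear_compose[OF Dlin[OF x0] w])
  qed
  have invF: "Blinfun (\<psi> x0) o\<^sub>L F x0 = id_blinfun"
    by (rule blinfun_eqI)
      (simp add: Fapp[OF x0] bounded_linear_Blinfun_apply[OF \<psi>lin] inv1[OF U1(2)])
  obtain W V g g' where W: "open W" "W \<subseteq> U1" "x0 \<in> W" "open V" "\<phi> x0 \<in> V"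
    "homeomorphism W V \<phi> g" "\<And>y. y \<in> V \<Longrightarrow> (g has_derivative g' y) (at y)"
    "\<And>y. y \<in> V \<Longrightarrow> g' y = inv (blinfun_apply (F (g y)))"
  proof (rule inverse_function_theorem[OF U1(1) _ contF U1(2) invF])
    show "(\<phi> has_derivative blinfun_apply (F x)) (at x)" if "x \<in> U1" for x
    proof -
      have "x \<in> U" using that U1(3) by blast
      then show ?thesis using D\<phi> Fapp by simp
    qed
  next
    fix W V g g'
    assume a: "open W" "W \<subseteq> U1" "x0 \<in> W" "open V" "\<phi> x0 \<in> V"
      "homeomorphism W V \<phi> g" "\<And>y. y \<in> V \<Longrightarrow> (g has_derivative g' y) (at y)"
      "\<And>y. y \<in> V \<Longrightarrow> g' y = inv (blinfun_apply (F (g y)))"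
    show thesis by (rule that[OF a])
  qed
  have V: "V = \<phi> ` W" using W(6) homeomorphism_image1 by blast
  have gW: "g y \<in> W" if "y \<in> V" for y using W(6) that homeomorphism_image2 by blast
  have g\<phi>: "g (\<phi> x) = x" if "x \<in> W" for x using W(6) that homeomorphism_apply1 by blast
  have \<phi>g: "\<phi> (g y) = y" if "y \<in> V" for y using W(6) that homeomorphism_apply2 by blast
  have g': "g' y = \<psi> (g y)" if "y \<in> V" for y
  proof -
    have "g y \<in> U1" using gW[OF that] W(2) by blast
    moreover from this have "g y \<in> U" using U1(3) by blast
    ultimately have "inv (\<phi>' (g y)) = \<psi> (g y)"
      using inv1 inv2 by (intro inv_equality) auto
    then show ?thesis using W(8)[OF that] Fapp[OF \<open>g y \<in> U\<close>] by simp
  qed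
  have Dg: "(g has_derivative \<psi> (g y)) (at y)" if "y \<in> V" for y
    using W(7)[OF that] g'[OF that] by simp
  have gimg: "g ` V \<subseteq> U1" using gW W(2) by blast
  have gC: "Ck_on k V g" for k
  proof (induction k)
    case 0
    then show ?case using W(6) homeomorphism_cont2 by auto
  next
    case (Suc k)
    show ?case
    proof (rule Ck_on_SucI[OF W(4) Dg])
      fix w
      have D1: "Ck_on k V (\<lambda>y. D (g y) v)" for v
        by (rule Ck_on_compose[OF W(4) U1(1) gimg Suc])
          (use Dsm U1(3) in \<open>auto simp: smooth_on_def intro: Ck_on_subset\<close>)
      have "Ck_on k V (\<lambda>y. (\<pi> w - D (g y) (w - \<iota> (\<pi> w))) * inverse (q (g y)))"
      proof (intro Ck_on_mult Ck_on_inverse W(4))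
        have "Ck_on k V (\<lambda>y. \<pi> w + - D (g y) (w - \<iota> (\<pi> w)))"
          by (intro Ck_on_add W(4) Ck_on_const D1
              Ck_on_bounded_linear_compose[OF W(4) bounded_linear_minus[OF bounded_linear_ident]])
        then show "Ck_on k V (\<lambda>y. \<pi> w - D (g y) (w - \<iota> (\<pi> w)))" by simp
        show "Ck_on k V (\<lambda>y. q (g y))" unfolding q_def by (rule D1)
        show "q (g y) \<noteq> 0" if "y \<in> V" for y using gimg that U1_def by auto
      qed
      then show "Ck_on k V (\<lambda>y. \<psi> (g y) w)" unfolding \<psi>_def
        by (intro Ck_on_add W(4) Ck_on_const Ck_on_bounded_linear_compose[OF W(4) lin(1)])
    qed
  qed
  have inj: "inj_on \<phi> W" using g\<phi> inj_on_inverseI by metis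
  have chart: "ambient_chart W \<phi>"
    unfolding ambient_chart_def
  proof (intro conjI)
    show "open W" "open (\<phi> ` W)" "inj_on \<phi> W" using W V inj by auto
    show "smooth_on W \<phi>" unfolding smooth_on_def
    proof
      fix k
      have "Ck_on k W G" using G W(2) U1(3) unfolding smooth_on_def by (meson Ck_on_subset subset_trans)
      then have "Ck_on k W (\<lambda>x. G x + - \<pi> x)"
        by (rule Ck_on_add[OF W(1) _ Ck_on_bounded_linear[OF W(1) bounded_linear_minus[OF lin(2)]]])
      then show "Ck_on k W \<phi>" unfolding \<phi>_def
        by (intro Ck_on_add[OF W(1) Ck_on_bounded_linear[OF W(1) bounded_linear_ident]]
            Ck_on_bounded_linear_compose[OF W(1) lin(1)]) simp
    qed
    show "smooth_on (\<phi> ` W) (inv_into W \<phi>)" unfolding smooth_on_def V[symmetric]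
    proof
      fix k
      show "Ck_on k V (inv_into W \<phi>)"
        by (rule Ck_on_cong[OF W(4) _ gC])
          (metis V \<phi>g f_inv_into_f g\<phi> gW inv_into_into)
    qed
  qed
  have \<phi>eq: "\<phi> = (\<lambda>x. x + \<iota> (G x - \<pi> x))" unfolding \<phi>_def ..
  show ?thesis
  proof (rule that[of W g, folded \<phi>eq V])
    show "W \<subseteq> U" using W(2) U1(3) by blast
    show "x0 \<in> W" "ambient_chart W \<phi>" by fact+
    show "\<forall>x\<in>W. g (x + \<iota> (G x - \<pi> x)) = x" using g\<phi> unfolding \<phi>_def by blast
    show "smooth_on V g" using gC unfolding smooth_on_def by blast
    show "\<forall>y\<in>V. g y \<in> W" using gW by blast
    show "\<forall>y\<in>V. g y + \<iota> (G (g y) - \<pi> (g y)) = y" using \<phi>g unfolding \<phi>_def by blast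
    have "frechet_derivative g (at y) w =
       w - \<iota> (\<pi> w) + \<iota> ((\<pi> w - frechet_derivative G (at (g y)) (w - \<iota> (\<pi> w)))
          * inverse (frechet_derivative G (at (g y)) (\<iota> 1)))" if "y \<in> V" for y w
      using fun_cong[OF frechet_derivative_at[OF Dg[OF that]], of w]
      unfolding \<psi>_def D_def q_def by (rule sym)
    then show "\<forall>y\<in>V. \<forall>w. frechet_derivative g (at y) w =
       w - \<iota> (\<pi> w) + \<iota> ((\<pi> w - frechet_derivative G (at (g y)) (w - \<iota> (\<pi> w)))
          * inverse (frechet_derivative G (at (g y)) (\<iota> 1)))" by blast
  qed
qed

section \<open>Homogenized polynomials\<close>

definition monomials_le :: "nat \<Rightarrow> ('n::finite \<Rightarrow>\<^sub>0 nat) set" where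
  "monomials_le d = {m. monomial_degree m \<le> d}"

lemma monomial_degree_UNIV:
  "monomial_degree m = (\<Sum>i\<in>UNIV. Poly_Mapping.lookup m i)" for m :: "'n::finite \<Rightarrow>\<^sub>0 nat"
  unfolding monomial_degree_def by (rule sum.mono_neutral_left) (auto simp: in_keys_iff)

lemma monomial_value_UNIV:
  "monomial_value x m = (\<Prod>i\<in>UNIV. x i ^ Poly_Mapping.lookup m i)" for m :: "'n::finite \<Rightarrow>\<^sub>0 nat"
  by (rule monomial_value_superset) auto

lemma finite_monomials_le: "finite (monomials_le d :: ('n::finite \<Rightarrow>\<^sub>0 nat) set)"
proof (rule finite_imageD)
  show "inj_on Poly_Mapping.lookup (monomials_le d)" by (simp add: inj_on_def)
  have "Poly_Mapping.lookup ` (monomials_le d :: ('n \<Rightarrow>\<^sub>0 nat) set) \<subseteq> {f. \<forall>i. (i \<in> UNIV \<longrightarrow> f i \<in> {..d}) \<and> (i \<notin> UNIV \<longrightarrow> f i = 0)}"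
  proof (rule image_subsetI)
    fix m :: "'n \<Rightarrow>\<^sub>0 nat" assume m: "m \<in> monomials_le d"
    have "Poly_Mapping.lookup m i \<le> monomial_degree m" for i
      unfolding monomial_degree_UNIV by (rule member_le_sum) auto
    then show "Poly_Mapping.lookup m \<in> {f. \<forall>i. (i \<in> UNIV \<longrightarrow> f i \<in> {..d}) \<and> (i \<notin> UNIV \<longrightarrow> f i = 0)}"
      using m unfolding monomials_le_def by (auto intro: order_trans)
  qed
  then show "finite (Poly_Mapping.lookup ` (monomials_le d :: ('n \<Rightarrow>\<^sub>0 nat) set))"
    by (rule finite_subset) (rule finite_set_of_finite_funs; simp)
qed

lemma polys_le_iff_keys: "p \<in> polys_le d \<longleftrightarrow> Poly_Mapping.keys p \<subseteq> monomials_le d"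
  unfolding polys_le_def monomials_le_def by auto

lemma monomial_degree_add: "monomial_degree (m + m') = monomial_degree m + monomial_degree m'"
  for m m' :: "'n::finite \<Rightarrow>\<^sub>0 nat"
  by (simp add: monomial_degree_UNIV lookup_add sum.distrib)

lemma monomial_degree_single [simp]: "monomial_degree (Poly_Mapping.single i e) = e"
  for i :: "'n::finite"
  by (simp add: monomial_degree_UNIV lookup_single when_def)

lemma monomial_degree_0 [simp]: "monomial_degree 0 = 0"
  by (simp add: monomial_degree_def)

lemma minus_single_plus:
  fixes m :: "'n \<Rightarrow>\<^sub>0 nat"
  assumes "Poly_Mapping.lookup m i \<ge> 1"
  shows "m = (m - Poly_Mapping.single i 1) + Poly_Mapping.single i 1"
  by (rule poly_mapping_eqI) (use assms in \<open>auto simp: lookup_add lookup_minus lookup_single when_def\<close>)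

lemma monomial_degree_minus_single:
  fixes m :: "'n::finite \<Rightarrow>\<^sub>0 nat"
  assumes "Poly_Mapping.lookup m i \<ge> 1"
  shows "monomial_degree m = Suc (monomial_degree (m - Poly_Mapping.single i 1))"
  using arg_cong[OF minus_single_plus[OF assms], of monomial_degree]
  by (simp add: monomial_degree_add)

lemma monomial_value_single [simp]: "monomial_value x (Poly_Mapping.single i e) = x i ^ e"
  by (simp add: monomial_value_def)

lemma monomial_value_0 [simp]: "monomial_value x 0 = 1"
  by (simp add: monomial_value_def)

lemma monomial_value_scale:
  fixes m :: "'n::finite \<Rightarrow>\<^sub>0 nat"
  assumes "\<And>i. x' i = k * x i"
  shows "monomial_value x' m = k ^ monomial_degree m * monomial_value x m"
  unfolding monomial_value_UNIV monomial_degree_UNIV assms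
  by (simp add: power_mult_distrib prod.distrib power_sum)

text \<open>
The homogenization of degree \<open>d\<close> at the point \<open>(\<mu>, z)\<close>. The coefficients are given by an arbitrary
function on monomials, so that linear families of polynomials are formed pointwise.
\<close>
definition homog :: "nat \<Rightarrow> (('n::finite \<Rightarrow>\<^sub>0 nat) \<Rightarrow> 'k::comm_semiring_1) \<Rightarrow> 'k \<Rightarrow> 'k ^ 'n \<Rightarrow> 'k" where
  "homog d c \<mu> z = (\<Sum>m\<in>monomials_le d. c m * \<mu> ^ (d - monomial_degree m) * monomial_value (($) z) m)"

text \<open>
The partial derivative of the homogenization in the direction of \<open>z $ i\<close>. Where the subtraction of
exponents truncates, the factor \<open>of_nat\<close> is zero.
\<close>
definition homog_deriv :: "nat \<Rightarrow> (('n::finite \<Rightarrow>\<^sub>0 nat) \<Rightarrow> 'k::comm_semiring_1) \<Rightarrow> 'n \<Rightarrow> 'k \<Rightarrow> 'k ^ 'n \<Rightarrow> 'k" where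
  "homog_deriv d c i \<mu> z = (\<Sum>m\<in>monomials_le d. c m * \<mu> ^ (d - monomial_degree m) *
     (of_nat (Poly_Mapping.lookup m i) * monomial_value (($) z) (m - Poly_Mapping.single i 1)))"

text \<open>
The projective closure is smooth and transverse to the hyperplane at infinity. Derivatives in \<open>z\<close>
suffice: at a zero with \<open>\<mu> \<noteq> 0\<close>, Euler's relation expresses the derivative in \<open>\<mu>\<close> through them, and
at \<open>\<mu> = 0\<close> they describe smoothness of the section by the hyperplane at infinity.
\<close>
definition nondegenerate :: "nat \<Rightarrow> (('n::finite \<Rightarrow>\<^sub>0 nat) \<Rightarrow> 'k::comm_semiring_1) \<Rightarrow> bool" where
  "nondegenerate d c \<longleftrightarrow> (\<forall>\<mu> z. (\<mu> \<noteq> 0 \<or> z \<noteq> 0) \<longrightarrow> homog d c \<mu> z = 0 \<longrightarrow> (\<exists>i. homog_deriv d c i \<mu> z \<noteq> 0))"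

lemma peval_sum: "peval x (\<Sum>a\<in>A. f a) = (\<Sum>a\<in>A. peval x (f a))"
  by (induction A rule: infinite_finite_induct) (auto simp: peval_add)

lemma peval_eq_homog:
  assumes "p \<in> polys_le d"
  shows "peval (($) z) p = homog d (Poly_Mapping.lookup p) 1 z"
  using peval_superset[OF finite_monomials_le, of p d "($) z"] assms
  by (simp add: polys_le_iff_keys homog_def)

lemma peval_pderivative:
  assumes "p \<in> polys_le d"
  shows "peval (($) z) (pderivative i p) = homog_deriv d (Poly_Mapping.lookup p) i 1 z"
proof -
  have "peval (($) z) (pderivative i p) = (\<Sum>m\<in>Poly_Mapping.keys p. Poly_Mapping.lookup p m *
     (of_nat (Poly_Mapping.lookup m i) * monomial_value (($) z) (m - Poly_Mapping.single i 1)))"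
    unfolding pderivative_def peval_sum by (simp add: mult_ac)
  also have "\<dots> = homog_deriv d (Poly_Mapping.lookup p) i 1 z"
    unfolding homog_deriv_def
    by (simp, rule sum.mono_neutral_left) (use assms finite_monomials_le in \<open>auto simp: polys_le_iff_keys in_keys_iff\<close>)
  finally show ?thesis .
qed

lemma homog_scale:
  assumes "\<And>i. z' $ i = k * z $ i"
  shows "homog d c (k * \<mu>) z' = k ^ d * homog d c \<mu> z"
  unfolding homog_def sum_distrib_left
proof (rule sum.cong[OF refl])
  fix m :: "'a \<Rightarrow>\<^sub>0 nat" assume "m \<in> monomials_le d"
  then have "k ^ d = k ^ (d - monomial_degree m) * k ^ monomial_degree m"
    unfolding monomials_le_def by (simp flip: power_add)
  then show "c m * (k * \<mu>) ^ (d - monomial_degree m) * monomial_value (($) z') m =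
     k ^ d * (c m * \<mu> ^ (d - monomial_degree m) * monomial_value (($) z) m)"
    unfolding monomial_value_scale[of "($) z'", OF assms]
    by (simp add: power_mult_distrib mult_ac)
qed

lemma homog_deriv_scale:
  assumes "\<And>i. z' $ i = k * z $ i"
  shows "homog_deriv d c i (k * \<mu>) z' = k ^ (d - 1) * homog_deriv d c i \<mu> z"
  unfolding homog_deriv_def sum_distrib_left
proof (rule sum.cong[OF refl])
  fix m :: "'a \<Rightarrow>\<^sub>0 nat" assume m: "m \<in> monomials_le d"
  show "c m * (k * \<mu>) ^ (d - monomial_degree m) *
      (of_nat (Poly_Mapping.lookup m i) * monomial_value (($) z') (m - Poly_Mapping.single i 1)) =
     k ^ (d - 1) * (c m * \<mu> ^ (d - monomial_degree m) *
      (of_nat (Poly_Mapping.lookup m i) * monomial_value (($) z) (m - Poly_Mapping.single i 1)))"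
  proof (cases "Poly_Mapping.lookup m i = 0")
    case False
    then have "k ^ (d - 1) = k ^ (d - monomial_degree m) * k ^ monomial_degree (m - Poly_Mapping.single i 1)"
      using m monomial_degree_minus_single[of m i] unfolding monomials_le_def by (simp flip: power_add)
    then show ?thesis
      unfolding monomial_value_scale[of "($) z'", OF assms]
      by (simp add: power_mult_distrib mult_ac)
  qed simp
qed

lemma has_derivative_monomial:
  fixes z :: "'k::{real_normed_field, euclidean_space} ^ 'n::finite"
  shows "((\<lambda>z. monomial_value (($) z) m) has_derivative
    (\<lambda>v. \<Sum>i\<in>UNIV. v $ i * (of_nat (Poly_Mapping.lookup m i) *
       monomial_value (($) z) (m - Poly_Mapping.single i 1)))) (at z)"
proof -
  have 1: "((\<lambda>z :: 'k ^ 'n. z $ i ^ e) has_derivative (\<lambda>v. of_nat e * v $ i * z $ i ^ (e - 1))) (at z)" for i e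
    by (rule has_derivative_power) (rule bounded_linear_imp_has_derivative[OF bounded_linear_vec_nth])
  have 2: "v $ i * (of_nat (Poly_Mapping.lookup m i) * monomial_value (($) z) (m - Poly_Mapping.single i 1))
    = of_nat (Poly_Mapping.lookup m i) * v $ i * z $ i ^ (Poly_Mapping.lookup m i - 1) *
       (\<Prod>j\<in>UNIV - {i}. z $ j ^ Poly_Mapping.lookup m j)" for i v
  proof -
    have "monomial_value (($) z) (m - Poly_Mapping.single i 1) =
       z $ i ^ (Poly_Mapping.lookup m i - 1) * (\<Prod>j\<in>UNIV - {i}. z $ j ^ Poly_Mapping.lookup m j)"
      unfolding monomial_value_UNIV
      by (subst prod.remove[of _ i]) (auto simp: lookup_minus lookup_single when_def intro!: prod.cong)
    then show ?thesis by (simp add: mult_ac)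
  qed
  show ?thesis unfolding monomial_value_UNIV[of _ m] 2
    by (rule has_derivative_prod) (rule 1)
qed

lemma has_derivative_homog:
  fixes z :: "'k::{real_normed_field, euclidean_space} ^ 'n::finite"
  shows "((homog d c \<mu>) has_derivative (\<lambda>v. \<Sum>i\<in>UNIV. v $ i * homog_deriv d c i \<mu> z)) (at z)"
proof -
  have "((\<lambda>z. \<Sum>m\<in>monomials_le d. (c m * \<mu> ^ (d - monomial_degree m)) * monomial_value (($) z) m) has_derivative
    (\<lambda>v. \<Sum>m\<in>monomials_le d. (c m * \<mu> ^ (d - monomial_degree m)) * (\<Sum>i\<in>UNIV. v $ i * (of_nat (Poly_Mapping.lookup m i) *
       monomial_value (($) z) (m - Poly_Mapping.single i 1))))) (at z)"
    by (intro has_derivative_sum has_derivative_mult_right has_derivative_monomial)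
  moreover have "(\<Sum>m\<in>monomials_le d. (c m * \<mu> ^ (d - monomial_degree m)) * (\<Sum>i\<in>UNIV. v $ i * (of_nat (Poly_Mapping.lookup m i) *
       monomial_value (($) z) (m - Poly_Mapping.single i 1)))) = (\<Sum>i\<in>UNIV. v $ i * homog_deriv d c i \<mu> z)" for v
    unfolding homog_deriv_def sum_distrib_left
    by (subst sum.swap) (simp add: mult_ac)
  ultimately show ?thesis unfolding homog_def[abs_def] by simp
qed

text \<open>
The pencil of the polynomials \<open>f + s * h\<close>, homogenized. The homogenizing parameter is real, because
it plays the role of the radial coordinate at infinity.
\<close>
definition pencil :: "nat \<Rightarrow> (('n::finite \<Rightarrow>\<^sub>0 nat) \<Rightarrow> 'k::{real_normed_field, euclidean_space}) \<Rightarrow>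
    (('n \<Rightarrow>\<^sub>0 nat) \<Rightarrow> 'k) \<Rightarrow> 'k \<times> real \<times> ('k ^ 'n) \<Rightarrow> 'k" where
  "pencil d f h = (\<lambda>(s, l, z). homog d (\<lambda>m. f m + s * h m) (of_real l) z)"

lemma smooth_pencil:
  fixes f h :: "('n::finite \<Rightarrow>\<^sub>0 nat) \<Rightarrow> 'k::{real_normed_field, euclidean_space}"
  shows "smooth_on UNIV (pencil d f h)"
  unfolding smooth_on_def
proof
  fix k
  have s: "Ck_on k UNIV (\<lambda>x :: 'k \<times> real \<times> ('k ^ 'n). fst x)"
    by (intro Ck_on_bounded_linear open_UNIV bounded_linear_fst)
  have l: "Ck_on k UNIV (\<lambda>x :: 'k \<times> real \<times> ('k ^ 'n). of_real (fst (snd x)) :: 'k)"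
    by (intro Ck_on_bounded_linear open_UNIV)
       (intro bounded_linear_compose[OF bounded_linear_of_real]
         bounded_linear_compose[OF bounded_linear_fst bounded_linear_snd])
  have z: "Ck_on k UNIV (\<lambda>x :: 'k \<times> real \<times> ('k ^ 'n). snd (snd x) $ i)" for i
    by (intro Ck_on_bounded_linear open_UNIV)
       (intro bounded_linear_compose[OF bounded_linear_vec_nth]
         bounded_linear_compose[OF bounded_linear_snd bounded_linear_snd])
  show "Ck_on k UNIV (pencil d f h)"
    unfolding pencil_def homog_def monomial_value_UNIV case_prod_unfold
    by (intro Ck_on_sum Ck_on_mult Ck_on_power Ck_on_prod Ck_on_add Ck_on_const s l z open_UNIV)
qed

text \<open>
Used to read off partial derivatives: \<open>j\<close> parametrizes an affine subspace through \<open>j z\<close>.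
\<close>
lemma frechet_derivative_along:
  assumes "F differentiable (at (j z))" "(j has_derivative J) (at z)"
    "((\<lambda>z. F (j z)) has_derivative D) (at z)"
  shows "frechet_derivative F (at (j z)) (J v) = D v"
proof -
  have "((F \<circ> j) has_derivative (frechet_derivative F (at (j z)) \<circ> J)) (at z)"
    using assms(1,2) by (intro diff_chain_at) (auto simp: frechet_derivative_works[symmetric])
  then show ?thesis
    using has_derivative_unique assms(3) unfolding o_def by metis
qed

lemma smooth_on_differentiable: "smooth_on U f \<Longrightarrow> x \<in> U \<Longrightarrow> f differentiable (at x)"
  unfolding smooth_on_def using Ck_on.simps(2)[of 0] by blast

lemma frechet_pencil:
  "frechet_derivative (pencil d f h) (at (s, l, z)) (0, 0, v)
     = (\<Sum>i\<in>UNIV. v $ i * homog_deriv d (\<lambda>m. f m + s * h m) i (of_real l) z)"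
proof -
  have "((\<lambda>z. pencil d f h (s, l, z)) has_derivative
     (\<lambda>v. \<Sum>i\<in>UNIV. v $ i * homog_deriv d (\<lambda>m. f m + s * h m) i (of_real l) z)) (at z)"
    unfolding pencil_def using has_derivative_homog by simp
  moreover have "((\<lambda>z. (s, l, z)) has_derivative (\<lambda>v. (0, 0, v))) (at z)"
    by (intro derivative_eq_intros has_derivative_Pair) auto
  moreover have "pencil d f h differentiable (at (s, l, z))"
    by (rule smooth_on_differentiable[OF smooth_pencil]) simp
  ultimately show ?thesis
    using frechet_derivative_along[of "pencil d f h" "\<lambda>z. (s, l, z)" z "\<lambda>v. (0, 0, v)"] by blast
qed

lemma frechet_pencil_axis:
  "frechet_derivative (pencil d f h) (at (s, l, z)) (0, 0, axis i k)
     = k * homog_deriv d (\<lambda>m. f m + s * h m) i (of_real l) z"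
proof -
  have "(\<Sum>j\<in>UNIV. axis i k $ j * homog_deriv d (\<lambda>m. f m + s * h m) j (of_real l) z)
     = (\<Sum>j\<in>UNIV. if j = i then k * homog_deriv d (\<lambda>m. f m + s * h m) i (of_real l) z else 0)"
    by (rule sum.cong) (auto simp: axis_def)
  then show ?thesis unfolding frechet_pencil by simp
qed

section \<open>Points joined by short paths\<close>

text \<open>
Being joined by a path of length at most \<open>M\<close>. Letting a path of speed at most one run over
\<open>[0, M]\<close> makes lengths add up under concatenation without any re-parametrization.
\<close>
definition joined :: "'e::metric_space set \<Rightarrow> real \<Rightarrow> 'e \<Rightarrow> 'e \<Rightarrow> bool" where
  "joined S M x y \<longleftrightarrow> 0 \<le> M \<and> (\<exists>\<gamma>. \<gamma> 0 = x \<and> \<gamma> M = y \<and> \<gamma> ` {0..M} \<subseteq> S \<and> 1-lipschitz_on {0..M} \<gamma>)"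

lemma joined_in: "joined S M x y \<Longrightarrow> x \<in> S \<and> y \<in> S"
  unfolding joined_def by force

lemma joined_refl: "x \<in> S \<Longrightarrow> 0 \<le> M \<Longrightarrow> joined S M x x"
  unfolding joined_def by (intro conjI exI[of _ "\<lambda>_. x"]) (auto intro!: lipschitz_onI)

lemma joined_sym:
  assumes "joined S M x y" shows "joined S M y x"
proof -
  obtain \<gamma> where g: "0 \<le> M" "\<gamma> 0 = x" "\<gamma> M = y" "\<gamma> ` {0..M} \<subseteq> S" "1-lipschitz_on {0..M} \<gamma>"
    using assms unfolding joined_def by blast
  have "dist (\<gamma> (M - a)) (\<gamma> (M - b)) \<le> 1 * dist a b" if "a \<in> {0..M}" "b \<in> {0..M}" for a b
    using lipschitz_onD[OF g(5), of "M - a" "M - b"] that by (auto simp: dist_real_def)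
  then show ?thesis unfolding joined_def
    using g by (intro conjI exI[of _ "\<lambda>t. \<gamma> (M - t)"]) (auto intro!: lipschitz_onI)
qed

lemma joined_trans:
  assumes "joined S M x y" "joined S M' y z" shows "joined S (M + M') x z"
proof -
  obtain \<gamma> where g: "0 \<le> M" "\<gamma> 0 = x" "\<gamma> M = y" "\<gamma> ` {0..M} \<subseteq> S" "1-lipschitz_on {0..M} \<gamma>"
    using assms unfolding joined_def by blast
  obtain \<delta> where d: "0 \<le> M'" "\<delta> 0 = y" "\<delta> M' = z" "\<delta> ` {0..M'} \<subseteq> S" "1-lipschitz_on {0..M'} \<delta>"
    using assms unfolding joined_def by blast
  define \<epsilon> where "\<epsilon> t = (if t \<le> M then \<gamma> t else \<delta> (t - M))" for t
  have "dist (\<delta> (a - M)) (\<delta> (b - M)) \<le> 1 * dist a b" if "a \<in> {M..M+M'}" "b \<in> {M..M+M'}" for a b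
    using lipschitz_onD[OF d(5), of "a - M" "b - M"] that by (auto simp: dist_real_def)
  then have "1-lipschitz_on {M..M+M'} (\<lambda>t. \<delta> (t - M))" by (intro lipschitz_onI) auto
  then have "1-lipschitz_on {0..M+M'} \<epsilon>" unfolding \<epsilon>_def
    by (intro lipschitz_on_concat g(5)) (use g d in auto)
  moreover have "\<epsilon> t \<in> S" if "t \<in> {0..M+M'}" for t
  proof (cases "t \<le> M")
    case True
    then have "\<gamma> t \<in> \<gamma> ` {0..M}" using that by auto
    then show ?thesis using g(4) True unfolding \<epsilon>_def by auto
  next
    case False
    then have "\<delta> (t - M) \<in> \<delta> ` {0..M'}" using that by auto
    then show ?thesis using d(4) False unfolding \<epsilon>_def by auto
  qed
  moreover have "\<epsilon> 0 = x" "\<epsilon> (M + M') = z"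
    using g(1,2,3) d(1,2,3) unfolding \<epsilon>_def by (cases "M' = 0"; auto)+
  ultimately show ?thesis unfolding joined_def using g(1) d(1) by (intro conjI exI[of _ \<epsilon>]) auto
qed

lemma joined_mono:
  assumes "joined S M x y" "M \<le> M'" shows "joined S M' x y"
  using joined_trans[OF assms(1) joined_refl[of y S "M' - M"]] joined_in[OF assms(1)] assms(2) by simp

lemma joined_component:
  assumes "joined Z M x y" "x \<in> C" "C \<in> components Z"
  shows "joined C M x y"
proof -
  obtain \<gamma> where g: "0 \<le> M" "\<gamma> 0 = x" "\<gamma> M = y" "\<gamma> ` {0..M} \<subseteq> Z" "1-lipschitz_on {0..M} \<gamma>"
    using assms unfolding joined_def by blast
  have "connected (\<gamma> ` {0..M})"
    by (intro connected_continuous_image lipschitz_on_continuous_on[OF g(5)]) simp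
  moreover have "C \<inter> \<gamma> ` {0..M} \<noteq> {}" using assms(2) g(1,2) by force
  ultimately have "\<gamma> ` {0..M} \<subseteq> C"
    using components_maximal[OF assms(3)] g(4) by blast
  then show ?thesis unfolding joined_def using g by blast
qed

lemma joined_lipschitz:
  assumes "F 0 = x" "F 1 = y" "F ` {0..1} \<subseteq> S" "M-lipschitz_on {0..1::real} F"
  shows "joined S M x y"
proof (cases "M = 0")
  case True
  then have "x = y" using lipschitz_onD[OF assms(4), of 0 1] assms(1,2) by simp
  then show ?thesis using joined_refl[of x S M] assms True by force
next
  case False
  then have M: "M > 0" using lipschitz_on_nonneg[OF assms(4)] by simp
  have "dist (F (a / M)) (F (b / M)) \<le> 1 * dist a b" if "a \<in> {0..M}" "b \<in> {0..M}" for a b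
  proof -
    have "dist (F (a / M)) (F (b / M)) \<le> M * dist (a / M) (b / M)"
      using that M by (intro lipschitz_onD[OF assms(4)]) auto
    also have "\<dots> = dist a b" using M by (simp add: dist_real_def field_simps flip: diff_divide_distrib)
    finally show ?thesis by simp
  qed
  then have "1-lipschitz_on {0..M} (\<lambda>t. F (t / M))" by (intro lipschitz_onI) auto
  moreover have "(\<lambda>t. F (t / M)) ` {0..M} \<subseteq> S"
  proof (rule image_subsetI)
    fix t assume "t \<in> {0..M}"
    then have "F (t / M) \<in> F ` {0..1}" using M by (intro imageI) auto
    then show "F (t / M) \<in> S" using assms(3) by blast
  qed
  ultimately show ?thesis unfolding joined_def using M assms(1,2)
    by (intro conjI exI[of _ "\<lambda>t. F (t / M)"]) auto
qed

lemma joined_image: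
  assumes "joined S M x y" "K-lipschitz_on S F" "F ` S \<subseteq> T"
  shows "joined T (K * M) (F x) (F y)"
proof -
  obtain \<gamma> where g: "0 \<le> M" "\<gamma> 0 = x" "\<gamma> M = y" "\<gamma> ` {0..M} \<subseteq> S" "1-lipschitz_on {0..M} \<gamma>"
    using assms unfolding joined_def by blast
  have K: "K \<ge> 0" using lipschitz_on_nonneg[OF assms(2)] .
  have tM: "t * M \<in> {0..M}" if "t \<in> {0..1}" for t
    using that g(1) by (auto intro: mult_left_le_one_le)
  have gS: "\<gamma> (t * M) \<in> S" if "t \<in> {0..1}" for t
    using tM[OF that] g(4) by blast
  have "dist (F (\<gamma> (a * M))) (F (\<gamma> (b * M))) \<le> K * M * dist a b" if "a \<in> {0..1}" "b \<in> {0..1}" for a b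
  proof -
    have "dist (F (\<gamma> (a * M))) (F (\<gamma> (b * M))) \<le> K * dist (\<gamma> (a * M)) (\<gamma> (b * M))"
      by (rule lipschitz_onD[OF assms(2)]) (use gS that in auto)
    also have "\<dots> \<le> K * (1 * dist (a * M) (b * M))"
      by (intro mult_left_mono lipschitz_onD[OF g(5)] K tM that)
    also have "\<dots> = K * M * dist a b"
      using g(1) by (simp add: dist_real_def abs_mult flip: left_diff_distrib)
    finally show ?thesis .
  qed
  then have "(K * M)-lipschitz_on {0..1} (\<lambda>t. F (\<gamma> (t * M)))"
    using K g(1) by (intro lipschitz_onI) auto
  then show ?thesis
    by (rule joined_lipschitz[rotated -1]) (use g gS assms(3) in auto)
qed

lemma inner_dist_joined:
  assumes "joined S M x y"
  shows "inner_dist S x y \<le> ennreal M"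
proof -
  obtain \<gamma>0 where g0: "0 \<le> M" "\<gamma>0 0 = x" "\<gamma>0 M = y" "\<gamma>0 ` {0..M} \<subseteq> S" "1-lipschitz_on {0..M} \<gamma>0"
    using assms unfolding joined_def by blast
  define \<gamma> where "\<gamma> t = \<gamma>0 (t * M)" for t
  have tM: "t * M \<in> {0..M}" if "t \<in> {0..1}" for t
    using that g0(1) by (auto intro: mult_left_le_one_le)
  have lip: "dist (\<gamma> a) (\<gamma> b) \<le> M * dist a b" if "a \<in> {0..1}" "b \<in> {0..1}" for a b
  proof -
    have "dist (\<gamma> a) (\<gamma> b) \<le> 1 * dist (a * M) (b * M)"
      unfolding \<gamma>_def by (intro lipschitz_onD[OF g0(5)] tM that)
    also have "\<dots> = dist a b * M"
      using g0(1) by (simp add: dist_real_def abs_mult flip: left_diff_distrib)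
    finally show ?thesis by (simp add: mult.commute)
  qed
  have "M-lipschitz_on {0..1} \<gamma>" using lip g0(1) by (intro lipschitz_onI) auto
  then have path: "path \<gamma>" unfolding path_def by (rule lipschitz_on_continuous_on)
  have len: "path_length \<gamma> \<le> ennreal M"
    unfolding path_length_def
  proof (rule SUP_least, clarify)
    fix t :: "nat \<Rightarrow> real" and k :: nat
    assume t: "mono t" "range t \<subseteq> {0..1}"
    have "(\<Sum>i<k. ennreal (dist (\<gamma> (t i)) (\<gamma> (t (Suc i))))) = ennreal (\<Sum>i<k. dist (\<gamma> (t i)) (\<gamma> (t (Suc i))))"
      by (simp add: sum_ennreal)
    also have "(\<Sum>i<k. dist (\<gamma> (t i)) (\<gamma> (t (Suc i)))) \<le> (\<Sum>i<k. M * (t (Suc i) - t i))"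
    proof (rule sum_mono)
      fix i
      have "t i \<le> t (Suc i)" using t(1) by (simp add: mono_def)
      then show "dist (\<gamma> (t i)) (\<gamma> (t (Suc i))) \<le> M * (t (Suc i) - t i)"
        using lip[of "t i" "t (Suc i)"] t(2)[THEN subsetD, OF rangeI[of t i]]
          t(2)[THEN subsetD, OF rangeI[of t "Suc i"]] by (simp add: dist_real_def)
    qed
    also have "\<dots> = M * (t k - t 0)"
      unfolding sum_distrib_left[symmetric] by (simp add: sum_lessThan_telescope)
    also have "\<dots> \<le> M * 1"
    proof (rule mult_left_mono[OF _ g0(1)])
      have "t k \<in> {0..1}" "t 0 \<in> {0..1}" using t(2) by blast+
      then show "t k - t 0 \<le> 1" by auto
    qed
    finally show "(\<Sum>i<k. ennreal (dist (\<gamma> (t i)) (\<gamma> (t (Suc i))))) \<le> ennreal M"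
      by (simp add: ennreal_leI)
  qed
  have "rectifiable_path \<gamma>" unfolding rectifiable_path_def
    using path len by (auto simp: less_top[symmetric] top_unique)
  moreover have "path_image \<gamma> \<subseteq> S"
    unfolding path_image_def \<gamma>_def using tM g0(4) by blast
  moreover have "pathstart \<gamma> = x" "pathfinish \<gamma> = y"
    unfolding pathstart_def pathfinish_def \<gamma>_def using g0 by auto
  ultimately have "inner_dist S x y \<le> path_length \<gamma>"
    unfolding inner_dist_def by (intro INF_lower) auto
  then show ?thesis using len by (rule order_trans)
qed

lemma smooth_on_locally_lipschitz:
  fixes g :: "'a::euclidean_space \<Rightarrow> 'b::euclidean_space"
  assumes "open V" "smooth_on V g" "y \<in> V"
  obtains r L where "r > 0" "ball y r \<subseteq> V" "L-lipschitz_on (ball y r) g"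
proof -
  obtain r where r: "r > 0" "cball y r \<subseteq> V" using assms(1,3) open_contains_cball by blast
  have "\<exists>B. \<forall>x\<in>cball y r. norm (frechet_derivative g (at x) b) \<le> B" for b
  proof -
    have "smooth_on V (\<lambda>x. frechet_derivative g (at x) b)" by (rule smooth_on_derivative(2)[OF assms(2)])
    then have "continuous_on (cball y r) (\<lambda>x. frechet_derivative g (at x) b)"
      unfolding smooth_on_def using Ck_on_imp_continuous_on r(2) continuous_on_subset by blast
    then have "compact ((\<lambda>x. frechet_derivative g (at x) b) ` cball y r)"
      by (rule compact_continuous_image) simp
    then show ?thesis using compact_imp_bounded bounded_iff by (metis (no_types, lifting) image_eqI)
  qed
  then obtain B where B: "\<And>b x. x \<in> cball y r \<Longrightarrow> norm (frechet_derivative g (at x) b) \<le> B b"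
    by metis
  define L where "L = (\<Sum>b\<in>Basis. B b)"
  have d: "(g has_derivative frechet_derivative g (at x)) (at x)" if "x \<in> cball y r" for x
    using smooth_on_derivative(1)[OF assms(2)] that r(2) by blast
  have on: "onorm (frechet_derivative g (at x)) \<le> L" if x: "x \<in> cball y r" for x
  proof (rule onorm_le)
    fix v
    have lin: "linear (frechet_derivative g (at x))" using d[OF x] has_derivative_linear by blast
    have "frechet_derivative g (at x) v = frechet_derivative g (at x) (\<Sum>b\<in>Basis. (v \<bullet> b) *\<^sub>R b)"
      by (simp add: euclidean_representation)
    also have "\<dots> = (\<Sum>b\<in>Basis. (v \<bullet> b) *\<^sub>R frechet_derivative g (at x) b)"
      using lin by (simp add: linear_sum linear_cmul)
    also have "norm \<dots> \<le> (\<Sum>b\<in>Basis. norm v * B b)"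
      using B[OF x] by (intro sum_norm_le) (auto intro!: mult_mono simp: Basis_le_norm)
    also have "\<dots> = L * norm v" unfolding L_def by (simp add: sum_distrib_right mult.commute[of "norm v"])
    finally show "norm (frechet_derivative g (at x) v) \<le> L * norm v" .
  qed
  have "L \<ge> 0" using on[of y] r(1) onorm_pos_le[of "frechet_derivative g (at y)"]
      has_derivative_bounded_linear[OF d[of y]] by force
  moreover have "dist (g a) (g b) \<le> L * dist a b" if "a \<in> ball y r" "b \<in> ball y r" for a b
    unfolding dist_norm
    by (rule differentiable_bound[of "cball y r" g "\<lambda>x. frechet_derivative g (at x)"])
       (use that on d in \<open>auto intro: has_derivative_at_withinI\<close>)
  ultimately have "L-lipschitz_on (ball y r) g" by (intro lipschitz_onI)
  then show ?thesis using that[of r L] r ball_subset_cball by blast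
qed

section \<open>Local geometry of a pencil of hypersurfaces\<close>

lemma bounded_linear_axis: "bounded_linear (axis i :: 'k::euclidean_space \<Rightarrow> 'k ^ 'n::finite)"
proof -
  have "linear (axis i :: 'k \<Rightarrow> 'k ^ 'n)"
    by (rule linearI) (auto simp: vec_eq_iff axis_def)
  then show ?thesis using linear_linear by blast
qed

text \<open>
Where the \<open>i\<close>-th partial derivative is nonzero, the \<open>i\<close>-th coordinate of \<open>z\<close> can be traded for the value
of the form; \<open>s\<close>, \<open>l\<close> and the other coordinates stay. The formula for the derivative of \<open>g\<close> is implicit
differentiation: moving the \<open>j\<close>-th coordinate along a level set moves the \<open>i\<close>-th one at the rate of minus
the quotient of the partial derivatives.
\<close>
lemma pencil_chart:
  fixes f h :: "('n::finite \<Rightarrow>\<^sub>0 nat) \<Rightarrow> 'k::{real_normed_field, euclidean_space}"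
    and p0 :: "'k \<times> real \<times> ('k ^ 'n)"
  assumes nz: "homog_deriv d (\<lambda>m. f m + fst p0 * h m) i (of_real (fst (snd p0))) (snd (snd p0)) \<noteq> 0"
    and \<Phi>: "\<Phi> = (\<lambda>x. x + (0, 0, axis i (pencil d f h x - snd (snd x) $ i)))"
  obtains W g where "p0 \<in> W" "open W" "open (\<Phi> ` W)" "continuous_on W \<Phi>"
    "\<forall>x\<in>W. g (\<Phi> x) = x" "smooth_on (\<Phi> ` W) g" "\<forall>y\<in>\<Phi> ` W. \<Phi> (g y) = y"
    "\<forall>j. j \<noteq> i \<longrightarrow> frechet_derivative g (at (\<Phi> p0)) (0, 0, axis j 1) = (0, 0, axis j 1 - axis i
       (homog_deriv d (\<lambda>m. f m + fst p0 * h m) j (of_real (fst (snd p0))) (snd (snd p0))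
        / homog_deriv d (\<lambda>m. f m + fst p0 * h m) i (of_real (fst (snd p0))) (snd (snd p0))))"
proof -
  define \<iota> :: "'k \<Rightarrow> 'k \<times> real \<times> ('k ^ 'n)" where "\<iota> k = (0, 0, axis i k)" for k
  define \<pi> where "\<pi> x = snd (snd x) $ i" for x :: "'k \<times> real \<times> ('k ^ 'n)"
  have b\<iota>: "bounded_linear (\<iota> :: 'k \<Rightarrow> 'k \<times> real \<times> ('k ^ 'n))" unfolding \<iota>_def
    by (intro bounded_linear_Pair bounded_linear_zero bounded_linear_axis)
  have b\<pi>: "bounded_linear \<pi>" unfolding \<pi>_def
    by (intro bounded_linear_compose[OF bounded_linear_vec_nth]
         bounded_linear_compose[OF bounded_linear_snd bounded_linear_snd])
  have retr: "\<pi> (\<iota> k) = k" for k unfolding \<pi>_def \<iota>_def by simp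
  have der: "frechet_derivative (pencil d f h) (at x) (\<iota> k) =
     k * homog_deriv d (\<lambda>m. f m + fst x * h m) i (of_real (fst (snd x))) (snd (snd x))" for x k
    unfolding \<iota>_def by (cases x) (simp add: frechet_pencil_axis)
  have klin: "frechet_derivative (pencil d f h) (at x) (\<iota> k) = k * frechet_derivative (pencil d f h) (at x) (\<iota> 1)" for x k
    unfolding der by simp
  have nz': "frechet_derivative (pencil d f h) (at p0) (\<iota> 1) \<noteq> 0" unfolding der using nz by simp
  have \<Phi>': "\<Phi> = (\<lambda>x. x + \<iota> (pencil d f h x - \<pi> x))" unfolding \<Phi> \<iota>_def \<pi>_def ..
  obtain W g where W: "W \<subseteq> UNIV" "p0 \<in> W" "ambient_chart W \<Phi>"
    "\<forall>x\<in>W. g (\<Phi> x) = x" "smooth_on (\<Phi> ` W) g"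
    "\<forall>y\<in>\<Phi> ` W. g y \<in> W" "\<forall>y\<in>\<Phi> ` W. \<Phi> (g y) = y"
    and D: "\<forall>y\<in>\<Phi> ` W. \<forall>w. frechet_derivative g (at y) w =
       w - \<iota> (\<pi> w) + \<iota> ((\<pi> w - frechet_derivative (pencil d f h) (at (g y)) (w - \<iota> (\<pi> w)))
          * inverse (frechet_derivative (pencil d f h) (at (g y)) (\<iota> 1)))"
    by (rule straightening_chart[OF open_UNIV smooth_pencil UNIV_I b\<iota> b\<pi> retr klin nz'])
      (rule that; ((unfold \<Phi>')?, assumption))
  have cont: "continuous_on W \<Phi>" "open W" "open (\<Phi> ` W)"
    using W(3) unfolding ambient_chart_def smooth_on_def using Ck_on_imp_continuous_on by blast+
  have gp: "g (\<Phi> p0) = p0" "\<Phi> p0 \<in> \<Phi> ` W" using W(4)[rule_format, OF W(2)] W(2) by auto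
  obtain s l z where p0: "p0 = (s, l, z)" by (cases p0)
  have Dg: "frechet_derivative g (at (\<Phi> p0)) (0, 0, axis j 1) = (0, 0, axis j 1 - axis i
       (homog_deriv d (\<lambda>m. f m + fst p0 * h m) j (of_real (fst (snd p0))) (snd (snd p0))
        / homog_deriv d (\<lambda>m. f m + fst p0 * h m) i (of_real (fst (snd p0))) (snd (snd p0))))"
    if "j \<noteq> i" for j
  proof -
    have "\<pi> (0, 0, axis j 1) = 0" unfolding \<pi>_def using that by (simp add: axis_def)
    moreover have "\<iota> 0 = 0" unfolding \<iota>_def by (simp add: zero_prod_def)
    moreover have "\<iota> (- k) = - \<iota> k" for k using linear_neg[OF bounded_linear.linear[OF b\<iota>]] .
    ultimately show ?thesis unfolding D[rule_format, OF gp(2)] gp(1) der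
      by (simp add: \<iota>_def p0 frechet_pencil_axis divide_inverse)
  qed
  show ?thesis by (rule that[OF W(2) cont(2,3,1) W(4,5,7)]) (use Dg in blast)
qed

text \<open>
In the chart the zero sets for all pairs \<open>(s, l)\<close> become pieces of parallel coordinate planes. Segments
in the chart give the paths, with a Lipschitz constant that does not depend on \<open>(s, l)\<close>, and
setting the straightened coordinate to zero turns a point close to \<open>p0\<close> into a zero close to it.
\<close>
lemma
  fixes f h :: "('n::finite \<Rightarrow>\<^sub>0 nat) \<Rightarrow> 'k::{real_normed_field, euclidean_space}"
    and p0 :: "'k \<times> real \<times> ('k ^ 'n)"
  assumes nz: "homog_deriv d (\<lambda>m. f m + fst p0 * h m) i (of_real (fst (snd p0))) (snd (snd p0)) \<noteq> 0"
    and z: "pencil d f h p0 = 0"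
  shows pencil_local_joined: "\<exists>\<delta>>0. \<exists>L. \<forall>s l z z'. (s, l, z) \<in> ball p0 \<delta> \<longrightarrow> (s, l, z') \<in> ball p0 \<delta> \<longrightarrow>
      pencil d f h (s, l, z) = 0 \<longrightarrow> pencil d f h (s, l, z') = 0 \<longrightarrow>
      joined {w. pencil d f h (s, l, w) = 0} (L * dist z z') z z'" (is ?th1)
    and pencil_local_zero: "\<eta> > 0 \<Longrightarrow> \<exists>\<delta>>0. \<forall>s l z. (s, l, z) \<in> ball p0 \<delta> \<longrightarrow>
      (\<exists>z'. dist z' z < \<eta> \<and> pencil d f h (s, l, z') = 0)" (is "_ \<Longrightarrow> ?th2")
proof -
  define \<Phi> where "\<Phi> = (\<lambda>x. x + (0, 0, axis i (pencil d f h x - snd (snd x) $ i)))"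
  obtain W g where W: "p0 \<in> W" "open W" "open (\<Phi> ` W)" "continuous_on W \<Phi>"
    "\<forall>x\<in>W. g (\<Phi> x) = x" "smooth_on (\<Phi> ` W) g" "\<forall>y\<in>\<Phi> ` W. \<Phi> (g y) = y"
    by (rule pencil_chart[OF nz \<Phi>_def]) (rule that; assumption)
  have g: "fst (g y) = fst y" "fst (snd (g y)) = fst (snd y)" "pencil d f h (g y) = snd (snd y) $ i"
    if "y \<in> \<Phi> ` W" for y
    using arg_cong[OF W(7)[rule_format, OF that], of fst] arg_cong[OF W(7)[rule_format, OF that], of "\<lambda>x. fst (snd x)"]
      arg_cong[OF W(7)[rule_format, OF that], of "\<lambda>x. snd (snd x) $ i"]
    unfolding \<Phi>_def by auto
  have p0V: "\<Phi> p0 \<in> \<Phi> ` W" using W(1) by blast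
  obtain r L where r: "r > 0" "ball (\<Phi> p0) r \<subseteq> \<Phi> ` W" "L-lipschitz_on (ball (\<Phi> p0) r) g"
    using smooth_on_locally_lipschitz[OF W(3,6) p0V] by blast
  have "\<exists>\<delta>>0. ball p0 \<delta> \<subseteq> W \<and> \<Phi> ` ball p0 \<delta> \<subseteq> ball (\<Phi> p0) r"
  proof -
    have "open (W \<inter> \<Phi> -` ball (\<Phi> p0) r)" using W(2,4) continuous_open_preimage by blast
    moreover have "p0 \<in> W \<inter> \<Phi> -` ball (\<Phi> p0) r" using W(1) r(1) by simp
    ultimately obtain \<delta> where "\<delta> > 0" "ball p0 \<delta> \<subseteq> W \<inter> \<Phi> -` ball (\<Phi> p0) r"
      using open_contains_ball by blast
    then show ?thesis by blast
  qed
  then obtain \<delta> where \<delta>: "\<delta> > 0" "ball p0 \<delta> \<subseteq> W" "\<Phi> ` ball p0 \<delta> \<subseteq> ball (\<Phi> p0) r" by blast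
  show ?th1
  proof (rule exI[of _ \<delta>], rule conjI[OF \<delta>(1)], rule exI[of _ "L * 2"], intro allI impI)
    fix s l z z'
    assume b: "(s, l, z) \<in> ball p0 \<delta>" "(s, l, z') \<in> ball p0 \<delta>"
      and H: "pencil d f h (s, l, z) = 0" "pencil d f h (s, l, z') = 0"
    define y where "y t = \<Phi> (s, l, z) + t *\<^sub>R (\<Phi> (s, l, z') - \<Phi> (s, l, z))" for t :: real
    have e: "\<Phi> (s, l, z) = (s, l, z - axis i (z $ i))" "\<Phi> (s, l, z') = (s, l, z' - axis i (z' $ i))"
      unfolding \<Phi>_def using H by (auto simp: vec_eq_iff axis_def)
    have y: "y t \<in> ball (\<Phi> p0) r" if "t \<in> {0..1}" for t
    proof -
      have "\<Phi> (s, l, z) \<in> ball (\<Phi> p0) r" "\<Phi> (s, l, z') \<in> ball (\<Phi> p0) r" using \<delta>(3) b by blast+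
      then have "(1 - t) *\<^sub>R \<Phi> (s, l, z) + t *\<^sub>R \<Phi> (s, l, z') \<in> ball (\<Phi> p0) r"
        using that by (intro convexD[OF convex_ball]) auto
      moreover have "(1 - t) *\<^sub>R \<Phi> (s, l, z) + t *\<^sub>R \<Phi> (s, l, z') = y t"
        unfolding y_def by (simp add: algebra_simps)
      ultimately show ?thesis by simp
    qed
    have ye: "fst (y t) = s" "fst (snd (y t)) = l" "snd (snd (y t)) $ i = 0" for t
      unfolding y_def e by auto
    have gy: "g (y t) = (s, l, snd (snd (g (y t))))" "pencil d f h (g (y t)) = 0" if "t \<in> {0..1}" for t
    proof -
      have "y t \<in> \<Phi> ` W" using y[OF that] r(2) by blast
      then show "g (y t) = (s, l, snd (snd (g (y t))))" "pencil d f h (g (y t)) = 0"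
        using g ye by (auto simp: prod_eq_iff)
    qed
    have n: "norm (\<Phi> (s, l, z') - \<Phi> (s, l, z)) \<le> 2 * dist z z'"
    proof -
      have "norm (\<Phi> (s, l, z') - \<Phi> (s, l, z)) = norm ((z' - z) - axis i ((z' - z) $ i))"
      proof -
        have "\<Phi> (s, l, z') - \<Phi> (s, l, z) = (0, 0, (z' - z) - axis i ((z' - z) $ i))"
          unfolding e by (auto simp: vec_eq_iff axis_def)
        then show ?thesis by (simp add: norm_Pair)
      qed
      also have "\<dots> \<le> norm (z' - z) + norm (axis i ((z' - z) $ i) :: 'k ^ 'n)"
        by (rule norm_triangle_ineq4)
      also have "norm (axis i ((z' - z) $ i) :: 'k ^ 'n) \<le> norm (z' - z)"
        by (rule norm_le_componentwise_cart) (auto simp: axis_def Finite_Cartesian_Product.norm_nth_le)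
      finally show ?thesis by (simp add: dist_norm norm_minus_commute)
    qed
    have L: "L \<ge> 0" using lipschitz_on_nonneg[OF r(3)] .
    have "dist (snd (snd (g (y a)))) (snd (snd (g (y b)))) \<le> L * 2 * dist z z' * dist a b"
      if "a \<in> {0..1}" "b \<in> {0..1}" for a b
    proof -
      have "dist (snd (snd (g (y a)))) (snd (snd (g (y b)))) \<le> dist (g (y a)) (g (y b))"
        by (rule order_trans[OF dist_snd_le dist_snd_le])
      also have "\<dots> \<le> L * dist (y a) (y b)" by (intro lipschitz_onD[OF r(3)] y that)
      also have "dist (y a) (y b) = norm ((a - b) *\<^sub>R (\<Phi> (s, l, z') - \<Phi> (s, l, z)))"
        unfolding y_def dist_norm by (simp add: algebra_simps)
      also have "\<dots> = dist a b * norm (\<Phi> (s, l, z') - \<Phi> (s, l, z))"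
        by (simp add: dist_real_def)
      also have "L * \<dots> \<le> L * (dist a b * (2 * dist z z'))"
        by (intro mult_left_mono n L) auto
      finally show ?thesis by (simp add: mult_ac)
    qed
    then have "(L * 2 * dist z z')-lipschitz_on {0..1} (\<lambda>t. snd (snd (g (y t))))"
      using L by (intro lipschitz_onI) auto
    then show "joined {w. pencil d f h (s, l, w) = 0} (L * 2 * dist z z') z z'"
    proof (rule joined_lipschitz[rotated -1])
      have "y 0 = \<Phi> (s, l, z)" "y 1 = \<Phi> (s, l, z')" unfolding y_def by auto
      then show "snd (snd (g (y 0))) = z" "snd (snd (g (y 1))) = z'"
        using W(5) b \<delta>(2) by (auto simp: subset_iff)
      show "(\<lambda>t. snd (snd (g (y t)))) ` {0..1} \<subseteq> {w. pencil d f h (s, l, w) = 0}"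
      proof (rule image_subsetI)
        fix t :: real assume t: "t \<in> {0..1}"
        show "snd (snd (g (y t))) \<in> {w. pencil d f h (s, l, w) = 0}"
          by (simp only: mem_Collect_eq gy(1)[OF t, symmetric] gy(2)[OF t])
      qed
    qed
  qed
  show ?th2 if "\<eta> > 0"
  proof -
    define P where "P x = (fst x, fst (snd x), snd (snd x) - axis i (snd (snd x) $ i))"
      for x :: "'k \<times> real \<times> ('k ^ 'n)"
    have Pc: "isCont P p0" unfolding P_def
      by (intro continuous_intros bounded_linear.isCont[OF bounded_linear_axis]
          bounded_linear.isCont[OF bounded_linear_vec_nth])
    have Pp0: "P p0 = \<Phi> p0" unfolding P_def \<Phi>_def using z
      by (cases p0) (auto simp: vec_eq_iff axis_def)
    have gc: "isCont g (\<Phi> p0)"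
    proof -
      have "continuous_on (\<Phi> ` W) g" using W(6) Ck_on_imp_continuous_on unfolding smooth_on_def by blast
      then show ?thesis using W(3) p0V continuous_on_eq_continuous_at by blast
    qed
    have "isCont (\<lambda>x. g (P x)) p0" by (rule isCont_o2[OF Pc]) (simp add: Pp0 gc)
    then obtain \<delta>1 where d1: "\<delta>1 > 0" "\<And>x. dist x p0 < \<delta>1 \<Longrightarrow> dist (g (P x)) (g (P p0)) < \<eta> / 2"
      unfolding continuous_at_eps_delta using \<open>\<eta> > 0\<close> half_gt_zero by blast
    obtain \<delta>2 where d2: "\<delta>2 > 0" "\<And>x. dist x p0 < \<delta>2 \<Longrightarrow> dist (P x) (P p0) < r"
      using Pc r(1) unfolding continuous_at_eps_delta by blast
    define \<delta>3 where "\<delta>3 = min (min \<delta>1 \<delta>2) (\<eta> / 2)"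
    show ?th2
    proof (intro exI[of _ \<delta>3] conjI allI impI)
      show "\<delta>3 > 0" unfolding \<delta>3_def using d1(1) d2(1) \<open>\<eta> > 0\<close> by simp
      fix s l z assume "(s, l, z) \<in> ball p0 \<delta>3"
      then have d: "dist (s, l, z) p0 < \<delta>1" "dist (s, l, z) p0 < \<delta>2" "dist (s, l, z) p0 < \<eta> / 2"
        unfolding \<delta>3_def by (auto simp: dist_commute)
      let ?y = "P (s, l, z)"
      have "?y \<in> ball (\<Phi> p0) r" using d2(2)[OF d(2)] Pp0 by (simp add: dist_commute)
      then have yV: "?y \<in> \<Phi> ` W" using r(2) by blast
      have "g ?y = (s, l, snd (snd (g ?y)))" using g(1,2)[OF yV] by (simp add: prod_eq_iff P_def)
      moreover have "pencil d f h (g ?y) = 0" using g(3)[OF yV] by (simp add: P_def)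
      moreover have "dist (snd (snd (g ?y))) z < \<eta>"
      proof -
        have "dist (snd (snd (g ?y))) z \<le> dist (g ?y) (s, l, z)"
          using dist_snd_le[of "g ?y" "(s, l, z)"] dist_snd_le[of "snd (g ?y)" "(l, z)"] by simp
        also have "\<dots> \<le> dist (g ?y) p0 + dist (s, l, z) p0" by (rule dist_triangle2)
        also have "\<dots> < \<eta> / 2 + \<eta> / 2"
          using d1(2)[OF d(1)] d(3) Pp0 W(5)[rule_format, OF W(1)] by simp
        finally show ?thesis by simp
      qed
      ultimately show "\<exists>z'. dist z' z < \<eta> \<and> pencil d f h (s, l, z') = 0" by metis
    qed
  qed
qed

section \<open>Uniform local geometry of a pencil\<close>

definition pencil_zeros :: "nat \<Rightarrow> (('n::finite \<Rightarrow>\<^sub>0 nat) \<Rightarrow> 'k::{real_normed_field, euclidean_space}) \<Rightarrow>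
    (('n \<Rightarrow>\<^sub>0 nat) \<Rightarrow> 'k) \<Rightarrow> 'k \<Rightarrow> ('k ^ 'n) set" where
  "pencil_zeros d f h s = {z. pencil d f h (s, 1, z) = 0}"

text \<open>
The norm of the homogeneous coordinates \<open>(1, x)\<close>: the scale at which the geometry near \<open>x\<close> is uniform.
\<close>
definition homog_norm :: "'e::real_normed_vector \<Rightarrow> real" where
  "homog_norm x = norm (1::real, x)"

lemma homog_norm_ge: "1 \<le> homog_norm x" "norm x \<le> homog_norm x"
  unfolding homog_norm_def using norm_fst_le[of "1::real" x] norm_snd_le[of x "1::real"] by auto

lemma homog_norm_pos: "0 < homog_norm x" using homog_norm_ge(1)[of x] by linarith

lemma homog_norm_diff: "homog_norm x \<le> homog_norm y + dist x y"
proof -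
  have "homog_norm x \<le> norm (1::real, y) + norm ((1, x) - (1::real, y))"
    unfolding homog_norm_def using norm_triangle_sub by blast
  also have "norm ((1, x) - (1::real, y)) = dist x y" by (simp add: norm_Pair dist_norm)
  finally show ?thesis unfolding homog_norm_def .
qed

lemma pencil_scale:
  "pencil d f h (s, t * l, t *\<^sub>R z) = of_real t ^ d * pencil d f h (s, l, z)"
proof -
  have "(t *\<^sub>R z) $ i = of_real t * z $ i" for i
    unfolding vector_scaleR_component by (rule scaleR_conv_of_real)
  from homog_scale[OF this, of d "\<lambda>m. f m + s * h m" "of_real l"] show ?thesis
    unfolding pencil_def by simp
qed

lemma pencil_scale_iff:
  assumes "t \<noteq> 0" shows "pencil d f h (s, t * l, t *\<^sub>R z) = 0 \<longleftrightarrow> pencil d f h (s, l, z) = 0"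
  using assms by (simp add: pencil_scale)

lemma mem_pencil_zeros_scale:
  assumes "t \<noteq> 0" shows "x \<in> pencil_zeros d f h s \<longleftrightarrow> pencil d f h (s, t, t *\<^sub>R x) = 0"
  unfolding pencil_zeros_def using pencil_scale_iff[OF assms, of d f h s 1 x] by simp

lemma joined_pencil_zeros_scale:
  assumes "0 < t" "joined {w. pencil d f h (s, t, w) = 0} M (t *\<^sub>R x) (t *\<^sub>R y)"
  shows "joined (pencil_zeros d f h s) (M / t) x y"
proof -
  have "(1 / t)-lipschitz_on {w. pencil d f h (s, t, w) = 0} (\<lambda>w. (1 / t) *\<^sub>R w)"
    using assms(1) by (intro lipschitz_onI) (auto simp: dist_norm simp flip: scaleR_diff_right)
  moreover have "(\<lambda>w. (1 / t) *\<^sub>R w) ` {w. pencil d f h (s, t, w) = 0} \<subseteq> pencil_zeros d f h s"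
  proof (rule image_subsetI)
    fix w assume "w \<in> {w. pencil d f h (s, t, w) = 0}"
    then show "(1 / t) *\<^sub>R w \<in> pencil_zeros d f h s"
      using assms(1) mem_pencil_zeros_scale[of t "(1 / t) *\<^sub>R w" d f h s] by simp
  qed
  ultimately have "joined (pencil_zeros d f h s) ((1 / t) * M) ((1 / t) *\<^sub>R t *\<^sub>R x) ((1 / t) *\<^sub>R t *\<^sub>R y)"
    by (rule joined_image[OF assms(2)])
  then show ?thesis using assms(1) by simp
qed

lemma continuous_pencil: "continuous_on S (pencil d f h)"
  using smooth_pencil[of d f h] Ck_on_imp_continuous_on continuous_on_subset subset_UNIV
  unfolding smooth_on_def by metis

lemma compact_subsequence:
  fixes S :: "'a::metric_space set"
  assumes "compact S" "\<And>n. f n \<in> S"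
  obtains l r where "l \<in> S" "strict_mono (r :: nat \<Rightarrow> nat)" "(\<lambda>n. f (r n)) \<longlonglongrightarrow> l"
proof -
  have "\<forall>f. (\<forall>n. f n \<in> S) \<longrightarrow> (\<exists>l\<in>S. \<exists>r::nat\<Rightarrow>nat. strict_mono r \<and> (f \<circ> r) \<longlonglongrightarrow> l)"
    using assms(1) unfolding compact_def .
  then have "\<exists>l\<in>S. \<exists>r::nat\<Rightarrow>nat. strict_mono r \<and> (f \<circ> r) \<longlonglongrightarrow> l" using assms(2) by blast
  then show ?thesis using that unfolding o_def by blast
qed

text \<open>
The compactness behind all uniform statements. The normalized homogeneous coordinates lie on a
sphere, so they accumulate, possibly at infinity, where \<open>fst (snd p0) = 0\<close>. The limit is again a zero,
and nondegeneracy supplies a chart there.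
\<close>
lemma nondegenerate_limit:
  fixes f h :: "('n::finite \<Rightarrow>\<^sub>0 nat) \<Rightarrow> 'k::{real_normed_field, euclidean_space}"
  assumes "compact T" "\<And>s. s \<in> T \<Longrightarrow> nondegenerate d (\<lambda>m. f m + s * h m)"
    and p: "\<And>n. s n \<in> T" "\<And>n. x n \<in> pencil_zeros d f h (s n)"
  obtains p0 r i where "strict_mono (r :: nat \<Rightarrow> nat)"
    "(\<lambda>n. (s (r n), 1 / homog_norm (x (r n)), (1 / homog_norm (x (r n))) *\<^sub>R x (r n))) \<longlonglongrightarrow> p0"
    "pencil d f h p0 = 0"
    "homog_deriv d (\<lambda>m. f m + fst p0 * h m) i (of_real (fst (snd p0))) (snd (snd p0)) \<noteq> 0"
proof -
  define q where "q n = (s n, 1 / homog_norm (x n), (1 / homog_norm (x n)) *\<^sub>R x n)" for n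
  have nq: "norm (snd (q n)) = 1" for n
  proof -
    have "snd (q n) = (1 / homog_norm (x n)) *\<^sub>R (1, x n)" unfolding q_def by simp
    then have "norm (snd (q n)) = \<bar>1 / homog_norm (x n)\<bar> * homog_norm (x n)" unfolding homog_norm_def by (simp only: norm_scaleR)
    then show ?thesis using homog_norm_pos[of "x n"] by simp
  qed
  have "compact (T \<times> (sphere 0 1 :: (real \<times> ('k ^ 'n)) set))" using assms(1) by (intro compact_Times) auto
  moreover have "q n \<in> T \<times> sphere 0 1" for n
    using p(1) nq[of n] by (simp add: mem_Times_iff) (simp add: q_def)
  ultimately obtain p0 r where r: "p0 \<in> T \<times> sphere 0 1" "strict_mono r" "(\<lambda>n. q (r n)) \<longlonglongrightarrow> p0"
    by (rule compact_subsequence)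
  have "pencil d f h (q n) = 0" for n
    using mem_pencil_zeros_scale[of "1 / homog_norm (x n)" "x n" d f h "s n"] p(2)[of n] homog_norm_pos[of "x n"]
    unfolding q_def by simp
  moreover have "(\<lambda>n. pencil d f h (q (r n))) \<longlonglongrightarrow> pencil d f h p0"
    using continuous_on_tendsto_compose[OF continuous_pencil[of UNIV] r(3)] by simp
  ultimately have z: "pencil d f h p0 = 0" using LIMSEQ_unique[of "\<lambda>n. 0"] by (simp add: LIMSEQ_const_iff)
  obtain s0 l0 z0 where p0: "p0 = (s0, l0, z0)" by (cases p0)
  have "s0 \<in> T" "(l0, z0) \<noteq> 0" using r(1) p0 by auto
  then have "\<exists>i. homog_deriv d (\<lambda>m. f m + s0 * h m) i (of_real l0) z0 \<noteq> 0"
    using assms(2)[OF \<open>s0 \<in> T\<close>] z unfolding nondegenerate_def p0 pencil_def by (auto simp: zero_prod_def)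
  then show ?thesis using that[OF r(2) _ z] r(3) unfolding p0 q_def by auto
qed

text \<open>
If no constants worked, a sequence of counterexamples with worse and worse constants would accumulate
at a zero \<open>p0\<close>, and near \<open>p0\<close> the local statement provides constants.
\<close>
lemma uniformly_locally_joined:
  fixes f h :: "('n::finite \<Rightarrow>\<^sub>0 nat) \<Rightarrow> 'k::{real_normed_field, euclidean_space}"
  assumes "compact T" "\<And>s. s \<in> T \<Longrightarrow> nondegenerate d (\<lambda>m. f m + s * h m)"
  obtains \<epsilon> L where "0 < \<epsilon>" "0 < L" "\<And>s x y. s \<in> T \<Longrightarrow> x \<in> pencil_zeros d f h s \<Longrightarrow> y \<in> pencil_zeros d f h s \<Longrightarrow>
      dist x y < \<epsilon> * homog_norm x \<Longrightarrow> joined (pencil_zeros d f h s) (L * dist x y) x y"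
proof (rule ccontr)
  assume H: "\<not> thesis"
  have "\<exists>s x y. s \<in> T \<and> x \<in> pencil_zeros d f h s \<and> y \<in> pencil_zeros d f h s \<and>
      dist x y < 1 / real (Suc n) * homog_norm x \<and> \<not> joined (pencil_zeros d f h s) (real (Suc n) * dist x y) x y" for n
    using that[of "1 / real (Suc n)" "real (Suc n)"] H by force
  then obtain s x y where sxy: "\<And>n. s n \<in> T" "\<And>n. x n \<in> pencil_zeros d f h (s n)" "\<And>n. y n \<in> pencil_zeros d f h (s n)"
     and close: "\<And>n. dist (x n) (y n) < 1 / real (Suc n) * homog_norm (x n)"
     and nj: "\<And>n. \<not> joined (pencil_zeros d f h (s n)) (real (Suc n) * dist (x n) (y n)) (x n) (y n)"
    by metis
  define t where "t n = 1 / homog_norm (x n)" for n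
  have t: "t n > 0" for n unfolding t_def using homog_norm_pos by simp
  obtain p0 r i where r: "strict_mono (r :: nat \<Rightarrow> nat)"
    "(\<lambda>n. (s (r n), t (r n), t (r n) *\<^sub>R x (r n))) \<longlonglongrightarrow> p0"
    "pencil d f h p0 = 0"
    "homog_deriv d (\<lambda>m. f m + fst p0 * h m) i (of_real (fst (snd p0))) (snd (snd p0)) \<noteq> 0"
    unfolding t_def by (rule nondegenerate_limit[OF assms sxy(1,2)])
  obtain \<delta> L where \<delta>: "\<delta> > 0" and L: "\<And>s l z z'. (s, l, z) \<in> ball p0 \<delta> \<Longrightarrow> (s, l, z') \<in> ball p0 \<delta> \<Longrightarrow>
      pencil d f h (s, l, z) = 0 \<Longrightarrow> pencil d f h (s, l, z') = 0 \<Longrightarrow>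
      joined {w. pencil d f h (s, l, w) = 0} (L * dist z z') z z'"
    using pencil_local_joined[OF r(4,3)] by blast
  have "eventually (\<lambda>n. dist (s (r n), t (r n), t (r n) *\<^sub>R x (r n)) p0 < \<delta> / 2) sequentially"
    using r(2) \<delta> tendstoD half_gt_zero by blast
  moreover have "eventually (\<lambda>n. real n > max L (2 / \<delta>)) sequentially"
    using filterlim_real_sequentially filterlim_at_top_dense by blast
  ultimately have "eventually (\<lambda>n. dist (s (r n), t (r n), t (r n) *\<^sub>R x (r n)) p0 < \<delta> / 2 \<and> real n > max L (2 / \<delta>)) sequentially"
    by (rule eventually_conj)
  then obtain n where n: "dist (s (r n), t (r n), t (r n) *\<^sub>R x (r n)) p0 < \<delta> / 2" "real n > max L (2 / \<delta>)"
    by (auto simp: eventually_sequentially)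
  define k where "k = r n"
  have k: "dist (s k, t k, t k *\<^sub>R x k) p0 < \<delta> / 2" "real k > L" "real k > 2 / \<delta>"
    using n seq_suble[OF r(1), of n] unfolding k_def by auto
  have "dist (s k, t k, t k *\<^sub>R y k) (s k, t k, t k *\<^sub>R x k) = t k * dist (x k) (y k)"
    using t[of k] by (simp add: dist_Pair_Pair dist_norm norm_minus_commute flip: scaleR_diff_right)
  also have "\<dots> < t k * (1 / real (Suc k) * homog_norm (x k))"
    using close[of k] t[of k] by (rule mult_strict_left_mono)
  also have "\<dots> = 1 / real (Suc k)" unfolding t_def using homog_norm_pos[of "x k"] by simp
  also have "\<dots> < \<delta> / 2" using k(3) \<delta> by (simp add: field_simps)
  finally have yk: "dist (s k, t k, t k *\<^sub>R y k) (s k, t k, t k *\<^sub>R x k) < \<delta> / 2" .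
  have "joined {w. pencil d f h (s k, t k, w) = 0} (L * dist (t k *\<^sub>R x k) (t k *\<^sub>R y k)) (t k *\<^sub>R x k) (t k *\<^sub>R y k)"
  proof (rule L)
    show "(s k, t k, t k *\<^sub>R x k) \<in> ball p0 \<delta>" using k(1) \<delta> by (simp add: dist_commute)
    show "(s k, t k, t k *\<^sub>R y k) \<in> ball p0 \<delta>"
      using dist_triangle_half_l[of _ _ \<delta> p0] k(1) yk
      by (metis dist_commute dist_triangle_half_r mem_ball)
    show "pencil d f h (s k, t k, t k *\<^sub>R x k) = 0" "pencil d f h (s k, t k, t k *\<^sub>R y k) = 0"
      using mem_pencil_zeros_scale[of "t k" _ d f h "s k"] t[of k] sxy(2,3)[of k] by simp_all
  qed
  then have "joined (pencil_zeros d f h (s k)) (L * dist (t k *\<^sub>R x k) (t k *\<^sub>R y k) / t k) (x k) (y k)"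
    by (rule joined_pencil_zeros_scale[OF t])
  moreover have "L * dist (t k *\<^sub>R x k) (t k *\<^sub>R y k) / t k = L * dist (x k) (y k)"
    using t[of k] by (simp add: dist_norm flip: scaleR_diff_right)
  moreover have "L * dist (x k) (y k) \<le> real (Suc k) * dist (x k) (y k)"
    using k(2) by (intro mult_right_mono) auto
  ultimately show False using nj[of k] joined_mono by metis
qed

text \<open>
Members of the pencil with close parameters have zero sets that are close relative to the distance from
the origin: a zero of one member is nearly a zero of the other, and \<open>pencil_local_zero\<close> corrects it.
\<close>
lemma uniformly_close:
  fixes f h :: "('n::finite \<Rightarrow>\<^sub>0 nat) \<Rightarrow> 'k::{real_normed_field, euclidean_space}"
  assumes "compact T" "\<And>s. s \<in> T \<Longrightarrow> nondegenerate d (\<lambda>m. f m + s * h m)" "0 < \<eta>"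
  obtains \<delta> where "0 < \<delta>" "\<And>s s' x. s \<in> T \<Longrightarrow> s' \<in> T \<Longrightarrow> dist s s' < \<delta> \<Longrightarrow> x \<in> pencil_zeros d f h s \<Longrightarrow>
      \<exists>x'\<in>pencil_zeros d f h s'. dist x x' < \<eta> * homog_norm x"
proof (rule ccontr)
  assume H: "\<not> thesis"
  have "\<exists>s s' x. s \<in> T \<and> s' \<in> T \<and> dist s s' < 1 / real (Suc n) \<and> x \<in> pencil_zeros d f h s \<and>
      \<not> (\<exists>x'\<in>pencil_zeros d f h s'. dist x x' < \<eta> * homog_norm x)" for n
    using that[of "1 / real (Suc n)"] H by force
  then obtain s s' x where sx: "\<And>n. s n \<in> T" "\<And>n. x n \<in> pencil_zeros d f h (s n)"
     and close: "\<And>n. dist (s n) (s' n) < 1 / real (Suc n)"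
     and nj: "\<And>n. \<not> (\<exists>x'\<in>pencil_zeros d f h (s' n). dist (x n) x' < \<eta> * homog_norm (x n))"
    by metis
  define t where "t n = 1 / homog_norm (x n)" for n
  have t: "t n > 0" for n unfolding t_def using homog_norm_pos by simp
  obtain p0 r i where r: "strict_mono (r :: nat \<Rightarrow> nat)"
    "(\<lambda>n. (s (r n), t (r n), t (r n) *\<^sub>R x (r n))) \<longlonglongrightarrow> p0"
    "pencil d f h p0 = 0"
    "homog_deriv d (\<lambda>m. f m + fst p0 * h m) i (of_real (fst (snd p0))) (snd (snd p0)) \<noteq> 0"
    unfolding t_def by (rule nondegenerate_limit[OF assms(1,2) sx])
  obtain \<delta> where \<delta>: "\<delta> > 0" and Z: "\<And>s l z. (s, l, z) \<in> ball p0 \<delta> \<Longrightarrow>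
      (\<exists>z'. dist z' z < \<eta> \<and> pencil d f h (s, l, z') = 0)"
    using pencil_local_zero[OF r(4,3) assms(3)] by blast
  have "eventually (\<lambda>n. dist (s (r n), t (r n), t (r n) *\<^sub>R x (r n)) p0 < \<delta> / 2) sequentially"
    using r(2) \<delta> tendstoD half_gt_zero by blast
  moreover have "eventually (\<lambda>n. real n > 2 / \<delta>) sequentially"
    using filterlim_real_sequentially filterlim_at_top_dense by blast
  ultimately have "eventually (\<lambda>n. dist (s (r n), t (r n), t (r n) *\<^sub>R x (r n)) p0 < \<delta> / 2 \<and> real n > 2 / \<delta>) sequentially"
    by (rule eventually_conj)
  then obtain n where n: "dist (s (r n), t (r n), t (r n) *\<^sub>R x (r n)) p0 < \<delta> / 2" "real n > 2 / \<delta>"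
    by (auto simp: eventually_sequentially)
  define k where "k = r n"
  have k: "dist (s k, t k, t k *\<^sub>R x k) p0 < \<delta> / 2" "real k > 2 / \<delta>"
    using n seq_suble[OF r(1), of n] unfolding k_def by auto
  have "dist (s' k, t k, t k *\<^sub>R x k) (s k, t k, t k *\<^sub>R x k) = dist (s k) (s' k)"
    by (simp add: dist_Pair_Pair dist_commute)
  also have "\<dots> < 1 / real (Suc k)" by (rule close)
  also have "\<dots> < \<delta> / 2" using k(2) \<delta> by (simp add: field_simps)
  finally have "dist (s' k, t k, t k *\<^sub>R x k) (s k, t k, t k *\<^sub>R x k) < \<delta> / 2" .
  then have "(s' k, t k, t k *\<^sub>R x k) \<in> ball p0 \<delta>"
    using k(1) by (metis dist_commute dist_triangle_half_r mem_ball)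
  from Z[OF this] obtain z' where z': "dist z' (t k *\<^sub>R x k) < \<eta>" "pencil d f h (s' k, t k, z') = 0" by blast
  define x' where "x' = (1 / t k) *\<^sub>R z'"
  have zx: "z' = t k *\<^sub>R x'" unfolding x'_def using t[of k] by simp
  have "x' \<in> pencil_zeros d f h (s' k)"
    using mem_pencil_zeros_scale[of "t k" x' d f h "s' k"] t[of k] z'(2) unfolding zx by simp
  moreover have "t k * dist (x k) x' < \<eta>"
    using z'(1) t[of k] unfolding zx by (simp add: dist_norm norm_minus_commute flip: scaleR_diff_right)
  then have "dist (x k) x' < \<eta> * homog_norm (x k)"
    unfolding t_def using homog_norm_pos[of "x k"] by (simp add: field_simps)
  ultimately show False using nj by blast
qed

text \<open>
Far from the origin the zero set is close to the cone given by the form of top degree, which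
is invariant under scaling. Hence the scaled point \<open>(1 - \<epsilon> / 2) *\<^sub>R x\<close> is nearly a zero, and
\<open>pencil_local_zero\<close> corrects it.
\<close>
lemma step_towards_origin:
  fixes f h :: "('n::finite \<Rightarrow>\<^sub>0 nat) \<Rightarrow> 'k::{real_normed_field, euclidean_space}"
  assumes nondegenerate: "nondegenerate d (\<lambda>m. f m + s * h m)" and \<epsilon>: "0 < \<epsilon>" "\<epsilon> \<le> 1"
  obtains R where "0 < R" "\<And>x. x \<in> pencil_zeros d f h s \<Longrightarrow> R \<le> norm x \<Longrightarrow>
      \<exists>y\<in>pencil_zeros d f h s. norm y \<le> (1 - \<epsilon> / 4) * norm x \<and> dist x y < \<epsilon> * norm x"
proof (rule ccontr)
  assume H: "\<not> thesis"
  have "\<exists>x. x \<in> pencil_zeros d f h s \<and> real (Suc n) \<le> norm x \<and>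
      \<not> (\<exists>y\<in>pencil_zeros d f h s. norm y \<le> (1 - \<epsilon> / 4) * norm x \<and> dist x y < \<epsilon> * norm x)" for n
    using that[of "real (Suc n)"] H by force
  then obtain x where x: "\<And>n. x n \<in> pencil_zeros d f h s" "\<And>n. real (Suc n) \<le> norm (x n)"
    and no: "\<And>n. \<not> (\<exists>y\<in>pencil_zeros d f h s. norm y \<le> (1 - \<epsilon> / 4) * norm (x n) \<and> dist (x n) y < \<epsilon> * norm (x n))"
    by metis
  have xpos: "0 < norm (x n)" for n using x(2)[of n] by linarith
  define t where "t n = 1 / norm (x n)" for n
  have t: "t n > 0" for n unfolding t_def using xpos by simp
  have "compact (sphere 0 1 :: ('k ^ 'n) set)" by simp
  moreover have "t n *\<^sub>R x n \<in> sphere 0 1" for n unfolding t_def using xpos[of n] by simp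
  ultimately obtain z0 r where r: "z0 \<in> sphere 0 1" "strict_mono (r :: nat \<Rightarrow> nat)" "(\<lambda>n. t (r n) *\<^sub>R x (r n)) \<longlonglongrightarrow> z0"
    by (rule compact_subsequence)
  have "t \<longlonglongrightarrow> 0"
  proof (rule tendsto_sandwich[OF _ _ tendsto_const LIMSEQ_inverse_real_of_nat])
    show "eventually (\<lambda>n. 0 \<le> t n) sequentially" using t by (auto intro!: always_eventually less_imp_le)
    show "eventually (\<lambda>n. t n \<le> inverse (real (Suc n))) sequentially"
    proof (rule always_eventually, rule allI)
      fix n
      show "t n \<le> inverse (real (Suc n))"
        unfolding t_def using le_imp_inverse_le[OF x(2)[of n]] by (simp add: inverse_eq_divide)
    qed
  qed
  then have tr: "(\<lambda>n. t (r n)) \<longlonglongrightarrow> 0" using LIMSEQ_subseq_LIMSEQ[OF _ r(2)] by (simp add: o_def)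
  define \<theta> where "\<theta> = 1 - \<epsilon> / 2"
  have \<theta>: "0 < \<theta>" "\<theta> < 1" unfolding \<theta>_def using \<epsilon> by auto
  have zr: "(\<lambda>n. t (r n) *\<^sub>R x (r n)) \<longlonglongrightarrow> z0" by (rule r(3))
  have zero: "pencil d f h (s, t n, t n *\<^sub>R x n) = 0" for n
    using mem_pencil_zeros_scale[of "t n" "x n" d f h s] t[of n] x(1)[of n] by simp
  have "(\<lambda>n. pencil d f h (s, t (r n), t (r n) *\<^sub>R x (r n))) \<longlonglongrightarrow> pencil d f h (s, 0, z0)"
    by (rule continuous_on_tendsto_compose[OF continuous_pencil[of UNIV]])
       (use tr zr in \<open>auto intro!: tendsto_intros\<close>)
  then have z0: "pencil d f h (s, 0, z0) = 0" using zero LIMSEQ_unique[of "\<lambda>n. 0"] by (simp add: LIMSEQ_const_iff)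
  let ?p0 = "(s, 0::real, \<theta> *\<^sub>R z0)"
  have Hp0: "pencil d f h ?p0 = 0" using pencil_scale_iff[of \<theta> d f h s 0 z0] \<theta> z0 by simp
  have "\<theta> *\<^sub>R z0 \<noteq> 0" using r(1) \<theta> by auto
  then obtain i where i: "homog_deriv d (\<lambda>m. f m + s * h m) i (of_real 0) (\<theta> *\<^sub>R z0) \<noteq> 0"
    using nondegenerate[unfolded nondegenerate_def, rule_format, of 0 "\<theta> *\<^sub>R z0"] Hp0 unfolding pencil_def by auto
  then have "homog_deriv d (\<lambda>m. f m + fst ?p0 * h m) i (of_real (fst (snd ?p0))) (snd (snd ?p0)) \<noteq> 0" by simp
  from pencil_local_zero[OF this Hp0, of "\<epsilon> / 4"] \<epsilon>(1) obtain \<delta> where \<delta>: "\<delta> > 0"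
    and Z: "\<And>s l z. (s, l, z) \<in> ball ?p0 \<delta> \<Longrightarrow> (\<exists>z'. dist z' z < \<epsilon> / 4 \<and> pencil d f h (s, l, z') = 0)"
    by auto
  have "(\<lambda>n. (s, t (r n), \<theta> *\<^sub>R t (r n) *\<^sub>R x (r n))) \<longlonglongrightarrow> ?p0"
    by (intro tendsto_intros tr zr)
  then have "eventually (\<lambda>n. dist (s, t (r n), \<theta> *\<^sub>R t (r n) *\<^sub>R x (r n)) ?p0 < \<delta>) sequentially"
    using \<delta> tendstoD by blast
  then obtain n where "dist (s, t (r n), \<theta> *\<^sub>R t (r n) *\<^sub>R x (r n)) ?p0 < \<delta>"
    by (auto simp: eventually_sequentially)
  then obtain k where "dist (s, t k, \<theta> *\<^sub>R t k *\<^sub>R x k) ?p0 < \<delta>" by blast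
  then obtain z' where z': "dist z' (\<theta> *\<^sub>R t k *\<^sub>R x k) < \<epsilon> / 4" "pencil d f h (s, t k, z') = 0"
    using Z[of s "t k" "\<theta> *\<^sub>R t k *\<^sub>R x k"] by (auto simp: dist_commute)
  define y where "y = (1 / t k) *\<^sub>R z'"
  have zy: "z' = t k *\<^sub>R y" unfolding y_def using t[of k] by simp
  have "y \<in> pencil_zeros d f h s"
    using mem_pencil_zeros_scale[of "t k" y d f h s] t[of k] z'(2) unfolding zy by simp
  moreover have yd: "dist y (\<theta> *\<^sub>R x k) < \<epsilon> / 4 * norm (x k)"
  proof -
    have "dist z' (\<theta> *\<^sub>R t k *\<^sub>R x k) = t k * dist y (\<theta> *\<^sub>R x k)"
      unfolding zy dist_norm using t[of k]
      by (metis abs_of_pos norm_scaleR scaleR_left_commute scaleR_right_diff_distrib)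
    then show ?thesis using z'(1) xpos[of k] unfolding t_def by (simp add: field_simps)
  qed
  have "norm y \<le> norm (\<theta> *\<^sub>R x k) + dist y (\<theta> *\<^sub>R x k)"
    unfolding dist_norm by (rule norm_triangle_sub)
  then have "norm y \<le> \<theta> * norm (x k) + \<epsilon> / 4 * norm (x k)" using yd \<theta> by simp
  then have "norm y \<le> (1 - \<epsilon> / 4) * norm (x k)" unfolding \<theta>_def by (simp add: algebra_simps)
  moreover have "dist (x k) y < \<epsilon> * norm (x k)"
  proof -
    have "dist (x k) y \<le> dist (x k) (\<theta> *\<^sub>R x k) + dist y (\<theta> *\<^sub>R x k)" by (rule dist_triangle2)
    also have "dist (x k) (\<theta> *\<^sub>R x k) = norm ((1 - \<theta>) *\<^sub>R x k)" by (simp add: dist_norm algebra_simps)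
    also have "\<dots> = \<epsilon> / 2 * norm (x k)" unfolding \<theta>_def using \<epsilon> by simp
    finally have "dist (x k) y < \<epsilon> / 2 * norm (x k) + \<epsilon> / 4 * norm (x k)" using yd by linarith
    also have "\<dots> \<le> \<epsilon> * norm (x k)"
      using mult_pos_pos[OF \<epsilon>(1) xpos[of k]] by (simp add: algebra_simps)
    finally show ?thesis .
  qed
  ultimately show False using no by blast
qed

section \<open>Lipschitz normal embedding of the components\<close>

text \<open>
Close points are covered by the local hypothesis. For the others \<open>dist x y\<close> dominates both norms, so
paths of length \<open>O(norm x + norm y)\<close> are short enough. Such a path descends from \<open>x\<close> to a compact set
\<open>K\<close> in geometric steps, crosses \<open>K\<close> and climbs to \<open>y\<close>; by compactness one bound \<open>D\<close> serves for
all points of \<open>K\<close> that can be joined at all.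
\<close>
lemma LNE_of_descent:
  fixes Z S :: "'e::euclidean_space set"
  assumes closed: "closed Z" and pos: "0 < \<epsilon>" "0 < L" "0 < A" "0 < \<theta>" "\<theta> < 1"
    and loc: "\<And>x y. x \<in> Z \<Longrightarrow> y \<in> Z \<Longrightarrow> dist x y < \<epsilon> * homog_norm x \<Longrightarrow> joined Z (L * dist x y) x y"
    and desc: "\<And>x. x \<in> Z \<Longrightarrow> R \<le> norm x \<Longrightarrow> \<exists>y. norm y \<le> \<theta> * norm x \<and> joined Z (A * norm x) x y"
    and S: "S \<subseteq> Z" "\<And>x y. x \<in> S \<Longrightarrow> y \<in> S \<Longrightarrow> \<exists>M. joined Z M x y"
    and stay: "\<And>M x y. x \<in> S \<Longrightarrow> joined Z M x y \<Longrightarrow> joined S M x y"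
  shows "LNE S"
proof -
  \<comment> \<open>The total length of steps of lengths \<open>A * \<theta> ^ k\<close> is \<open>A / (1 - \<theta>)\<close>.\<close>
  define B where "B = A / (1 - \<theta>)"
  have B: "0 < B" "A + B * \<theta> = B" unfolding B_def using pos by (auto simp: field_simps)
  have down: "\<exists>x0. norm x0 \<le> max R 1 \<and> joined Z (B * norm x) x x0"
    if "x \<in> Z" "norm x * \<theta> ^ k \<le> max R 1" for k x
    using that
  proof (induction k arbitrary: x)
    case 0
    then show ?case using joined_refl[of x Z "B * norm x"] B(1) by auto
  next
    case (Suc k)
    show ?case
    proof (cases "norm x \<le> max R 1")
      case True
      then show ?thesis using joined_refl[of x Z "B * norm x"] B(1) Suc.prems(1) by auto
    next
      case False
      then have "R \<le> norm x" by linarith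
      then obtain y where y: "norm y \<le> \<theta> * norm x" "joined Z (A * norm x) x y"
        using desc[OF Suc.prems(1)] by blast
      have "norm y * \<theta> ^ k \<le> (\<theta> * norm x) * \<theta> ^ k" using y(1) pos by (intro mult_right_mono) auto
      also have "\<dots> \<le> max R 1" using Suc.prems(2) by (simp add: mult_ac)
      finally obtain x0 where x0: "norm x0 \<le> max R 1" "joined Z (B * norm y) y x0"
        using Suc.IH[of y] joined_in[OF y(2)] by blast
      have "joined Z (A * norm x + B * norm y) x x0" by (rule joined_trans[OF y(2) x0(2)])
      moreover have "A * norm x + B * norm y \<le> A * norm x + B * (\<theta> * norm x)"
        using y(1) B(1) by simp
      moreover have "A * norm x + B * (\<theta> * norm x) = B * norm x"
        using B(2) by (metis distrib_right mult.assoc)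
      ultimately show ?thesis using joined_mono x0(1) by metis
    qed
  qed
  have ex_down: "\<exists>x0. norm x0 \<le> max R 1 \<and> joined Z (B * norm x) x x0" if x: "x \<in> Z" for x
  proof -
    have "(\<lambda>k. norm x * \<theta> ^ k) \<longlonglongrightarrow> norm x * 0"
      using pos by (intro tendsto_intros LIMSEQ_power_zero) auto
    then have "eventually (\<lambda>k. norm x * \<theta> ^ k < 1) sequentially"
      by (rule order_tendstoD(2)) simp
    then obtain k where "norm x * \<theta> ^ k < 1" by (auto simp: eventually_sequentially)
    then show ?thesis using down[OF x, of k] by auto
  qed
  define K where "K = Z \<inter> cball 0 (max R 1)"
  have K: "compact K" unfolding K_def using closed by (simp add: closed_Int_compact)
  have "\<exists>D. \<forall>x\<in>K. \<forall>y\<in>K. (\<exists>M. joined Z M x y) \<longrightarrow> joined Z D x y"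
  proof (rule ccontr)
    assume "\<not> ?thesis"
    then have "\<forall>n. \<exists>x y. x \<in> K \<and> y \<in> K \<and> (\<exists>M. joined Z M x y) \<and> \<not> joined Z (real n) x y" by blast
    then obtain x y where xy: "\<And>n. x n \<in> K" "\<And>n. y n \<in> K" "\<And>n. \<exists>M. joined Z M (x n) (y n)"
      "\<And>n. \<not> joined Z (real n) (x n) (y n)" by metis
    have "compact (K \<times> K)" using K by (intro compact_Times)
    moreover have "(x n, y n) \<in> K \<times> K" for n using xy by simp
    ultimately obtain p r where r: "p \<in> K \<times> K" "strict_mono (r :: nat \<Rightarrow> nat)" "(\<lambda>n. (x (r n), y (r n))) \<longlonglongrightarrow> p"
      by (rule compact_subsequence)
    obtain a b where p: "p = (a, b)" by (cases p)
    have lim: "(\<lambda>n. x (r n)) \<longlonglongrightarrow> a" "(\<lambda>n. y (r n)) \<longlonglongrightarrow> b"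
      using tendsto_fst[OF r(3)] tendsto_snd[OF r(3)] p by auto
    have "eventually (\<lambda>n. dist (x (r n)) a < \<epsilon>) sequentially" "eventually (\<lambda>n. dist (y (r n)) b < \<epsilon>) sequentially"
      using lim pos(1) by (auto intro: tendstoD)
    then have "eventually (\<lambda>n. dist (x (r n)) a < \<epsilon> \<and> dist (y (r n)) b < \<epsilon>) sequentially"
      by (rule eventually_conj)
    then obtain N where N: "\<And>n. n \<ge> N \<Longrightarrow> dist (x (r n)) a < \<epsilon> \<and> dist (y (r n)) b < \<epsilon>"
      by (auto simp: eventually_sequentially)
    have near: "joined Z (L * \<epsilon>) u c" if "u \<in> K" "c \<in> K" "dist u c < \<epsilon>" for u c
    proof -
      have "\<epsilon> * 1 \<le> \<epsilon> * homog_norm u" using pos(1) homog_norm_ge by (intro mult_left_mono) auto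
      then have "joined Z (L * dist u c) u c" using that unfolding K_def by (intro loc) auto
      then show ?thesis by (rule joined_mono) (use that pos in auto)
    qed
    have ab: "a \<in> K" "b \<in> K" using r(1) p by auto
    have na: "joined Z (L * \<epsilon>) (x (r n)) a" "joined Z (L * \<epsilon>) (y (r n)) b" if "n \<ge> N" for n
      using near[OF xy(1) ab(1)] near[OF xy(2) ab(2)] N[OF that] by auto
    obtain M where M: "joined Z M (x (r N)) (y (r N))" using xy(3) by blast
    have abM: "joined Z (L * \<epsilon> + M + L * \<epsilon>) a b"
      by (rule joined_trans[OF joined_trans[OF joined_sym[OF na(1)] M] na(2)]) auto
    obtain n0 where n0: "real n0 > L * \<epsilon> + (L * \<epsilon> + M + L * \<epsilon>) + L * \<epsilon>" using reals_Archimedean2 by blast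
    define n where "n = max n0 N"
    have "joined Z (L * \<epsilon> + (L * \<epsilon> + M + L * \<epsilon>) + L * \<epsilon>) (x (r n)) (y (r n))"
      by (rule joined_trans[OF joined_trans[OF na(1) abM] joined_sym[OF na(2)]]) (auto simp: n_def)
    moreover have "L * \<epsilon> + (L * \<epsilon> + M + L * \<epsilon>) + L * \<epsilon> \<le> real (r n)"
    proof -
      have "n0 \<le> r n" using seq_suble[OF r(2), of n] unfolding n_def by simp
      then show ?thesis using n0 by simp
    qed
    ultimately show False using xy(4) joined_mono by blast
  qed
  then obtain D where D: "\<And>x y M. x \<in> K \<Longrightarrow> y \<in> K \<Longrightarrow> joined Z M x y \<Longrightarrow> joined Z D x y" by blast
  define C where "C = max L ((2 * B + \<bar>D\<bar>) / \<epsilon>)"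
  have C: "C > 0" unfolding C_def using pos by auto
  have main: "joined Z (C * dist x y) x y" if xy: "x \<in> S" "y \<in> S" for x y
  proof -
    have Z: "x \<in> Z" "y \<in> Z" using xy S(1) by auto
    consider "dist x y < \<epsilon> * homog_norm x" | "dist y x < \<epsilon> * homog_norm y" | "\<epsilon> * homog_norm x \<le> dist x y" "\<epsilon> * homog_norm y \<le> dist x y"
      by (metis dist_commute not_le)
    then show ?thesis
    proof cases
      case 1
      have "L * dist x y \<le> C * dist x y" unfolding C_def by (intro mult_right_mono) auto
      then show ?thesis using loc[OF Z 1] joined_mono by blast
    next
      case 2
      have "L * dist y x \<le> C * dist x y" unfolding C_def dist_commute[of y] by (intro mult_right_mono) auto
      then show ?thesis using joined_sym[OF loc[OF Z(2,1) 2]] joined_mono by blast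
    next
      case 3
      obtain x0 y0 where x0: "norm x0 \<le> max R 1" "joined Z (B * norm x) x x0"
        and y0: "norm y0 \<le> max R 1" "joined Z (B * norm y) y y0"
        using ex_down Z by meson
      obtain M where M: "joined Z M x y" using S(2)[OF xy] by blast
      have "joined Z (B * norm x + M + B * norm y) x0 y0"
        by (rule joined_trans[OF joined_trans[OF joined_sym[OF x0(2)] M] y0(2)])
      moreover have "x0 \<in> K" "y0 \<in> K" unfolding K_def
        using x0 y0 joined_in[OF x0(2)] joined_in[OF y0(2)] by auto
      ultimately have "joined Z D x0 y0" by (intro D)
      then have j: "joined Z (B * norm x + D + B * norm y) x y"
        by (intro joined_trans[OF joined_trans[OF x0(2)] joined_sym[OF y0(2)]])
      have a: "norm x \<le> dist x y / \<epsilon>" "norm y \<le> dist x y / \<epsilon>" "1 \<le> dist x y / \<epsilon>"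
      proof -
        have "\<epsilon> * c \<le> \<epsilon> * homog_norm u" if "c \<le> homog_norm u" for c :: real and u :: 'e
          using that pos(1) by (intro mult_left_mono) auto
        then have "\<epsilon> * norm x \<le> dist x y" "\<epsilon> * norm y \<le> dist x y" "\<epsilon> * 1 \<le> dist x y"
          using 3 homog_norm_ge[of x] homog_norm_ge(2)[of y] by (meson order_trans)+
        then show "norm x \<le> dist x y / \<epsilon>" "norm y \<le> dist x y / \<epsilon>" "1 \<le> dist x y / \<epsilon>"
          using pos(1) by (simp_all add: pos_le_divide_eq mult.commute)
      qed
      have "B * norm x + D + B * norm y \<le> B * (dist x y / \<epsilon>) + \<bar>D\<bar> * (dist x y / \<epsilon>) + B * (dist x y / \<epsilon>)"
      proof (intro add_mono mult_left_mono a)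
        show "D \<le> \<bar>D\<bar> * (dist x y / \<epsilon>)"
          using mult_left_mono[OF a(3), of "\<bar>D\<bar>"] by simp
      qed (use B(1) in auto)
      also have "\<dots> = (2 * B + \<bar>D\<bar>) / \<epsilon> * dist x y" by (simp add: algebra_simps add_divide_distrib)
      also have "\<dots> \<le> C * dist x y" unfolding C_def by (intro mult_right_mono) auto
      finally show ?thesis using j joined_mono by blast
    qed
  qed
  show ?thesis unfolding LNE_def
    using C main stay inner_dist_joined by blast
qed

lemma closed_pencil_zeros: "closed (pencil_zeros d f h s)"
proof -
  have "continuous_on UNIV (\<lambda>z. pencil d f h (s, 1, z))"
    by (rule continuous_on_compose2[OF continuous_pencil[of UNIV]]) (auto intro!: continuous_intros)
  then show ?thesis unfolding pencil_zeros_def by (intro closed_Collect_eq) auto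
qed

text \<open>
A single nondegenerate member has the uniform constants that \<open>LNE_of_descent\<close> asks for. As points at
distance less than \<open>\<epsilon>\<close> are joined, being joined is an open equivalence relation, hence constant on
connected components.
\<close>
lemma
  fixes f h :: "('n::finite \<Rightarrow>\<^sub>0 nat) \<Rightarrow> 'k::{real_normed_field, euclidean_space}"
  assumes nondegenerate: "nondegenerate d (\<lambda>m. f m + s * h m)"
  shows pencil_zeros_LNE_of_joined: "S \<subseteq> pencil_zeros d f h s \<Longrightarrow> (\<And>x y. x \<in> S \<Longrightarrow> y \<in> S \<Longrightarrow> \<exists>M. joined (pencil_zeros d f h s) M x y) \<Longrightarrow>
     (\<And>M x y. x \<in> S \<Longrightarrow> joined (pencil_zeros d f h s) M x y \<Longrightarrow> joined S M x y) \<Longrightarrow> LNE S"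
    and pencil_zeros_component_joined: "C \<in> components (pencil_zeros d f h s) \<Longrightarrow> x \<in> C \<Longrightarrow> y \<in> C \<Longrightarrow> \<exists>M. joined (pencil_zeros d f h s) M x y"
proof -
  let ?Z = "pencil_zeros d f h s"
  obtain \<epsilon>0 L where \<epsilon>0: "0 < \<epsilon>0" and L: "0 < L" and loc0: "\<And>s' x y. s' \<in> {s} \<Longrightarrow> x \<in> pencil_zeros d f h s' \<Longrightarrow> y \<in> pencil_zeros d f h s' \<Longrightarrow>
      dist x y < \<epsilon>0 * homog_norm x \<Longrightarrow> joined (pencil_zeros d f h s') (L * dist x y) x y"
    by (rule uniformly_locally_joined[of "{s}" d f h]) (use nondegenerate in auto)
  define \<epsilon> where "\<epsilon> = min \<epsilon>0 1"
  have \<epsilon>: "0 < \<epsilon>" "\<epsilon> \<le> 1" unfolding \<epsilon>_def using \<epsilon>0 by auto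
  have loc: "joined ?Z (L * dist x y) x y" if "x \<in> ?Z" "y \<in> ?Z" "dist x y < \<epsilon> * homog_norm x" for x y
  proof (rule loc0)
    have "\<epsilon> * homog_norm x \<le> \<epsilon>0 * homog_norm x" unfolding \<epsilon>_def using homog_norm_pos[of x] by (intro mult_right_mono) auto
    then show "dist x y < \<epsilon>0 * homog_norm x" using that by linarith
  qed (use that in auto)
  obtain R where R: "0 < R" "\<And>x. x \<in> ?Z \<Longrightarrow> R \<le> norm x \<Longrightarrow>
      \<exists>y\<in>?Z. norm y \<le> (1 - \<epsilon> / 4) * norm x \<and> dist x y < \<epsilon> * norm x"
    using step_towards_origin[OF nondegenerate \<epsilon>] by blast
  have desc: "\<exists>y. norm y \<le> (1 - \<epsilon> / 4) * norm x \<and> joined ?Z (L * \<epsilon> * norm x) x y"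
    if x: "x \<in> ?Z" "R \<le> norm x" for x
  proof -
    obtain y where y: "y \<in> ?Z" "norm y \<le> (1 - \<epsilon> / 4) * norm x" "dist x y < \<epsilon> * norm x"
      using R(2)[OF x] by blast
    have "\<epsilon> * norm x \<le> \<epsilon> * homog_norm x" using \<epsilon> homog_norm_ge by (intro mult_left_mono) auto
    then have "joined ?Z (L * dist x y) x y" using y x by (intro loc) auto
    moreover have "L * dist x y \<le> L * (\<epsilon> * norm x)" using y(3) L by (intro mult_left_mono) auto
    ultimately show ?thesis using y(2) joined_mono by (metis mult.assoc)
  qed
  show "LNE S" if "S \<subseteq> ?Z" "\<And>x y. x \<in> S \<Longrightarrow> y \<in> S \<Longrightarrow> \<exists>M. joined ?Z M x y"
    "\<And>M x y. x \<in> S \<Longrightarrow> joined ?Z M x y \<Longrightarrow> joined S M x y"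
    by (rule LNE_of_descent[OF closed_pencil_zeros \<epsilon>(1) L _ _ _ loc desc that]) (use \<epsilon> L in auto)
  show "\<exists>M. joined ?Z M x y" if C: "C \<in> components ?Z" "x \<in> C" "y \<in> C"
  proof (rule connected_induction_simple[OF in_components_connected[OF C(1)] C(2,3)])
    have sub: "C \<subseteq> ?Z" using in_components_subset[OF C(1)] .
    then show "\<exists>M. joined ?Z M x x" using C(2) joined_refl[of x ?Z 0] by auto
    fix a assume a: "a \<in> C"
    show "\<exists>T. openin (top_of_set C) T \<and> a \<in> T \<and> (\<forall>u\<in>T. \<forall>v\<in>T. (\<exists>M. joined ?Z M x u) \<longrightarrow> (\<exists>M. joined ?Z M x v))"
    proof (intro exI[of _ "C \<inter> ball a (\<epsilon> / 2)"] conjI ballI impI)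
      show "openin (top_of_set C) (C \<inter> ball a (\<epsilon> / 2))" by (simp add: openin_open_Int)
      show "a \<in> C \<inter> ball a (\<epsilon> / 2)" using a \<epsilon> by simp
      fix u v assume uv: "u \<in> C \<inter> ball a (\<epsilon> / 2)" "v \<in> C \<inter> ball a (\<epsilon> / 2)" and "\<exists>M. joined ?Z M x u"
      then obtain M where M: "joined ?Z M x u" by blast
      have "dist u v < \<epsilon>" using uv dist_triangle_half_r[of a u \<epsilon> v] by auto
      also have "\<epsilon> * 1 \<le> \<epsilon> * homog_norm u" using \<epsilon> homog_norm_ge by (intro mult_left_mono) auto
      finally have "joined ?Z (L * dist u v) u v" using uv sub by (intro loc) auto
      then show "\<exists>M. joined ?Z M x v" using joined_trans[OF M] by blast
    qed
  qed
qed

lemma components_pencil_zeros_LNE: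
  assumes "nondegenerate d (\<lambda>m. f m + s * h m)" "C \<in> components (pencil_zeros d f h s)"
  shows "LNE C"
  by (rule pencil_zeros_LNE_of_joined[OF assms(1) in_components_subset[OF assms(2)] pencil_zeros_component_joined[OF assms]])
     (use joined_component assms(2) in auto)

section \<open>Connectedness under deformation\<close>

definition all_joined :: "'e::metric_space set \<Rightarrow> bool" where
  "all_joined Z \<longleftrightarrow> (\<forall>x\<in>Z. \<forall>y\<in>Z. \<exists>M. joined Z M x y)"

lemma pencil_zeros_LNE:
  assumes "nondegenerate d (\<lambda>m. f m + s * h m)" "all_joined (pencil_zeros d f h s)"
  shows "LNE (pencil_zeros d f h s)"
  by (rule pencil_zeros_LNE_of_joined[OF assms(1)]) (use assms(2) in \<open>auto simp: all_joined_def\<close>)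

lemma all_joined_connected:
  assumes "all_joined Z" shows "connected Z"
proof (rule path_connected_imp_connected, unfold path_connected_def, intro ballI)
  fix x y assume "x \<in> Z" "y \<in> Z"
  then obtain M where "joined Z M x y" using assms unfolding all_joined_def by blast
  then obtain \<gamma> where g: "0 \<le> M" "\<gamma> 0 = x" "\<gamma> M = y" "\<gamma> ` {0..M} \<subseteq> Z" "1-lipschitz_on {0..M} \<gamma>"
    unfolding joined_def by blast
  have tM: "t * M \<in> {0..M}" if "t \<in> {0..1}" for t
    using that g(1) by (auto intro: mult_left_le_one_le)
  have "path (\<lambda>t. \<gamma> (t * M))" unfolding path_def
    by (rule continuous_on_compose2[OF lipschitz_on_continuous_on[OF g(5)]])
       (use tM in \<open>auto intro!: continuous_intros simp del: atLeastAtMost_iff\<close>)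
  moreover have "path_image (\<lambda>t. \<gamma> (t * M)) \<subseteq> Z"
    unfolding path_image_def using tM g(4) by blast
  ultimately show "\<exists>g. path g \<and> path_image g \<subseteq> Z \<and> pathstart g = x \<and> pathfinish g = y"
    using g(2,3) by (intro exI[of _ "\<lambda>t. \<gamma> (t * M)"]) (auto simp: pathstart_def pathfinish_def)
qed

text \<open>
Points of the zero set at \<open>s'\<close> are shadowed by points at \<open>s\<close>. Along a connected path of shadows, the
shadowed points move by steps so small relative to their norm that consecutive ones are joined.
\<close>
lemma all_joined_nearby:
  fixes f h :: "('n::finite \<Rightarrow>\<^sub>0 nat) \<Rightarrow> 'k::{real_normed_field, euclidean_space}"
  assumes "compact T" "\<And>s. s \<in> T \<Longrightarrow> nondegenerate d (\<lambda>m. f m + s * h m)"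
  obtains \<delta> where "0 < \<delta>" "\<And>s s'. s \<in> T \<Longrightarrow> s' \<in> T \<Longrightarrow> dist s s' < \<delta> \<Longrightarrow>
    all_joined (pencil_zeros d f h s) \<Longrightarrow> all_joined (pencil_zeros d f h s')"
proof -
  obtain \<epsilon> L where \<epsilon>: "0 < \<epsilon>" and L: "0 < L" and loc: "\<And>s x y. s \<in> T \<Longrightarrow> x \<in> pencil_zeros d f h s \<Longrightarrow> y \<in> pencil_zeros d f h s \<Longrightarrow>
      dist x y < \<epsilon> * homog_norm x \<Longrightarrow> joined (pencil_zeros d f h s) (L * dist x y) x y"
    using uniformly_locally_joined[OF assms] by blast
  \<comment> \<open>Two shadows and the step between them amount to at most \<open>5 * \<eta>\<close> times the norm of the shadowed point.\<close>
  define \<eta> where "\<eta> = min (\<epsilon> / 5) (1 / 4)"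
  have \<eta>: "0 < \<eta>" "\<eta> \<le> 1 / 4" "5 * \<eta> \<le> \<epsilon>" unfolding \<eta>_def using \<epsilon> by auto
  obtain \<delta> where \<delta>: "0 < \<delta>" and app: "\<And>s s' x. s \<in> T \<Longrightarrow> s' \<in> T \<Longrightarrow> dist s s' < \<delta> \<Longrightarrow> x \<in> pencil_zeros d f h s \<Longrightarrow>
      \<exists>x'\<in>pencil_zeros d f h s'. dist x x' < \<eta> * homog_norm x"
    using uniformly_close[OF assms \<eta>(1)] by blast
  have trans: "dist u' v' < \<epsilon> * homog_norm u'"
    if "dist u u' < \<eta> * homog_norm u" "dist v v' < \<eta> * homog_norm v" "dist u v \<le> \<eta> * homog_norm u" for u u' v v' :: "'k ^ 'n"
  proof -
    have 1: "homog_norm v \<le> homog_norm u + \<eta> * homog_norm u" using homog_norm_diff[of v u] that(3) by (simp add: dist_commute)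
    have 2: "homog_norm u \<le> homog_norm u' + \<eta> * homog_norm u" using homog_norm_diff[of u u'] that(1) by simp
    have q: "\<eta> * homog_norm u \<le> 1 / 4 * homog_norm u" using \<eta> homog_norm_pos[of u] by (intro mult_right_mono) auto
    have "dist u' v' \<le> dist u' u + dist u v + dist v v'"
      using dist_triangle[of u' v' u] dist_triangle[of u v' v] by linarith
    also have "\<dots> < \<eta> * homog_norm u + \<eta> * homog_norm u + \<eta> * homog_norm v" using that by (simp add: dist_commute)
    also have "\<dots> \<le> \<eta> * homog_norm u + \<eta> * homog_norm u + \<eta> * (5 / 4 * homog_norm u)"
      using 1 q \<eta> by (intro add_mono mult_left_mono) auto
    also have "\<dots> = \<eta> * (13 / 4 * homog_norm u)" by simp
    also have "\<dots> \<le> \<eta> * (5 * homog_norm u')" using 2 q homog_norm_pos[of u'] \<eta> by (intro mult_left_mono) auto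
    also have "\<dots> \<le> \<epsilon> * homog_norm u'" using mult_right_mono[OF \<eta>(3), of "homog_norm u'"] homog_norm_pos[of u'] by (simp add: mult_ac)
    finally show ?thesis .
  qed
  have "all_joined (pencil_zeros d f h s')" if s: "s \<in> T" "s' \<in> T" "dist s s' < \<delta>" and aj: "all_joined (pencil_zeros d f h s)" for s s'
    unfolding all_joined_def
  proof (intro ballI)
    let ?Z = "pencil_zeros d f h s" and ?Z' = "pencil_zeros d f h s'"
    fix x y assume x: "x \<in> ?Z'" and y: "y \<in> ?Z'"
    have s': "dist s' s < \<delta>" using s(3) by (simp add: dist_commute)
    obtain x1 where x1: "x1 \<in> ?Z" "dist x x1 < \<eta> * homog_norm x" using app[OF s(2,1) s' x] by blast
    obtain y1 where y1: "y1 \<in> ?Z" "dist y y1 < \<eta> * homog_norm y" using app[OF s(2,1) s' y] by blast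
    define P where "P u \<longleftrightarrow> (\<exists>u'\<in>?Z'. dist u u' < \<eta> * homog_norm u \<and> (\<exists>M. joined ?Z' M x u'))" for u
    have reach: "\<exists>M. joined ?Z' M v v'" if "v \<in> ?Z'" "v' \<in> ?Z'" "dist v w < \<eta> * homog_norm v" "dist w v' < \<eta> * homog_norm w" for v v' w
    proof -
      have "dist v v' < \<epsilon> * homog_norm v"
      proof (rule trans[of v v w v'])
        show "dist v v < \<eta> * homog_norm v" using \<eta> homog_norm_pos[of v] by simp
      qed (use that in auto)
      then show ?thesis using loc[OF s(2) that(1,2)] by blast
    qed
    have "P y1"
    proof (rule connected_induction_simple[OF all_joined_connected[OF aj] x1(1) y1(1)])
      obtain x2 where x2: "x2 \<in> ?Z'" "dist x1 x2 < \<eta> * homog_norm x1" using app[OF s x1(1)] by blast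
      then show "P x1" unfolding P_def using reach[OF x x2(1) x1(2) x2(2)] by blast
      fix a assume a: "a \<in> ?Z"
      show "\<exists>U. openin (top_of_set ?Z) U \<and> a \<in> U \<and> (\<forall>u\<in>U. \<forall>v\<in>U. P u \<longrightarrow> P v)"
      proof (intro exI[of _ "?Z \<inter> ball a (\<eta> / 2)"] conjI ballI impI)
        show "openin (top_of_set ?Z) (?Z \<inter> ball a (\<eta> / 2))" by (simp add: openin_open_Int)
        show "a \<in> ?Z \<inter> ball a (\<eta> / 2)" using a \<eta> by simp
        fix u v assume uv: "u \<in> ?Z \<inter> ball a (\<eta> / 2)" "v \<in> ?Z \<inter> ball a (\<eta> / 2)" and "P u"
        then obtain u' M where u': "u' \<in> ?Z'" "dist u u' < \<eta> * homog_norm u" "joined ?Z' M x u'"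
          unfolding P_def by blast
        obtain v' where v': "v' \<in> ?Z'" "dist v v' < \<eta> * homog_norm v" using app[OF s, of v] uv(2) by blast
        have "dist u v < \<eta>" using uv dist_triangle_half_r[of a u \<eta> v] by auto
        also have "\<eta> * 1 \<le> \<eta> * homog_norm u" using \<eta> homog_norm_ge by (intro mult_left_mono) auto
        finally have "dist u' v' < \<epsilon> * homog_norm u'" by (intro trans[OF u'(2) v'(2)]) auto
        then have "joined ?Z' (L * dist u' v') u' v'" by (intro loc s u' v')
        then show "P v" unfolding P_def using v' joined_trans[OF u'(3)] by blast
      qed
    qed
    then obtain y2 M where y2: "y2 \<in> ?Z'" "dist y1 y2 < \<eta> * homog_norm y1" "joined ?Z' M x y2" unfolding P_def by blast
    obtain M' where "joined ?Z' M' y y2" using reach[OF y y2(1) y1(2) y2(2)] by blast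
    then show "\<exists>M. joined ?Z' M x y" using joined_trans[OF y2(3) joined_sym] by blast
  qed
  then show ?thesis using that[OF \<delta>] by blast
qed

lemma all_joined_deform:
  fixes f h :: "('n::finite \<Rightarrow>\<^sub>0 nat) \<Rightarrow> 'k::{real_normed_field, euclidean_space}"
  assumes "compact T" "connected T" "\<And>s. s \<in> T \<Longrightarrow> nondegenerate d (\<lambda>m. f m + s * h m)"
    "a \<in> T" "b \<in> T" "all_joined (pencil_zeros d f h a)"
  shows "all_joined (pencil_zeros d f h b)"
proof -
  obtain \<delta> where \<delta>: "0 < \<delta>" and near: "\<And>s s'. s \<in> T \<Longrightarrow> s' \<in> T \<Longrightarrow> dist s s' < \<delta> \<Longrightarrow>
    all_joined (pencil_zeros d f h s) \<Longrightarrow> all_joined (pencil_zeros d f h s')"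
    using all_joined_nearby[OF assms(1,3)] by blast
  show ?thesis
  proof (rule connected_induction_simple[OF assms(2,4,5), of "\<lambda>s. all_joined (pencil_zeros d f h s)", OF assms(6)])
    fix c assume c: "c \<in> T"
    show "\<exists>U. openin (top_of_set T) U \<and> c \<in> U \<and>
      (\<forall>x\<in>U. \<forall>y\<in>U. all_joined (pencil_zeros d f h x) \<longrightarrow> all_joined (pencil_zeros d f h y))"
    proof (intro exI[of _ "T \<inter> ball c (\<delta> / 2)"] conjI ballI impI)
      show "openin (top_of_set T) (T \<inter> ball c (\<delta> / 2))" by (simp add: openin_open_Int)
      show "c \<in> T \<inter> ball c (\<delta> / 2)" using c \<delta> by simp
      fix u v assume "u \<in> T \<inter> ball c (\<delta> / 2)" "v \<in> T \<inter> ball c (\<delta> / 2)" "all_joined (pencil_zeros d f h u)"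
      then show "all_joined (pencil_zeros d f h v)"
        using near[of u v] dist_triangle_half_r[of c u \<delta> v] by auto
    qed
  qed
qed

section \<open>The Fermat hypersurface\<close>

text \<open>
The coefficients of \<open>x\<^sub>1 ^ d + \<dots> + x\<^sub>n ^ d - 1\<close>.
\<close>
definition fermat :: "nat \<Rightarrow> ('n::finite \<Rightarrow>\<^sub>0 nat) \<Rightarrow> 'k::field_char_0" where
  "fermat d m = (if m = 0 then -1 else if m \<in> range (\<lambda>i. Poly_Mapping.single i d) then 1 else 0)"

lemma fermat_sum:
  fixes H :: "('n::finite \<Rightarrow>\<^sub>0 nat) \<Rightarrow> 'k::field_char_0"
  assumes "d \<ge> 1"
  shows "(\<Sum>m\<in>monomials_le d. fermat d m * H m) = (\<Sum>i\<in>UNIV. H (Poly_Mapping.single i d)) - H 0"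
proof -
  let ?R = "range (\<lambda>i::'n. Poly_Mapping.single i d)"
  have nz: "Poly_Mapping.single i d \<noteq> 0" for i :: 'n
    using assms by (metis lookup_single_eq lookup_zero not_one_le_zero)
  have inj: "inj (\<lambda>i::'n. Poly_Mapping.single i d)"
  proof (rule injI)
    fix i j :: 'n assume "Poly_Mapping.single i d = Poly_Mapping.single j d"
    then have "Poly_Mapping.lookup (Poly_Mapping.single i d) i = Poly_Mapping.lookup (Poly_Mapping.single j d) i" by simp
    then show "i = j" using assms by (auto simp: lookup_single when_def split: if_splits)
  qed
  have 0: "0 \<notin> ?R" using nz by (metis imageE)
  have "(\<Sum>m\<in>monomials_le d. fermat d m * H m) = (\<Sum>m\<in>insert 0 ?R. fermat d m * H m)"
    by (rule sum.mono_neutral_right[OF finite_monomials_le]) (auto simp: monomials_le_def fermat_def)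
  also have "\<dots> = - H 0 + (\<Sum>m\<in>?R. fermat d m * H m)" using 0 by (simp add: fermat_def)
  also have "(\<Sum>m\<in>?R. fermat d m * H m) = (\<Sum>i\<in>UNIV. H (Poly_Mapping.single i d))"
    unfolding sum.reindex[OF inj] by (simp add: fermat_def nz)
  finally show ?thesis by simp
qed

lemma homog_fermat:
  fixes z :: "'k::field_char_0 ^ 'n::finite"
  assumes "d \<ge> 1"
  shows "homog d (fermat d) \<mu> z = (\<Sum>i\<in>UNIV. z $ i ^ d) - \<mu> ^ d"
  unfolding homog_def mult.assoc fermat_sum[OF assms] by simp

lemma homog_deriv_fermat:
  fixes z :: "'k::field_char_0 ^ 'n::finite"
  assumes "d \<ge> 1"
  shows "homog_deriv d (fermat d) i \<mu> z = of_nat d * z $ i ^ (d - 1)"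
proof -
  have "homog_deriv d (fermat d) i \<mu> z = (\<Sum>j\<in>UNIV. of_nat (Poly_Mapping.lookup (Poly_Mapping.single j d) i) *
      monomial_value (($) z) (Poly_Mapping.single j d - Poly_Mapping.single i 1))"
    unfolding homog_deriv_def mult.assoc fermat_sum[OF assms] by simp
  also have "\<dots> = (\<Sum>j\<in>UNIV. if j = i then of_nat d * monomial_value (($) z) (Poly_Mapping.single i (d - 1)) else 0)"
    by (rule sum.cong) (auto simp: lookup_single when_def single_diff)
  finally show ?thesis by simp
qed

lemma nondegenerate_fermat:
  assumes "d \<ge> 1"
  shows "nondegenerate d (fermat d :: ('n::finite \<Rightarrow>\<^sub>0 nat) \<Rightarrow> 'k::field_char_0)"
  unfolding nondegenerate_def
proof (intro allI impI, rule ccontr)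
  fix \<mu> :: 'k and z :: "'k ^ 'n"
  assume nz: "\<mu> \<noteq> 0 \<or> z \<noteq> 0" and H: "homog d (fermat d) \<mu> z = 0"
    and "\<nexists>i. homog_deriv d (fermat d) i \<mu> z \<noteq> 0"
  then have "of_nat d * z $ i ^ (d - 1) = 0" for i using homog_deriv_fermat[OF assms] by metis
  then have "z $ i = 0" for i using assms by auto
  then have "z = 0" by (simp add: vec_eq_iff)
  then have "\<mu> ^ d = 0" using H assms unfolding homog_fermat[OF assms] by (simp add: power_0_left)
  then show False using nz \<open>z = 0\<close> by simp
qed

definition principal_root :: "nat \<Rightarrow> complex \<Rightarrow> complex" where
  "principal_root d w = exp (Ln w / of_nat d)"

lemma principal_root_power: "d \<ge> 1 \<Longrightarrow> w \<noteq> 0 \<Longrightarrow> principal_root d w ^ d = w"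
  unfolding principal_root_def by (simp flip: exp_of_nat_mult)

lemma principal_root_1: "principal_root d 1 = 1"
  unfolding principal_root_def by simp

definition fermat_set :: "nat \<Rightarrow> (complex ^ 'n::finite) set" where
  "fermat_set d = {z. (\<Sum>i\<in>UNIV. z $ i ^ d) = 1}"

text \<open>
The numbers \<open>z $ i ^ d\<close> add up to \<open>1\<close>, so one of them is not a non-positive real. The segment from it
to \<open>1\<close> avoids the branch cut of the logarithm, so its \<open>d\<close>-th root can be followed continuously; the other
coordinates shrink in such a way that the sum of the \<open>d\<close>-th powers remains \<open>1\<close>.
\<close>
lemma fermat_to_axis:
  fixes z :: "complex ^ 'n::finite"
  assumes d: "d \<ge> 1" and z: "z \<in> fermat_set d"
  obtains i \<omega> where "\<omega> ^ d = 1" "path_component (fermat_set d) z (axis i \<omega>)"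
proof -
  have "\<exists>i. z $ i ^ d \<notin> \<real>\<^sub>\<le>\<^sub>0"
  proof (rule ccontr)
    assume "\<not> ?thesis"
    then have "Re (z $ i ^ d) \<le> 0" for i by (auto simp: complex_nonpos_Reals_iff)
    then have "Re (\<Sum>i\<in>UNIV. z $ i ^ d) \<le> 0" by (simp add: sum_nonpos)
    moreover have "Re (\<Sum>i\<in>UNIV. z $ i ^ d) = Re 1" using z unfolding fermat_set_def by simp
    ultimately show False by simp
  qed
  then obtain i where i: "z $ i ^ d \<notin> \<real>\<^sub>\<le>\<^sub>0" by blast
  define y where "y = z $ i ^ d"
  have y: "y \<notin> \<real>\<^sub>\<le>\<^sub>0" using i unfolding y_def .
  then have y0: "y \<noteq> 0" by auto
  define \<omega> where "\<omega> = z $ i / principal_root d y"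
  have pr: "principal_root d y \<noteq> 0" unfolding principal_root_def by simp
  have \<omega>: "\<omega> ^ d = 1" unfolding \<omega>_def power_divide principal_root_power[OF d y0] using y0 by (simp add: y_def)
  define w where "w t = (1 - of_real t) * y + of_real t" for t
  have w: "w t \<notin> \<real>\<^sub>\<le>\<^sub>0" if "t \<in> {0..1}" for t
  proof
    assume "w t \<in> \<real>\<^sub>\<le>\<^sub>0"
    then have "(1 - t) * Re y + t \<le> 0" "(1 - t) * Im y = 0"
      unfolding w_def by (auto simp: complex_nonpos_Reals_iff)
    moreover have "t \<noteq> 1" using calculation(1) by auto
    ultimately have "Im y = 0" "(1 - t) * Re y \<le> 0" "0 < 1 - t" using that by auto
    then show False using y by (auto simp: complex_nonpos_Reals_iff mult_le_0_iff)
  qed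
  define \<gamma> where "\<gamma> t = (\<chi> j. if j = i then \<omega> * principal_root d (w t) else of_real (root d (1 - t)) * z $ j)" for t
  have d0: "d > 0" using d by simp
  have "path \<gamma>" unfolding path_def \<gamma>_def
  proof (rule continuous_on_vec_lambda)
    fix j
    have "continuous_on {0..1} (\<lambda>t. \<omega> * principal_root d (w t))"
      unfolding principal_root_def using w d0 unfolding w_def
      by (intro continuous_intros) auto
    moreover have "continuous_on {0..1} (\<lambda>t. complex_of_real (root d (1 - t)) * z $ j)"
      using d0 by (intro continuous_intros)
    ultimately show "continuous_on {0..1} (\<lambda>t. if j = i then \<omega> * principal_root d (w t) else of_real (root d (1 - t)) * z $ j)"
      by (cases "j = i") auto
  qed
  moreover have "\<gamma> t \<in> fermat_set d" if t: "t \<in> {0..1}" for t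
  proof -
    have "w t \<noteq> 0" using w[OF t] by auto
    have r: "root d (1 - t) ^ d = 1 - t" using t d0 by (intro real_root_pow_pos2) auto
    have "(\<Sum>j\<in>UNIV. \<gamma> t $ j ^ d) = \<gamma> t $ i ^ d + (\<Sum>j\<in>UNIV - {i}. \<gamma> t $ j ^ d)"
      by (rule sum.remove) auto
    also have "(\<Sum>j\<in>UNIV - {i}. \<gamma> t $ j ^ d) = (\<Sum>j\<in>UNIV - {i}. of_real (1 - t) * z $ j ^ d)"
      unfolding \<gamma>_def by (intro sum.cong) (auto simp: power_mult_distrib r simp flip: of_real_power)
    also have "\<gamma> t $ i ^ d = w t"
      unfolding \<gamma>_def using principal_root_power[OF d \<open>w t \<noteq> 0\<close>] \<omega> by (simp add: power_mult_distrib)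
    also have "w t + (\<Sum>j\<in>UNIV - {i}. of_real (1 - t) * z $ j ^ d) =
       of_real (1 - t) * (z $ i ^ d + (\<Sum>j\<in>UNIV - {i}. z $ j ^ d)) + of_real t"
      unfolding w_def y_def by (simp add: sum_distrib_left algebra_simps)
    also have "z $ i ^ d + (\<Sum>j\<in>UNIV - {i}. z $ j ^ d) = (\<Sum>j\<in>UNIV. z $ j ^ d)"
      by (rule sum.remove[symmetric]) auto
    also have "\<dots> = 1" using z unfolding fermat_set_def by simp
    finally show ?thesis unfolding fermat_set_def by simp
  qed
  moreover have "\<gamma> 0 = z" "\<gamma> 1 = axis i \<omega>"
    using pr d0 unfolding \<gamma>_def w_def \<omega>_def
    by (auto simp: vec_eq_iff axis_def principal_root_1)
  ultimately have "path_component (fermat_set d) z (axis i \<omega>)"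
    unfolding path_component_def by (intro exI[of _ \<gamma>]) (auto simp: path_image_def pathstart_def pathfinish_def)
  then show ?thesis using that \<omega> by blast
qed

lemma fermat_axis_axis:
  assumes d: "d \<ge> 1" and ij: "i \<noteq> j" and \<omega>: "\<omega> ^ d = 1"
  shows "path_component (fermat_set d :: (complex ^ 'n::finite) set) (axis i \<omega>) (axis j 1)"
proof -
  define \<gamma> :: "real \<Rightarrow> complex ^ 'n" where
    "\<gamma> t = axis i (of_real (root d (1 - t)) * \<omega>) + axis j (of_real (root d t))" for t
  have d0: "d > 0" using d by simp
  have "path \<gamma>" unfolding path_def \<gamma>_def
    using d0 by (intro continuous_intros bounded_linear.continuous_on[OF bounded_linear_axis])
  moreover have "\<gamma> t \<in> fermat_set d" if t: "t \<in> {0..1}" for t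
  proof -
    have r: "root d (1 - t) ^ d = 1 - t" "root d t ^ d = t"
      using t d0 by (auto intro!: real_root_pow_pos2)
    have "(\<Sum>k\<in>UNIV. \<gamma> t $ k ^ d) = (\<Sum>k\<in>{i,j}. \<gamma> t $ k ^ d)"
      by (rule sum.mono_neutral_right) (use d0 in \<open>auto simp: \<gamma>_def axis_def\<close>)
    also have "\<dots> = \<gamma> t $ i ^ d + \<gamma> t $ j ^ d" using ij by simp
    also have "\<gamma> t $ i ^ d = of_real (1 - t)"
      using ij \<omega> r(1) by (simp add: \<gamma>_def axis_def power_mult_distrib flip: of_real_power)
    also have "\<gamma> t $ j ^ d = of_real t"
      using ij r(2) by (simp add: \<gamma>_def axis_def flip: of_real_power)
    finally show ?thesis unfolding fermat_set_def by simp
  qed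
  moreover have "\<gamma> 0 = axis i \<omega>" "\<gamma> 1 = axis j 1"
    using d0 unfolding \<gamma>_def by (auto simp: vec_eq_iff axis_def)
  ultimately show ?thesis
    unfolding path_component_def by (intro exI[of _ \<gamma>]) (auto simp: path_image_def pathstart_def pathfinish_def)
qed

lemma connected_fermat_set:
  assumes d: "d \<ge> 1" and n: "CARD('n::finite) \<ge> 2"
  shows "connected (fermat_set d :: (complex ^ 'n) set)"
proof (rule path_connected_imp_connected, unfold path_connected_component, intro ballI)
  let ?F = "fermat_set d :: (complex ^ 'n) set"
  obtain i0 :: 'n where True by blast
  have to: "path_component ?F z (axis i0 1)" if zF: "z \<in> ?F" for z
  proof -
    obtain i \<omega> where i: "\<omega> ^ d = 1" "path_component ?F z (axis i \<omega>)" by (rule fermat_to_axis[OF d zF])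
    have "\<exists>j. j \<noteq> i0"
    proof (rule ccontr)
      assume "\<nexists>j. j \<noteq> i0"
      then have "UNIV = {i0}" by auto
      then show False using n by (metis card.empty card_insert_disjoint empty_iff finite.emptyI not_less_eq_eq numeral_2_eq_2 order_refl)
    qed
    then obtain j where j: "j \<noteq> i0" by blast
    have j0: "path_component ?F (axis j 1) (axis i0 1)" by (rule fermat_axis_axis[OF d j]) simp
    show ?thesis
    proof (cases "i = i0")
      case True
      then have "path_component ?F (axis i \<omega>) (axis j 1)" using j by (intro fermat_axis_axis[OF d _ i(1)]) auto
      then show ?thesis using i(2) j0 path_component_trans by blast
    next
      case False
      then have "path_component ?F (axis i \<omega>) (axis i0 1)" by (intro fermat_axis_axis[OF d _ i(1)])
      then show ?thesis using i(2) path_component_trans by blast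
    qed
  qed
  fix x y assume "x \<in> ?F" "y \<in> ?F"
  then show "path_component ?F x y" using to path_component_trans path_component_sym by metis
qed

lemma connected_imp_all_joined:
  assumes "nondegenerate d (\<lambda>m. f m + s * h m)" "connected (pencil_zeros d f h s)"
  shows "all_joined (pencil_zeros d f h s)"
proof (cases "pencil_zeros d f h s = {}")
  case True
  then show ?thesis unfolding all_joined_def by simp
next
  case False
  then have "pencil_zeros d f h s \<in> components (pencil_zeros d f h s)"
    using assms(2) by (auto simp: in_components_maximal)
  then show ?thesis unfolding all_joined_def using pencil_zeros_component_joined[OF assms(1)] by blast
qed

text \<open>
The complement of a finite set in the complex line is path connected. The two end points, \<open>f\<close> at \<open>0\<close> and
the Fermat polynomial at \<open>1\<close>, are nondegenerate in their own right and are therefore not removed.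
\<close>
lemma all_joined_complex:
  fixes f :: "('n::finite \<Rightarrow>\<^sub>0 nat) \<Rightarrow> complex"
  assumes d: "d \<ge> 1" and n: "CARD('n) \<ge> 2" and f: "nondegenerate d f" and S: "finite S"
    and h: "h = (\<lambda>m. fermat d m - f m)"
    and nondegenerate: "\<And>s. s \<notin> S \<Longrightarrow> nondegenerate d (\<lambda>m. f m + s * h m)"
  shows "all_joined (pencil_zeros d f h 0)"
proof -
  have g0: "nondegenerate d (\<lambda>m. f m + 0 * h m)" using f by simp
  have g1: "nondegenerate d (\<lambda>m. f m + 1 * h m)" using nondegenerate_fermat[OF d] unfolding h by simp
  have "pencil_zeros d f h 1 = fermat_set d"
    unfolding pencil_zeros_def pencil_def fermat_set_def h using d by (auto simp: homog_fermat)
  then have 1: "all_joined (pencil_zeros d f h 1)"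
    using connected_imp_all_joined[OF g1] connected_fermat_set[OF d n] by simp
  have "path_connected (- (S - {0, 1}))"
    using S by (intro path_connected_complement_countable) (auto intro: countable_finite)
  then obtain g where g: "path g" "path_image g \<subseteq> - (S - {0, 1})" "pathstart g = 1" "pathfinish g = 0"
    unfolding path_connected_def by auto
  show ?thesis
  proof (rule all_joined_deform[OF compact_path_image[OF g(1)] connected_path_image[OF g(1)] _ _ _ 1])
    show "1 \<in> path_image g" "0 \<in> path_image g"
      using g(3,4) pathstart_in_path_image pathfinish_in_path_image by metis+
    show "nondegenerate d (\<lambda>m. f m + s * h m)" if "s \<in> path_image g" for s
      using that g(2) nondegenerate[of s] g0 g1 by (cases "s = 0"; cases "s = 1") auto
  qed
qed

section \<open>Ambient charts\<close>

lemma ambient_chart_compose: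
  assumes \<phi>: "ambient_chart W1 \<phi>" and \<psi>: "ambient_chart W2 \<psi>" "W2 \<subseteq> \<phi> ` W1"
  shows "ambient_chart (W1 \<inter> \<phi> -` W2) (\<lambda>x. \<psi> (\<phi> x))"
    and "(\<lambda>x. \<psi> (\<phi> x)) ` (W1 \<inter> \<phi> -` W2) = \<psi> ` W2"
proof -
  let ?W = "W1 \<inter> \<phi> -` W2"
  note P = \<phi>[unfolded ambient_chart_def] \<psi>(1)[unfolded ambient_chart_def]
  have cont: "continuous_on W1 \<phi>" using P(1) Ck_on_imp_continuous_on unfolding smooth_on_def by blast
  have oW: "open ?W" using cont P continuous_open_preimage by blast
  have im: "\<phi> ` ?W = W2" using \<psi>(2) by auto
  then show img: "(\<lambda>x. \<psi> (\<phi> x)) ` ?W = \<psi> ` W2" by (metis image_image)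
  have inj: "inj_on (\<lambda>x. \<psi> (\<phi> x)) ?W"
    using P im unfolding inj_on_def by (metis IntD1 IntD2 vimageD)
  have "smooth_on ?W (\<lambda>x. \<psi> (\<phi> x))"
    by (rule smooth_on_compose[OF oW _ equalityD1[OF im]])
       (use P in \<open>auto simp: smooth_on_def intro: Ck_on_subset\<close>)
  moreover have "smooth_on (\<psi> ` W2) (inv_into ?W (\<lambda>x. \<psi> (\<phi> x)))"
  proof -
    have sub: "inv_into W2 \<psi> ` \<psi> ` W2 \<subseteq> \<phi> ` W1"
      using \<psi>(2) P by (simp add: image_subset_iff inv_into_f_f)
    have "smooth_on (\<psi> ` W2) (\<lambda>y. inv_into W1 \<phi> (inv_into W2 \<psi> y))"
      by (rule smooth_on_compose[OF _ _ sub]) (use P in auto)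
    moreover have "inv_into W1 \<phi> (inv_into W2 \<psi> y) = inv_into ?W (\<lambda>x. \<psi> (\<phi> x)) y" if "y \<in> \<psi> ` W2" for y
    proof -
      have "y \<in> (\<lambda>x. \<psi> (\<phi> x)) ` ?W" using that img by blast
      then obtain x where x: "x \<in> ?W" "y = \<psi> (\<phi> x)" by blast
      have "inv_into ?W (\<lambda>x. \<psi> (\<phi> x)) y = x" unfolding x(2) by (rule inv_into_f_f[OF inj x(1)])
      moreover have "inv_into W2 \<psi> y = \<phi> x" unfolding x(2) using P x(1) by (auto intro!: inv_into_f_f)
      moreover have "inv_into W1 \<phi> (\<phi> x) = x" using P x(1) by (auto intro!: inv_into_f_f)
      ultimately show ?thesis by simp
    qed
    ultimately show ?thesis unfolding smooth_on_def using P by (meson Ck_on_cong)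
  qed
  ultimately show "ambient_chart ?W (\<lambda>x. \<psi> (\<phi> x))"
    unfolding ambient_chart_def img using oW P inj by simp
qed

lemma ambient_chart_restrict:
  assumes \<phi>: "ambient_chart W \<phi>" and W': "open W'" "W' \<subseteq> W"
  shows "ambient_chart W' \<phi>"
proof -
  note P = \<phi>[unfolded ambient_chart_def]
  have inj: "inj_on \<phi> W'" using P W' inj_on_subset by blast
  have cont: "continuous_on (\<phi> ` W) (inv_into W \<phi>)"
    using P Ck_on_imp_continuous_on unfolding smooth_on_def by blast
  have "\<phi> ` W' = \<phi> ` W \<inter> inv_into W \<phi> -` W'"
    using P W'(2) by (auto simp: inv_into_f_f subset_iff)
  then have o: "open (\<phi> ` W')" using continuous_open_preimage[OF cont _ W'(1)] P by simp
  have "smooth_on (\<phi> ` W') (inv_into W' \<phi>)" unfolding smooth_on_def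
  proof
    fix k
    have "Ck_on k (\<phi> ` W') (inv_into W \<phi>)"
      using P W'(2) unfolding smooth_on_def by (meson Ck_on_subset image_mono)
    moreover have "inv_into W \<phi> y = inv_into W' \<phi> y" if y: "y \<in> \<phi> ` W'" for y
    proof -
      obtain x where x: "x \<in> W'" "y = \<phi> x" using y by blast
      then show ?thesis using P W'(2) inj by (auto simp: inv_into_f_f subset_iff)
    qed
    ultimately show "Ck_on k (\<phi> ` W') (inv_into W' \<phi>)" using Ck_on_cong[OF o] by blast
  qed
  moreover have "smooth_on W' \<phi>" using P W'(2) unfolding smooth_on_def by (meson Ck_on_subset)
  ultimately show ?thesis unfolding ambient_chart_def using o inj W'(1) by blast
qed

lemma dim_orthogonal_finite:
  fixes B :: "'a::euclidean_space set"
  assumes "finite B" "pairwise orthogonal B" "0 \<notin> B"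
  shows "dim {y. \<forall>b\<in>B. b \<bullet> y = 0} = DIM('a) - card B"
proof -
  have ind: "independent B" using assms pairwise_orthogonal_independent by blast
  have eq: "{y. \<forall>b\<in>B. b \<bullet> y = 0} = {y \<in> UNIV. \<forall>x\<in>span B. orthogonal x y}"
    by (auto simp: orthogonal_def span_base inner_commute
        intro: orthogonal_to_span[unfolded orthogonal_def])
  have "dim {y \<in> UNIV. \<forall>x\<in>span B. orthogonal x y} + dim (span B) = dim (UNIV :: 'a set)"
    by (rule dim_subspace_orthogonal_to_vectors) auto
  moreover have "dim (span B) = card B" using ind by (simp add: dim_eq_card_independent)
  ultimately show ?thesis unfolding eq by simp
qed

section \<open>Conic structure at infinity\<close>

text \<open>
The closure of the zero set in the coordinates \<open>(r, u)\<close> at infinity, which stand for the point \<open>u / r\<close>.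
\<close>
definition cone_model :: "nat \<Rightarrow> (('n::finite \<Rightarrow>\<^sub>0 nat) \<Rightarrow> 'k::{real_normed_field, euclidean_space}) \<Rightarrow> (real \<times> ('k ^ 'n)) set" where
  "cone_model d f = {x. 0 \<le> fst x \<and> norm (snd x) = 1 \<and> homog d f (of_real (fst x)) (snd x) = 0}"

lemma smooth_homog:
  fixes f :: "('n::finite \<Rightarrow>\<^sub>0 nat) \<Rightarrow> 'k::{real_normed_field, euclidean_space}"
  shows "smooth_on UNIV (\<lambda>x :: real \<times> ('k ^ 'n). homog d f (of_real (fst x)) (snd x))"
proof -
  have "smooth_on UNIV (\<lambda>x :: real \<times> ('k ^ 'n). pencil d f (\<lambda>_. 0) (0, fst x, snd x))"
  proof (rule smooth_on_compose[OF open_UNIV open_UNIV _ _ smooth_pencil])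
    show "smooth_on UNIV (\<lambda>x :: real \<times> ('k ^ 'n). (0::'k, fst x, snd x))"
      unfolding smooth_on_def
      by (intro allI Ck_on_bounded_linear open_UNIV bounded_linear_Pair bounded_linear_zero
          bounded_linear_fst bounded_linear_snd)
  qed auto
  then show ?thesis unfolding pencil_def by (simp only: prod.case mult_zero_right add_0_right)
qed

lemma frechet_homog:
  fixes f :: "('n::finite \<Rightarrow>\<^sub>0 nat) \<Rightarrow> 'k::{real_normed_field, euclidean_space}"
  shows "frechet_derivative (\<lambda>x :: real \<times> ('k ^ 'n). homog d f (of_real (fst x)) (snd x)) (at (r, u)) (0, v)
     = (\<Sum>i\<in>UNIV. v $ i * homog_deriv d f i (of_real r) u)"
proof -
  let ?G = "\<lambda>x :: real \<times> ('k ^ 'n). homog d f (of_real (fst x)) (snd x)"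
  have "((\<lambda>z. ?G (r, z)) has_derivative (\<lambda>v. \<Sum>i\<in>UNIV. v $ i * homog_deriv d f i (of_real r) u)) (at u)"
    using has_derivative_homog by simp
  moreover have "((\<lambda>z. (r, z)) has_derivative (\<lambda>v. (0, v))) (at u)"
    by (intro derivative_eq_intros has_derivative_Pair) auto
  moreover have "?G differentiable (at (r, u))"
    by (rule smooth_on_differentiable[OF smooth_homog]) simp
  ultimately show ?thesis
    using frechet_derivative_along[of ?G "\<lambda>z. (r, z)" u "\<lambda>v. (0, v)"] by blast
qed

lemma frechet_homog_axis:
  fixes f :: "('n::finite \<Rightarrow>\<^sub>0 nat) \<Rightarrow> 'k::{real_normed_field, euclidean_space}"
  shows "frechet_derivative (\<lambda>x :: real \<times> ('k ^ 'n). homog d f (of_real (fst x)) (snd x)) (at x) (0, axis i k)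
     = k * homog_deriv d f i (of_real (fst x)) (snd x)"
proof -
  have "(\<Sum>j\<in>UNIV. axis i k $ j * homog_deriv d f j (of_real (fst x)) (snd x))
     = (\<Sum>j\<in>UNIV. if j = i then k * homog_deriv d f i (of_real (fst x)) (snd x) else 0)"
    by (rule sum.cong) (auto simp: axis_def)
  then show ?thesis using frechet_homog[of d f "fst x" "snd x" "axis i k"] by simp
qed

text \<open>
Euler's relation at a zero at infinity: the form vanishes along the whole ray through \<open>u\<close>.
\<close>
lemma euler_zero:
  fixes f :: "('n::finite \<Rightarrow>\<^sub>0 nat) \<Rightarrow> 'k::{real_normed_field, euclidean_space}"
  assumes "homog d f 0 u = 0"
  shows "(\<Sum>i\<in>UNIV. u $ i * homog_deriv d f i 0 u) = 0"
proof -
  have z: "homog d f 0 (t *\<^sub>R u) = 0" for t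
    using homog_scale[of "t *\<^sub>R u" "of_real t" u d f 0] assms
    unfolding vector_scaleR_component by (simp add: scaleR_conv_of_real[where 'a = 'k])
  have "((\<lambda>t::real. t *\<^sub>R u) has_derivative (\<lambda>t. t *\<^sub>R u)) (at 1)"
    by (auto intro!: derivative_eq_intros)
  moreover have "(homog d f 0 has_derivative (\<lambda>v. \<Sum>i\<in>UNIV. v $ i * homog_deriv d f i 0 u)) (at (1 *\<^sub>R u))"
    using has_derivative_homog[of d f 0 u] by simp
  ultimately have "((homog d f 0 \<circ> (\<lambda>t::real. t *\<^sub>R u)) has_derivative
      ((\<lambda>v. \<Sum>i\<in>UNIV. v $ i * homog_deriv d f i 0 u) \<circ> (\<lambda>t. t *\<^sub>R u))) (at 1)"
    by (rule diff_chain_at)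
  moreover have "(homog d f 0 \<circ> (\<lambda>t::real. t *\<^sub>R u)) = (\<lambda>t. 0)" using z by auto
  ultimately have "((\<lambda>t::real. 0) has_derivative
      ((\<lambda>v. \<Sum>i\<in>UNIV. v $ i * homog_deriv d f i 0 u) \<circ> (\<lambda>t. t *\<^sub>R u))) (at 1)" by simp
  then have "(\<lambda>v. \<Sum>i\<in>UNIV. v $ i * homog_deriv d f i 0 u) \<circ> (\<lambda>t::real. t *\<^sub>R u) = (\<lambda>t. 0)"
    by (rule has_derivative_unique[OF _ has_derivative_const])
  from fun_cong[OF this, of 1] show ?thesis by simp
qed

text \<open>
Two straightenings in succession, of the form along a coordinate axis and then of \<open>|u|\<^sup>2 - 1\<close>. The second
one uses the image of the radial direction \<open>(0, u0)\<close>, which is tangent to the zero set of the form by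
Euler's relation, while \<open>|u|\<^sup>2\<close> has derivative \<open>2\<close> along it. Both steps leave \<open>r\<close> unchanged, so the
half-space \<open>r \<ge> 0\<close> is preserved.
\<close>
lemma cone_chart:
  fixes f :: "('n::finite \<Rightarrow>\<^sub>0 nat) \<Rightarrow> 'k::{real_normed_field, euclidean_space}"
  assumes nondegenerate: "nondegenerate d f" and u0: "norm u0 = 1" "homog d f 0 u0 = 0"
  shows "\<exists>W \<phi> V. ambient_chart W \<phi> \<and> (0, u0) \<in> W \<and> subspace V \<and>
     dim V = DIM(real \<times> ('k ^ 'n)) - (DIM('k) + 1) \<and> (1, 0) \<in> V \<and> (\<forall>x\<in>W. fst (\<phi> x) = fst x) \<and>
     \<phi> ` (cone_model d f \<inter> W) = \<phi> ` W \<inter> {y \<in> V. 0 \<le> fst y}"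
proof -
  have u0nz: "u0 \<noteq> 0" using u0(1) by auto
  obtain i where i: "homog_deriv d f i 0 u0 \<noteq> 0" using nondegenerate u0 u0nz unfolding nondegenerate_def by blast
  define G where "G x = homog d f (of_real (fst x)) (snd x)" for x :: "real \<times> ('k ^ 'n)"
  have smG: "smooth_on UNIV G" using smooth_homog unfolding G_def[abs_def] .
  define \<iota> :: "'k \<Rightarrow> real \<times> ('k ^ 'n)" where "\<iota> k = (0, axis i k)" for k
  define \<pi> where "\<pi> x = snd x $ i" for x :: "real \<times> ('k ^ 'n)"
  have b\<iota>: "bounded_linear \<iota>" unfolding \<iota>_def
    by (intro bounded_linear_Pair bounded_linear_zero bounded_linear_axis)
  have b\<pi>: "bounded_linear \<pi>" unfolding \<pi>_def
    by (intro bounded_linear_compose[OF bounded_linear_vec_nth] bounded_linear_snd)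
  have retr: "\<pi> (\<iota> k) = k" for k unfolding \<pi>_def \<iota>_def by simp
  have der: "frechet_derivative G (at x) (\<iota> k) = k * homog_deriv d f i (of_real (fst x)) (snd x)" for x k
    unfolding \<iota>_def G_def[abs_def] by (rule frechet_homog_axis)
  have klin: "frechet_derivative G (at x) (\<iota> k) = k * frechet_derivative G (at x) (\<iota> 1)" for x k
    unfolding der by simp
  have nz: "frechet_derivative G (at (0, u0)) (\<iota> 1) \<noteq> 0" unfolding der using i by simp
  define \<phi>1 where "\<phi>1 = (\<lambda>x. x + \<iota> (G x - \<pi> x))"
  obtain W1 g1 where "W1 \<subseteq> UNIV" and W1: "(0, u0) \<in> W1" "ambient_chart W1 \<phi>1"
    "\<forall>x\<in>W1. g1 (\<phi>1 x) = x"
    "smooth_on (\<phi>1 ` W1) g1"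
    "\<forall>y\<in>\<phi>1 ` W1. g1 y \<in> W1" "\<forall>y\<in>\<phi>1 ` W1. \<phi>1 (g1 y) = y"
    and D1: "\<forall>y\<in>\<phi>1 ` W1. \<forall>w. frechet_derivative g1 (at y) w =
       w - \<iota> (\<pi> w) + \<iota> ((\<pi> w - frechet_derivative G (at (g1 y)) (w - \<iota> (\<pi> w)))
          * inverse (frechet_derivative G (at (g1 y)) (\<iota> 1)))"
    by (rule straightening_chart[OF open_UNIV smG UNIV_I b\<iota> b\<pi> retr klin nz])
      (rule that; ((unfold \<phi>1_def)?, assumption))
  define w0 where "w0 = u0 - axis i (u0 $ i)"
  have Gx0: "G (0, u0) = 0" unfolding G_def using u0(2) by simp
  have y0: "\<phi>1 (0, u0) = (0, w0)" unfolding \<phi>1_def Gx0 w0_def \<iota>_def \<pi>_def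
    by (auto simp: vec_eq_iff axis_def)
  have y0W: "(0, w0) \<in> \<phi>1 ` W1" using y0 W1(1) by (metis imageI)
  have g1y0: "g1 (0, w0) = (0, u0)" using W1(3) W1(1) y0 by metis
  have w0i: "w0 $ i = 0" unfolding w0_def by simp
  have oV1: "open (\<phi>1 ` W1)" using W1(2) unfolding ambient_chart_def by blast
  \<comment> \<open>By Euler's relation the first chart takes the radial direction \<open>(0, u0)\<close> to \<open>(0, w0)\<close>.\<close>
  have Dw0: "frechet_derivative g1 (at (0, w0)) (0, w0) = (0, u0)"
  proof -
    let ?q = "homog_deriv d f i 0 u0"
    have p: "\<pi> (0, w0) = 0" unfolding \<pi>_def using w0i by simp
    have \<iota>0: "\<iota> 0 = 0" unfolding \<iota>_def by (simp add: zero_prod_def)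
    have "frechet_derivative G (at (0, u0)) (0, u0) = 0"
      unfolding G_def[abs_def] frechet_homog using euler_zero[OF u0(2)] by simp
    moreover have "(0, w0) = (0, u0) - \<iota> (u0 $ i)" unfolding w0_def \<iota>_def by simp
    moreover have "linear (frechet_derivative G (at (0, u0)))"
      using smooth_on_derivative(1)[OF smG] has_derivative_linear by blast
    ultimately have "frechet_derivative G (at (0, u0)) (0, w0) = - (u0 $ i * ?q)"
      using der[of "(0, u0)" "u0 $ i"] by (simp add: linear_diff)
    then have "frechet_derivative g1 (at (0, w0)) (0, w0) = (0, w0) + \<iota> (u0 $ i * ?q * inverse ?q)"
      using D1[rule_format, OF y0W, of "(0, w0)"] der[of "(0, u0)" 1] unfolding g1y0 p \<iota>0 by simp
    also have "\<dots> = (0, u0)" using i unfolding w0_def \<iota>_def by (simp add: mult.assoc)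
    finally show ?thesis .
  qed
  have Dg1: "(g1 has_derivative frechet_derivative g1 (at y)) (at y)" if "y \<in> \<phi>1 ` W1" for y
    using smooth_on_derivative(1)[OF W1(4) that] .
  have w0nz: "w0 \<noteq> 0"
  proof
    assume "w0 = 0"
    then have "frechet_derivative g1 (at (0, w0)) (0, w0) = 0"
      using has_derivative_linear[OF Dg1[OF y0W]] linear_0 by (metis zero_prod_def)
    then show False using Dw0 u0nz by (simp add: zero_prod_def)
  qed
  have ww: "w0 \<bullet> w0 \<noteq> 0" using w0nz by simp
  define G2 :: "real \<times> ('k ^ 'n) \<Rightarrow> real" where "G2 y = snd (g1 y) \<bullet> snd (g1 y) - 1" for y
  have smG2: "smooth_on (\<phi>1 ` W1) G2" unfolding smooth_on_def
  proof
    fix k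
    have s: "Ck_on k (\<phi>1 ` W1) (\<lambda>y. snd (g1 y))"
      using W1(4) unfolding smooth_on_def by (auto intro: Ck_on_bounded_linear_compose[OF oV1 bounded_linear_snd])
    have "Ck_on k (\<phi>1 ` W1) (\<lambda>y. snd (g1 y) \<bullet> snd (g1 y) + (- 1))"
      by (intro Ck_on_add Ck_on_bilinear[OF oV1 bounded_bilinear_inner] s Ck_on_const oV1)
    then show "Ck_on k (\<phi>1 ` W1) G2" unfolding G2_def[abs_def] by simp
  qed
  define \<iota>2 :: "real \<Rightarrow> real \<times> ('k ^ 'n)" where "\<iota>2 k = k *\<^sub>R (0, w0)" for k
  define \<pi>2 :: "real \<times> ('k ^ 'n) \<Rightarrow> real" where "\<pi>2 y = (y \<bullet> (0, w0)) * inverse (w0 \<bullet> w0)" for y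
  have b\<iota>2: "bounded_linear \<iota>2" unfolding \<iota>2_def by (rule bounded_linear_scaleR_left)
  have b\<pi>2: "bounded_linear \<pi>2" unfolding \<pi>2_def
    by (intro bounded_linear_mult_const bounded_linear_inner_left)
  have retr2: "\<pi>2 (\<iota>2 k) = k" for k unfolding \<pi>2_def \<iota>2_def using ww by simp
  have klin2: "frechet_derivative G2 (at x) (\<iota>2 k) = k * frechet_derivative G2 (at x) (\<iota>2 1)" if "x \<in> \<phi>1 ` W1" for x k
  proof -
    have "linear (frechet_derivative G2 (at x))"
      using smooth_on_derivative(1)[OF smG2 that] has_derivative_linear by blast
    moreover have "\<iota>2 k = k *\<^sub>R \<iota>2 1" unfolding \<iota>2_def by simp
    ultimately show ?thesis by (simp only: linear_cmul) simp
  qed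
  have nz2: "frechet_derivative G2 (at (0, w0)) (\<iota>2 1) \<noteq> 0"
  proof -
    have ds: "((\<lambda>y. snd (g1 y)) has_derivative (\<lambda>v. snd (frechet_derivative g1 (at (0, w0)) v))) (at (0, w0))"
      by (intro has_derivative_snd Dg1 y0W)
    have "(G2 has_derivative (\<lambda>v. snd (g1 (0, w0)) \<bullet> snd (frechet_derivative g1 (at (0, w0)) v) +
       snd (frechet_derivative g1 (at (0, w0)) v) \<bullet> snd (g1 (0, w0)) - 0)) (at (0, w0))"
      unfolding G2_def[abs_def] by (intro has_derivative_diff has_derivative_inner ds has_derivative_const)
    then have "frechet_derivative G2 (at (0, w0)) = (\<lambda>v. snd (g1 (0, w0)) \<bullet> snd (frechet_derivative g1 (at (0, w0)) v) +
       snd (frechet_derivative g1 (at (0, w0)) v) \<bullet> snd (g1 (0, w0)) - 0)"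
      by (rule frechet_derivative_at[symmetric])
    then have "frechet_derivative G2 (at (0, w0)) (\<iota>2 1) = 2 * (u0 \<bullet> u0)"
      unfolding \<iota>2_def g1y0 by (simp add: Dw0)
    also have "\<dots> \<noteq> 0" using u0nz by simp
    finally show ?thesis .
  qed
  define \<phi>2 where "\<phi>2 = (\<lambda>x. x + \<iota>2 (G2 x - \<pi>2 x))"
  obtain W2 g2 where W2: "W2 \<subseteq> \<phi>1 ` W1" "(0, w0) \<in> W2" "ambient_chart W2 \<phi>2"
  proof (rule straightening_chart[OF oV1 smG2 y0W b\<iota>2 b\<pi>2 retr2 klin2 nz2], assumption)
    fix W g
    assume a: "W \<subseteq> \<phi>1 ` W1" "(0, w0) \<in> W" "ambient_chart W (\<lambda>x. x + \<iota>2 (G2 x - \<pi>2 x))"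
    show thesis by (rule that[OF a[folded \<phi>2_def]])
  qed
  define W where "W = W1 \<inter> \<phi>1 -` W2"
  define \<phi> where "\<phi> = (\<lambda>x. \<phi>2 (\<phi>1 x))"
  have chart: "ambient_chart W \<phi>" unfolding W_def \<phi>_def by (rule ambient_chart_compose(1)[OF W1(2) W2(3,1)])
  define B :: "(real \<times> ('k ^ 'n)) set" where "B = insert (0, w0) ((\<lambda>b. (0, axis i b)) ` Basis)"
  define V where "V = {y. \<forall>b\<in>B. b \<bullet> y = 0}"
  have V_iff: "y \<in> V \<longleftrightarrow> w0 \<bullet> snd y = 0 \<and> snd y $ i = 0" for y
  proof -
    have "(\<forall>b\<in>Basis. snd y \<bullet> axis i b = 0) \<longleftrightarrow> snd y $ i = 0"
      unfolding inner_axis by (rule euclidean_all_zero_iff)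
    then show ?thesis unfolding V_def B_def by (auto simp: inner_prod_def inner_commute)
  qed
  have subV: "subspace V" unfolding subspace_def by (auto simp: V_iff inner_add_right)
  have dimV: "dim V = DIM(real \<times> ('k ^ 'n)) - (DIM('k) + 1)"
  proof -
    have notin: "(0::real, w0) \<notin> (\<lambda>b. (0, axis i b)) ` (Basis :: 'k set)"
    proof
      assume "(0::real, w0) \<in> (\<lambda>b. (0, axis i b)) ` (Basis :: 'k set)"
      then obtain b :: 'k where "b \<in> Basis" "w0 = axis i b" by auto
      then show False using w0i by (auto simp: nonzero_Basis)
    qed
    have "inj_on (\<lambda>b. (0::real, axis i b)) (Basis :: 'k set)" by (auto simp: inj_on_def axis_eq_axis)
    then have "card B = DIM('k) + 1" unfolding B_def using notin by (simp add: card_image)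
    moreover have "pairwise orthogonal B"
      unfolding B_def pairwise_def
      by (auto simp: orthogonal_def inner_prod_def inner_axis inner_axis' w0i inner_Basis axis_eq_axis)
    moreover have "0 \<notin> B" unfolding B_def using w0nz by (auto simp: zero_prod_def nonzero_Basis)
    moreover have "finite B" unfolding B_def by simp
    ultimately show ?thesis unfolding V_def using dim_orthogonal_finite[of B] by simp
  qed
  have f1: "fst (\<phi>1 x) = fst x" "snd (\<phi>1 x) $ i = G x" for x
    unfolding \<phi>1_def \<iota>_def \<pi>_def by auto
  have f2: "fst (\<phi>2 y) = fst y" "snd (\<phi>2 y) $ i = snd y $ i" "w0 \<bullet> snd (\<phi>2 y) = G2 y * (w0 \<bullet> w0)" for y
    unfolding \<phi>2_def \<iota>2_def \<pi>2_def using w0i ww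
    by (auto simp: inner_add_right inner_prod_def inner_commute left_diff_distrib)
  have f: "fst (\<phi> x) = fst x" "\<phi> x \<in> V \<longleftrightarrow> norm (snd x) = 1 \<and> G x = 0" if "x \<in> W" for x
  proof -
    show "fst (\<phi> x) = fst x" unfolding \<phi>_def f2 f1 ..
    have "g1 (\<phi>1 x) = x" using W1(3) that unfolding W_def by blast
    then have "G2 (\<phi>1 x) = (norm (snd x))\<^sup>2 - 1" unfolding G2_def by (simp add: power2_norm_eq_inner)
    then have "G2 (\<phi>1 x) = 0 \<longleftrightarrow> norm (snd x) = 1"
      using norm_ge_zero[of "snd x"] by (simp add: power2_eq_1_iff del: norm_ge_zero)
    then show "\<phi> x \<in> V \<longleftrightarrow> norm (snd x) = 1 \<and> G x = 0" unfolding V_iff \<phi>_def f2 f1 using ww by simp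
  qed
  have "\<phi> ` (cone_model d f \<inter> W) = \<phi> ` W \<inter> {y \<in> V. 0 \<le> fst y}"
  proof (intro equalityI subsetI)
    fix y assume "y \<in> \<phi> ` (cone_model d f \<inter> W)"
    then obtain x where "x \<in> cone_model d f" "x \<in> W" "y = \<phi> x" by blast
    then show "y \<in> \<phi> ` W \<inter> {y \<in> V. 0 \<le> fst y}" using f[of x] unfolding cone_model_def G_def by auto
  next
    fix y assume "y \<in> \<phi> ` W \<inter> {y \<in> V. 0 \<le> fst y}"
    then obtain x where "x \<in> W" "y = \<phi> x" "\<phi> x \<in> V" "0 \<le> fst (\<phi> x)" by blast
    then have "x \<in> cone_model d f \<inter> W" using f[of x] unfolding cone_model_def G_def by auto
    then show "y \<in> \<phi> ` (cone_model d f \<inter> W)" using \<open>y = \<phi> x\<close> by blast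
  qed
  moreover have "(0, u0) \<in> W" unfolding W_def using W1(1) W2(2) y0 by simp
  moreover have "(1, 0) \<in> V" unfolding V_iff by simp
  ultimately show ?thesis using chart subV dimV f(1) by blast
qed

lemma velocity_unique:
  fixes \<gamma> :: "real \<Rightarrow> 'a::euclidean_space"
  assumes "(\<gamma> has_vector_derivative v) (at 0 within {0..})" "(\<gamma> has_vector_derivative w) (at 0 within {0..})"
  shows "v = w"
proof -
  have "(\<gamma> has_vector_derivative v) (at 0 within {0..1})" "(\<gamma> has_vector_derivative w) (at 0 within {0..1})"
    using assms by (auto intro: has_vector_derivative_within_subset)
  then show ?thesis
    using vector_derivative_unique_within_closed_interval[of 0 1 0 \<gamma> v w] by simp
qed

lemma velocity_mem_tangent_space:
  "\<gamma> 0 = x \<Longrightarrow> \<gamma> ` {0..} \<subseteq> N \<Longrightarrow> (\<gamma> has_vector_derivative v) (at 0 within {0..}) \<Longrightarrow> v \<in> tangent_space N x"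
  unfolding tangent_space_def by (rule span_base) blast

lemma tangent_space_mono: "N \<subseteq> P \<Longrightarrow> tangent_space N x \<subseteq> tangent_space P x"
  unfolding tangent_space_def by (rule span_mono) blast

lemma tangent_space_M_bar:
  fixes x :: "real \<times> 'e::euclidean_space"
  assumes "x \<in> M_bar" "p \<in> tangent_space M_bar x"
  shows "snd p \<bullet> snd x = 0"
proof -
  have "tangent_space M_bar x \<subseteq> {p. snd p \<bullet> snd x = 0}"
    unfolding tangent_space_def
  proof (rule span_minimal)
    show "subspace {p::real \<times> 'e. snd p \<bullet> snd x = 0}" by (auto simp: subspace_def inner_add_left)
    show "{v. \<exists>\<gamma>. \<gamma> 0 = x \<and> \<gamma> ` {0..} \<subseteq> M_bar \<and> (\<gamma> has_vector_derivative v) (at 0 within {0..})}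
        \<subseteq> {p. snd p \<bullet> snd x = 0}"
    proof (rule subsetI, elim CollectE exE conjE)
      fix p :: "real \<times> 'e" and \<gamma> assume g: "\<gamma> 0 = x" "\<gamma> ` {0..} \<subseteq> M_bar"
        "(\<gamma> has_vector_derivative p) (at 0 within {0..})"
      define b where "b = snd p"
      have s: "((\<lambda>t. snd (\<gamma> t)) has_vector_derivative b) (at 0 within {0..})"
        unfolding b_def by (rule bounded_linear.has_vector_derivative[OF bounded_linear_snd g(3)])
      have "((\<lambda>t. snd (\<gamma> t) \<bullet> snd (\<gamma> t)) has_vector_derivative (snd (\<gamma> 0) \<bullet> b + b \<bullet> snd (\<gamma> 0))) (at 0 within {0..})"
        by (rule bounded_bilinear.has_vector_derivative[OF bounded_bilinear_inner s s])
      moreover have "((\<lambda>t. snd (\<gamma> t) \<bullet> snd (\<gamma> t)) has_vector_derivative 0) (at 0 within {0..})"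
      proof (rule has_vector_derivative_transform[of 0 "{0..}" _ "\<lambda>t. 1"])
        show "snd (\<gamma> t) \<bullet> snd (\<gamma> t) = 1" if "t \<in> {0..}" for t
        proof -
          have "\<gamma> t \<in> M_bar" using g(2) that by blast
          then have "norm (snd (\<gamma> t)) = 1" unfolding M_bar_def by auto
          then show ?thesis by (simp flip: power2_norm_eq_inner)
        qed
      qed auto
      ultimately have "snd (\<gamma> 0) \<bullet> b + b \<bullet> snd (\<gamma> 0) = 0" by (rule velocity_unique)
      then show "p \<in> {p. snd p \<bullet> snd x = 0}" unfolding g(1) b_def by (simp add: inner_commute)
    qed
  qed
  then show ?thesis using assms(2) by blast
qed

text \<open>
The velocity of a great circle.
\<close>
lemma tangent_space_M_bdry:
  fixes u w :: "'e::euclidean_space"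
  assumes "norm u = 1" "w \<bullet> u = 0"
  shows "(0, w) \<in> tangent_space M_bdry (0, u)"
proof (cases "w = 0")
  case True
  then show ?thesis unfolding tangent_space_def by (simp add: span_0 flip: zero_prod_def)
next
  case False
  define n where "n = norm w"
  have n: "n > 0" unfolding n_def using False by simp
  define \<gamma> where "\<gamma> t = (0::real, cos (n * t) *\<^sub>R u + sin (n * t) *\<^sub>R (w /\<^sub>R n))" for t
  show ?thesis
  proof (rule velocity_mem_tangent_space[of \<gamma>])
    show "\<gamma> 0 = (0, u)" unfolding \<gamma>_def by simp
    have "norm (cos (n * t) *\<^sub>R u + sin (n * t) *\<^sub>R (w /\<^sub>R n)) = 1" for t
    proof -
      define e where "e = w /\<^sub>R n"
      have "u \<bullet> u = 1" using assms(1) by (simp flip: power2_norm_eq_inner)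
      moreover have "e \<bullet> e = 1"
        using n unfolding n_def e_def by (simp add: power2_norm_eq_inner[symmetric] power2_eq_square)
      moreover have "e \<bullet> u = 0" "u \<bullet> e = 0" using assms(2) unfolding e_def by (auto simp: inner_commute)
      ultimately have "(cos (n * t) *\<^sub>R u + sin (n * t) *\<^sub>R (w /\<^sub>R n)) \<bullet> (cos (n * t) *\<^sub>R u + sin (n * t) *\<^sub>R (w /\<^sub>R n))
         = cos (n * t) * cos (n * t) + sin (n * t) * sin (n * t)"
        unfolding e_def[symmetric] by (simp add: inner_add_left inner_add_right)
      also have "\<dots> = 1" by (metis sin_cos_squared_add3)
      finally show ?thesis by (simp add: norm_eq_sqrt_inner)
    qed
    then show "\<gamma> ` {0..} \<subseteq> M_bdry" unfolding \<gamma>_def M_bdry_def by auto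
    have "((\<lambda>t. cos (n * t) *\<^sub>R u + sin (n * t) *\<^sub>R (w /\<^sub>R n)) has_vector_derivative w) (at 0 within {0..})"
      using n by (auto intro!: derivative_eq_intros)
    then show "(\<gamma> has_vector_derivative (0, w)) (at 0 within {0..})"
      unfolding \<gamma>_def by (intro has_vector_derivative_Pair has_vector_derivative_const)
  qed
qed

lemma cone_model_M_bar: "cone_model d f \<subseteq> M_bar"
  unfolding cone_model_def M_bar_def by (auto simp: mem_Times_iff)

lemma closed_cone_model:
  fixes f :: "('n::finite \<Rightarrow>\<^sub>0 nat) \<Rightarrow> 'k::{real_normed_field, euclidean_space}"
  shows "closed (cone_model d f)"
proof -
  have "continuous_on UNIV (\<lambda>x :: real \<times> ('k ^ 'n). homog d f (of_real (fst x)) (snd x))"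
    using smooth_homog Ck_on_imp_continuous_on unfolding smooth_on_def by blast
  then show ?thesis unfolding cone_model_def
    by (intro closed_Collect_conj closed_Collect_eq closed_Collect_le continuous_intros)
qed

text \<open>
The curve runs in the direction \<open>(1, 0)\<close> of the chart. It provides a tangent vector that is transverse
to the boundary, and it shows that boundary points are limits of points with \<open>r > 0\<close>. It
stops at time \<open>\<tau>\<close> because a curve that defines a tangent vector must stay in the set for all times.
\<close>
lemma chart_inward_curve:
  fixes W :: "(real \<times> 'e::euclidean_space) set"
  assumes chart: "ambient_chart W \<phi>" and x: "x \<in> W" "x \<in> M" "fst x = 0"
    and V: "subspace V" "(1, 0) \<in> V" and fst: "\<forall>x\<in>W. fst (\<phi> x) = fst x"
    and M: "\<phi> ` (M \<inter> W) = \<phi> ` W \<inter> {y \<in> V. 0 \<le> fst y}"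
  obtains \<gamma> v where "\<gamma> 0 = x" "\<gamma> ` {0..} \<subseteq> M \<inter> W" "(\<gamma> has_vector_derivative v) (at 0 within {0..})"
    "fst v = 1" "\<And>t. t > 0 \<Longrightarrow> fst (\<gamma> t) > 0"
proof -
  note P = chart[unfolded ambient_chart_def]
  define g where "g = inv_into W \<phi>"
  have gW: "g y \<in> W" "\<phi> (g y) = y" if "y \<in> \<phi> ` W" for y
    unfolding g_def using that by (auto intro: inv_into_into f_inv_into_f)
  have g\<phi>: "g (\<phi> y) = y" if "y \<in> W" for y unfolding g_def using P that by auto
  have fg: "fst (g y) = fst y" if "y \<in> \<phi> ` W" for y using gW[OF that] fst by metis
  have \<phi>x: "\<phi> x \<in> \<phi> ` W" "\<phi> x \<in> V" "fst (\<phi> x) = 0" using x M fst by auto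
  obtain \<tau>' where \<tau>': "\<tau>' > 0" "ball (\<phi> x) \<tau>' \<subseteq> \<phi> ` W" using P \<phi>x(1) open_contains_ball by blast
  define \<tau> where "\<tau> = \<tau>' / 2"
  have \<tau>: "\<tau> > 0" unfolding \<tau>_def using \<tau>' by simp
  define c where "c t = \<phi> x + min t \<tau> *\<^sub>R (1, 0)" for t
  have c: "c t \<in> \<phi> ` W \<inter> {y \<in> V. 0 \<le> fst y}" "fst (c t) = min t \<tau>" if "t \<ge> 0" for t
  proof -
    have "dist (\<phi> x) (c t) = \<bar>min t \<tau>\<bar>" unfolding c_def dist_norm by (simp add: norm_Pair)
    also have "\<dots> < \<tau>'" using that \<tau> unfolding \<tau>_def by auto
    finally have "c t \<in> \<phi> ` W" using \<tau>'(2) by auto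
    moreover have "c t \<in> V" unfolding c_def using V \<phi>x(2) by (intro subspace_add subspace_scale)
    ultimately show "c t \<in> \<phi> ` W \<inter> {y \<in> V. 0 \<le> fst y}" "fst (c t) = min t \<tau>"
      using \<phi>x(3) that \<tau> unfolding c_def by auto
  qed
  define \<gamma> where "\<gamma> t = g (c t)" for t
  have \<gamma>M: "\<gamma> t \<in> M \<inter> W" if "t \<ge> 0" for t
  proof -
    have "c t \<in> \<phi> ` (M \<inter> W)" using c(1)[OF that] M by simp
    then obtain z where "z \<in> M \<inter> W" "c t = \<phi> z" by blast
    then show ?thesis unfolding \<gamma>_def using g\<phi> by auto
  qed
  have f\<gamma>: "fst (\<gamma> t) = min t \<tau>" if "t \<ge> 0" for t
    unfolding \<gamma>_def using fg c[OF that] by auto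
  have c0: "c 0 = \<phi> x" unfolding c_def using \<tau> by (simp flip: zero_prod_def)
  have dc: "(c has_vector_derivative (1, 0)) (at 0 within {0..})"
  proof (rule has_vector_derivative_transform_within[where d = \<tau> and f = "\<lambda>t. \<phi> x + t *\<^sub>R (1, 0)"])
    show "((\<lambda>t. \<phi> x + t *\<^sub>R (1, 0)) has_vector_derivative (1, 0)) (at 0 within {0..})"
      by (auto intro!: derivative_eq_intros)
  qed (use \<tau> in \<open>auto simp: c_def\<close>)
  have "(g has_derivative frechet_derivative g (at (c 0))) (at (c 0))"
    unfolding c0 g_def by (rule smooth_on_derivative(1)[of "\<phi> ` W"]) (use P \<phi>x in auto)
  then have "((g \<circ> c) has_vector_derivative frechet_derivative g (at (c 0)) (1, 0)) (at 0 within {0..})"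
    by (rule vector_derivative_diff_chain_within[OF dc has_derivative_at_withinI])
  then obtain v where v: "(\<gamma> has_vector_derivative v) (at 0 within {0..})"
    unfolding \<gamma>_def o_def by blast
  have "fst v = 1"
  proof (rule velocity_unique[of "\<lambda>t. fst (\<gamma> t)"])
    show "((\<lambda>t. fst (\<gamma> t)) has_vector_derivative fst v) (at 0 within {0..})"
      by (rule bounded_linear.has_vector_derivative[OF bounded_linear_fst v])
    show "((\<lambda>t. fst (\<gamma> t)) has_vector_derivative 1) (at 0 within {0..})"
    proof (rule has_vector_derivative_transform_within[where d = \<tau> and f = "\<lambda>t. t"])
      show "t = fst (\<gamma> t)" if "t \<in> {0..}" "dist t 0 < \<tau>" for t
        using f\<gamma>[of t] that by auto
    qed (use \<tau> in \<open>auto intro!: derivative_eq_intros\<close>)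
  qed
  moreover have "\<gamma> 0 = x" unfolding \<gamma>_def c0 using g\<phi> x(1) by simp
  ultimately show ?thesis using that[of \<gamma> v] \<gamma>M v f\<gamma> \<tau> by auto
qed

text \<open>
The p-sub-manifold \<open>N\<close> is the part of \<open>cone_model\<close> that is covered by the charts at its boundary points.
The charts at the boundary also serve for the interior points, after restriction to \<open>r > 0\<close>.
\<close>
lemma conic_at_infinity_nondegenerate:
  fixes f :: "('n::finite \<Rightarrow>\<^sub>0 nat) \<Rightarrow> 'k::{real_normed_field, euclidean_space}"
  assumes nondegenerate: "nondegenerate d f"
  shows "conic_at_infinity {z. homog d f 1 z = 0}"
proof (cases "bounded {z. homog d f 1 z = 0}")
  case True
  then show ?thesis unfolding conic_at_infinity_def by simp
next
  case False
  let ?Z = "{z. homog d f 1 z = 0}"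
  let ?M = "cone_model d f"
  define A where "A = {p \<in> {0<..} \<times> sphere 0 1. infinity_chart p \<in> ?Z}"
  have A: "x \<in> A \<longleftrightarrow> x \<in> ?M \<and> 0 < fst x" for x
  proof (cases "0 < fst x")
    case True
    obtain r u where x: "x = (r, u)" by (cases x)
    have r: "r > 0" using True x by simp
    have "homog d f (of_real r * 1) (r *\<^sub>R (u /\<^sub>R r)) = of_real r ^ d * homog d f 1 (u /\<^sub>R r)"
    proof (rule homog_scale)
      fix i show "(r *\<^sub>R (u /\<^sub>R r)) $ i = of_real r * (u /\<^sub>R r) $ i"
        by (simp only: vector_scaleR_component[of r] scaleR_conv_of_real[of r "(u /\<^sub>R r) $ i"])
    qed
    then have "homog d f (of_real r) u = 0 \<longleftrightarrow> homog d f 1 (u /\<^sub>R r) = 0" using r by simp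
    then show ?thesis unfolding A_def cone_model_def infinity_chart_def x using r by auto
  next
    case False
    then show ?thesis unfolding A_def by (auto simp: mem_Times_iff)
  qed
  have ci: "closure_infinity ?Z = closure A" unfolding closure_infinity_def A_def ..
  have cM: "closure A \<subseteq> ?M" by (rule closure_minimal[OF _ closed_cone_model]) (use A in auto)
  define Q where "Q = ?M \<inter> M_bdry"
  have Qx: "fst x = 0" "norm (snd x) = 1" "homog d f 0 (snd x) = 0" "x = (0, snd x)" if "x \<in> Q" for x
    using that unfolding Q_def cone_model_def M_bdry_def by auto
  define k where "k = DIM(real \<times> ('k ^ 'n)) - (DIM('k) + 1)"
  define P where "P x W \<phi> V \<longleftrightarrow> ambient_chart W \<phi> \<and> x \<in> W \<and> subspace V \<and>
     dim V = k \<and> (1, 0) \<in> V \<and> (\<forall>x\<in>W. fst (\<phi> x) = fst x) \<and>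
     \<phi> ` (?M \<inter> W) = \<phi> ` W \<inter> {y \<in> V. 0 \<le> fst y}"
    for x W V and \<phi> :: "real \<times> ('k ^ 'n) \<Rightarrow> real \<times> ('k ^ 'n)"
  have "\<exists>W \<phi> V. P x W \<phi> V" if "x \<in> Q" for x
    using cone_chart[OF nondegenerate Qx(2,3)[OF that]] unfolding P_def k_def Qx(4)[OF that, symmetric] .
  then obtain W \<phi> V where WV: "\<And>x. x \<in> Q \<Longrightarrow> P x (W x) (\<phi> x) (V x)" by metis
  have ch: "ambient_chart (W x) (\<phi> x)" "x \<in> W x" "subspace (V x)" "dim (V x) = k" "(1, 0) \<in> V x"
    "\<forall>y\<in>W x. fst (\<phi> x y) = fst y" "\<phi> x ` (?M \<inter> W x) = \<phi> x ` W x \<inter> {y \<in> V x. 0 \<le> fst y}"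
    if "x \<in> Q" for x
    using WV[OF that] unfolding P_def by simp_all
  \<comment> \<open>Points of the model in \<open>W0\<close> are the ones that the charts at boundary points describe.\<close>
  define W0 where "W0 = (\<Union>x\<in>Q. W x)"
  define N where "N = ?M \<inter> W0"
  have oW: "open (W x)" if "x \<in> Q" for x using ch(1)[OF that] unfolding ambient_chart_def by blast
  have NW: "N \<inter> W x = ?M \<inter> W x" if "x \<in> Q" for x using that unfolding N_def W0_def by blast
  have NQ: "N \<inter> M_bdry = Q" unfolding N_def Q_def W0_def using ch(2) unfolding Q_def by blast
  have NB: "N \<subseteq> M_bar" unfolding N_def using cone_model_M_bar by blast
  have f0: "0 < fst x" if "x \<in> N - Q" for x
  proof -
    have x: "x \<in> ?M" "x \<notin> Q" using that unfolding N_def by auto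
    then have "fst x \<noteq> 0" unfolding Q_def cone_model_def M_bdry_def by (cases x) auto
    then show ?thesis using x(1) unfolding cone_model_def by simp
  qed
  have curve: "\<exists>\<gamma> v. \<gamma> 0 = x \<and> \<gamma> ` {0..} \<subseteq> N \<and> (\<gamma> has_vector_derivative v) (at 0 within {0..}) \<and>
    fst v = 1 \<and> (\<forall>t>0. fst (\<gamma> t) > 0)" if x: "x \<in> Q" for x
  proof -
    have "x \<in> ?M" using x unfolding Q_def by blast
    obtain \<gamma> v where "\<gamma> 0 = x" "\<gamma> ` {0..} \<subseteq> ?M \<inter> W x" "(\<gamma> has_vector_derivative v) (at 0 within {0..})"
      "fst v = 1" "\<And>t. t > 0 \<Longrightarrow> fst (\<gamma> t) > 0"
      using chart_inward_curve[OF ch(1)[OF x] ch(2)[OF x] \<open>x \<in> ?M\<close> Qx(1)[OF x] ch(3)[OF x] ch(5)[OF x] ch(6)[OF x] ch(7)[OF x]]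
      by blast
    then show ?thesis using NW[OF x] by blast
  qed
  have sub: "submanifold_with_boundary k N (N \<inter> M_bdry)"
    unfolding submanifold_with_boundary_def NQ
  proof (intro conjI ballI)
    show "Q \<subseteq> N" using NQ by blast
  next
    fix x assume x: "x \<in> N - Q"
    then obtain q where q: "q \<in> Q" "x \<in> W q" unfolding N_def W0_def by blast
    define W' where "W' = W q \<inter> {y. 0 < fst y}"
    have oW': "open W'" unfolding W'_def
      by (intro open_Int oW q open_Collect_less continuous_intros)
    have ch': "ambient_chart W' (\<phi> q)"
      by (rule ambient_chart_restrict[OF ch(1)[OF q(1)] oW']) (auto simp: W'_def)
    have inj: "inj_on (\<phi> q) (W q)" using ch(1)[OF q(1)] unfolding ambient_chart_def by blast
    have "\<phi> q ` (N \<inter> W') = \<phi> q ` W' \<inter> V q"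
    proof (intro equalityI subsetI)
      fix y assume "y \<in> \<phi> q ` (N \<inter> W')"
      then obtain z where z: "z \<in> N" "z \<in> W'" "y = \<phi> q z" by blast
      then have "z \<in> ?M \<inter> W q" unfolding N_def W'_def by blast
      then have "y \<in> V q" using ch(7)[OF q(1)] z(3) by blast
      then show "y \<in> \<phi> q ` W' \<inter> V q" using z by blast
    next
      fix y assume y: "y \<in> \<phi> q ` W' \<inter> V q"
      then obtain z where z: "z \<in> W q" "0 < fst z" "y = \<phi> q z" "z \<in> W'" unfolding W'_def by blast
      then have "0 \<le> fst y" using ch(6)[OF q(1)] by simp
      then have "y \<in> \<phi> q ` (?M \<inter> W q)" using ch(7)[OF q(1)] y z(1,3) by blast
      then obtain z' where z': "z' \<in> ?M" "z' \<in> W q" "y = \<phi> q z'" by blast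
      then have "z = z'" using inj z(1,3) unfolding inj_on_def by blast
      then have "z \<in> N \<inter> W'" using z' z q(1) unfolding N_def W0_def by blast
      then show "y \<in> \<phi> q ` (N \<inter> W')" using z(3) by blast
    qed
    then show "\<exists>W \<phi> V. ambient_chart W \<phi> \<and> x \<in> W \<and> subspace V \<and> dim V = k \<and> \<phi> ` (N \<inter> W) = \<phi> ` W \<inter> V"
      using ch' q(2) f0[OF x] ch(3,4)[OF q(1)] unfolding W'_def by blast
  next
    fix x assume x: "x \<in> Q"
    have "(1, 0) \<bullet> y = fst y" for y :: "real \<times> ('k ^ 'n)" by (simp add: inner_prod_def)
    then have "(1, 0) \<bullet> \<phi> x x = 0" "\<phi> x ` (N \<inter> W x) = \<phi> x ` W x \<inter> {y \<in> V x. 0 \<le> (1, 0) \<bullet> y}"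
      using ch(6)[OF x] ch(2)[OF x] Qx(1)[OF x] ch(7)[OF x] unfolding NW[OF x] by auto
    moreover have "(1::real, 0 :: 'k ^ 'n) \<noteq> 0" by (simp add: zero_prod_def)
    ultimately show "\<exists>W \<phi> V \<nu>. ambient_chart W \<phi> \<and> x \<in> W \<and> subspace V \<and> dim V = k \<and>
        \<nu> \<in> V \<and> \<nu> \<noteq> 0 \<and> \<nu> \<bullet> \<phi> x = 0 \<and> \<phi> ` (N \<inter> W) = \<phi> ` W \<inter> {y \<in> V. 0 \<le> \<nu> \<bullet> y}"
      using ch(1-5)[OF x] by blast
  qed
  have psub: "p_submanifold k N M_bar M_bdry"
    unfolding p_submanifold_def
  proof (intro conjI NB sub ballI)
    fix x assume "x \<in> N \<inter> M_bdry"
    then have x: "x \<in> Q" using NQ by blast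
    obtain \<gamma> v where g: "\<gamma> 0 = x" "\<gamma> ` {0..} \<subseteq> N" "(\<gamma> has_vector_derivative v) (at 0 within {0..})" "fst v = 1"
      using curve[OF x] by blast
    have vN: "v \<in> tangent_space N x" by (rule velocity_mem_tangent_space[OF g(1,2,3)])
    have NP: "tangent_space N x \<subseteq> tangent_space M_bar x" by (rule tangent_space_mono[OF NB])
    have BP: "tangent_space M_bdry x \<subseteq> tangent_space M_bar x"
      by (rule tangent_space_mono) (auto simp: M_bdry_def M_bar_def)
    have xM: "x \<in> M_bar" using x NB NQ by blast
    show "{a + b |a b. a \<in> tangent_space N x \<and> b \<in> tangent_space M_bdry x} = tangent_space M_bar x"
    proof (intro equalityI subsetI)
      fix p assume "p \<in> {a + b |a b. a \<in> tangent_space N x \<and> b \<in> tangent_space M_bdry x}"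
      then obtain a b where ab: "a \<in> tangent_space M_bar x" "b \<in> tangent_space M_bar x" "p = a + b"
        using NP BP by blast
      show "p \<in> tangent_space M_bar x" using ab(1,2) unfolding ab(3) tangent_space_def by (rule span_add)
    next
      fix p assume p: "p \<in> tangent_space M_bar x"
      have "snd p \<bullet> snd x = 0" "snd v \<bullet> snd x = 0"
        by (rule tangent_space_M_bar[OF xM p], rule tangent_space_M_bar[OF xM subsetD[OF NP vN]])
      then have "(snd p - fst p *\<^sub>R snd v) \<bullet> snd x = 0" by (simp add: inner_diff_left)
      then have "(0, snd p - fst p *\<^sub>R snd v) \<in> tangent_space M_bdry (0, snd x)"
        by (rule tangent_space_M_bdry[OF Qx(2)[OF x]])
      then have "(0, snd p - fst p *\<^sub>R snd v) \<in> tangent_space M_bdry x" unfolding Qx(4)[OF x, symmetric] .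
      moreover have "fst p *\<^sub>R v \<in> tangent_space N x"
        using vN unfolding tangent_space_def by (rule span_scale)
      moreover have "p = fst p *\<^sub>R v + (0, snd p - fst p *\<^sub>R snd v)" using g(4) by (simp add: prod_eq_iff)
      ultimately show "p \<in> {a + b |a b. a \<in> tangent_space N x \<and> b \<in> tangent_space M_bdry x}" by blast
    qed
  qed
  have oW0: "open W0" unfolding W0_def using oW by blast
  have trace: "closure A \<inter> M_bdry \<subseteq> W0" using cM ch(2) unfolding W0_def Q_def by blast
  have eq: "closure A \<inter> W0 = N \<inter> W0"
  proof (intro equalityI subsetI)
    fix x assume "x \<in> closure A \<inter> W0"
    then show "x \<in> N \<inter> W0" using cM unfolding N_def by blast
  next
    fix x assume x: "x \<in> N \<inter> W0"
    have "x \<in> closure A"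
    proof (cases "x \<in> Q")
      case False
      then have "x \<in> A" using A f0[of x] x unfolding N_def by blast
      then show ?thesis using closure_subset by blast
    next
      case True
      then obtain \<gamma> v where g: "\<gamma> 0 = x" "\<gamma> ` {0..} \<subseteq> N" "(\<gamma> has_vector_derivative v) (at 0 within {0..})"
        "\<And>t. t > 0 \<Longrightarrow> fst (\<gamma> t) > 0" using curve by blast
      have "continuous (at 0 within {0..}) \<gamma>" using g(3) by (rule has_vector_derivative_continuous)
      then have lim: "(\<gamma> \<longlongrightarrow> x) (at 0 within {0..})" unfolding continuous_within g(1) .
      have "(\<lambda>n. \<gamma> (inverse (real (Suc n)))) \<longlonglongrightarrow> x"
      proof (rule filterlim_compose[OF lim])
        show "filterlim (\<lambda>n. inverse (real (Suc n))) (at 0 within {0..}) sequentially"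
          unfolding filterlim_at using LIMSEQ_inverse_real_of_nat by (auto intro!: always_eventually)
      qed
      moreover have "\<gamma> (inverse (real (Suc n))) \<in> A" for n
        using A g(2) g(4)[of "inverse (real (Suc n))"] unfolding N_def by auto
      ultimately show ?thesis unfolding closure_sequential
        by (intro exI[of _ "\<lambda>n. \<gamma> (inverse (real (Suc n)))"] conjI allI)
    qed
    then show "x \<in> closure A \<inter> W0" using x by blast
  qed
  have ne: "closure A \<inter> M_bdry \<noteq> {}"
  proof -
    have "\<forall>n. \<exists>z\<in>?Z. norm z > real (Suc n)"
      using False unfolding bounded_iff by (meson not_le)
    then obtain z where z: "\<And>n. z n \<in> ?Z" "\<And>n. norm (z n) > real (Suc n)" by metis
    have zp: "norm (z n) > 0" for n using z(2)[of n] by linarith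
    define p where "p n = (inverse (norm (z n)), z n /\<^sub>R norm (z n))" for n
    have pA: "p n \<in> A" for n
      unfolding A_def p_def infinity_chart_def using z(1)[of n] zp[of n] by auto
    have "snd (p n) \<in> sphere 0 1" for n unfolding p_def using zp[of n] by simp
    with compact_sphere obtain u r where r: "u \<in> sphere 0 1" "strict_mono (r :: nat \<Rightarrow> nat)" "(\<lambda>n. snd (p (r n))) \<longlonglongrightarrow> u"
      by (rule compact_subsequence)
    have "(\<lambda>n. fst (p n)) \<longlonglongrightarrow> 0"
    proof (rule tendsto_sandwich[OF _ _ tendsto_const LIMSEQ_inverse_real_of_nat])
      show "eventually (\<lambda>n. 0 \<le> fst (p n)) sequentially" unfolding p_def by simp
      show "eventually (\<lambda>n. fst (p n) \<le> inverse (real (Suc n))) sequentially"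
      proof (rule always_eventually, rule allI)
        fix n
        show "fst (p n) \<le> inverse (real (Suc n))"
          unfolding p_def using le_imp_inverse_le[OF less_imp_le[OF z(2)[of n]]] by simp
      qed
    qed
    then have "(\<lambda>n. fst (p (r n))) \<longlonglongrightarrow> 0" using LIMSEQ_subseq_LIMSEQ[OF _ r(2)] by (simp add: o_def)
    then have "(\<lambda>n. (fst (p (r n)), snd (p (r n)))) \<longlonglongrightarrow> (0, u)" by (intro tendsto_Pair r(3))
    then have "(\<lambda>n. p (r n)) \<longlonglongrightarrow> (0, u)" by simp
    then have "(0, u) \<in> closure A" unfolding closure_sequential using pA by (intro exI[of _ "\<lambda>n. p (r n)"]) auto
    then show ?thesis using r(1) unfolding M_bdry_def by blast
  qed
  show ?thesis unfolding conic_at_infinity_def ci using ne psub oW0 trace eq by blast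
qed

section \<open>Non-vanishing of polynomials\<close>

text \<open>
Induction on the variables: grouping by the exponent of one variable \<open>j\<close> gives a univariate polynomial,
one coefficient of which is nonzero at a suitable choice of the remaining variables.
\<close>
lemma monomial_sum_nonvanishing:
  fixes c :: "('j \<Rightarrow> nat) \<Rightarrow> 'k::field_char_0"
  assumes "finite A" "finite M" "\<forall>m\<in>M. \<forall>m'\<in>M. (\<forall>j\<in>A. m j = m' j) \<longrightarrow> m = m'" "m0 \<in> M" "c m0 \<noteq> 0"
  shows "\<exists>x. (\<Sum>m\<in>M. c m * (\<Prod>j\<in>A. x j ^ m j)) \<noteq> 0"
  using assms
proof (induction A arbitrary: M m0 rule: finite_induct)
  case empty
  then have "M = {m0}" by auto
  then show ?case using empty by simp
next
  case (insert j A)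
  define N where "N = {m\<in>M. m j = m0 j}"
  have "\<exists>x. (\<Sum>m\<in>N. c m * (\<Prod>j\<in>A. x j ^ m j)) \<noteq> 0"
  proof (rule insert.IH)
    show "\<forall>m\<in>N. \<forall>m'\<in>N. (\<forall>j\<in>A. m j = m' j) \<longrightarrow> m = m'"
      using insert.prems(2) unfolding N_def by auto
  qed (use insert.prems in \<open>auto simp: N_def\<close>)
  then obtain x where x: "(\<Sum>m\<in>N. c m * (\<Prod>j\<in>A. x j ^ m j)) \<noteq> 0" by blast
  define q where "q = (\<Sum>m\<in>M. monom (c m * (\<Prod>j\<in>A. x j ^ m j)) (m j))"
  have "coeff q (m0 j) = (\<Sum>m\<in>M. if m j = m0 j then c m * (\<Prod>j\<in>A. x j ^ m j) else 0)"
    unfolding q_def by (simp add: coeff_sum)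
  also have "\<dots> = (\<Sum>m\<in>N. c m * (\<Prod>j\<in>A. x j ^ m j))"
    unfolding N_def using insert.prems(1) by (simp add: sum.inter_filter)
  finally have "q \<noteq> 0" using x by auto
  then have "finite {t. poly q t = 0}" by (rule poly_roots_finite)
  then have "\<exists>t. poly q t \<noteq> 0" using infinite_UNIV_char_0[where 'a = 'k] by (metis (mono_tags, lifting) Collect_cong UNIV_def)
  then obtain t where t: "poly q t \<noteq> 0" by blast
  define y where "y = x(j := t)"
  have "(\<Prod>l\<in>insert j A. y l ^ m l) = t ^ m j * (\<Prod>l\<in>A. x l ^ m l)" for m
  proof -
    have "(\<Prod>l\<in>insert j A. y l ^ m l) = y j ^ m j * (\<Prod>l\<in>A. y l ^ m l)" using insert.hyps by simp
    also have "(\<Prod>l\<in>A. y l ^ m l) = (\<Prod>l\<in>A. x l ^ m l)"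
      using insert.hyps(2) unfolding y_def by (intro prod.cong) auto
    finally show ?thesis unfolding y_def by simp
  qed
  then have "(\<Sum>m\<in>M. c m * (\<Prod>l\<in>insert j A. y l ^ m l)) = poly q t"
    unfolding q_def by (simp add: poly_sum poly_monom mult_ac)
  then show ?case using t by metis
qed

lemma peval_cong:
  assumes "\<And>m i. m \<in> Poly_Mapping.keys p \<Longrightarrow> i \<in> Poly_Mapping.keys m \<Longrightarrow> x i = y i"
  shows "peval x p = peval y p"
  unfolding peval_def monomial_value_def using assms by (auto intro!: sum.cong prod.cong)

lemma mpoly_nonvanishing:
  fixes p :: "('j, 'k::field_char_0) mpoly"
  assumes "p \<noteq> 0"
  obtains x where "peval x p \<noteq> 0"
proof -
  define A where "A = (\<Union>m\<in>Poly_Mapping.keys p. Poly_Mapping.keys m)"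
  have fA: "finite A" unfolding A_def by auto
  define c where "c f = Poly_Mapping.lookup p (Poly_Mapping.Abs_poly_mapping f)" for f
  let ?M = "Poly_Mapping.lookup ` Poly_Mapping.keys p"
  have inj: "inj_on Poly_Mapping.lookup (Poly_Mapping.keys p)" by (auto simp: inj_on_def)
  have c: "c (Poly_Mapping.lookup m) = Poly_Mapping.lookup p m" for m
    unfolding c_def by (simp add: lookup_inverse)
  obtain m0 where m0: "m0 \<in> Poly_Mapping.keys p" using assms by (metis all_not_in_conv keys_eq_empty)
  have "\<exists>x. (\<Sum>f\<in>?M. c f * (\<Prod>j\<in>A. x j ^ f j)) \<noteq> 0"
  proof (rule monomial_sum_nonvanishing[OF fA])
    show "\<forall>f\<in>?M. \<forall>f'\<in>?M. (\<forall>j\<in>A. f j = f' j) \<longrightarrow> f = f'"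
    proof (intro ballI impI ext)
      fix f f' j assume f: "f \<in> ?M" "f' \<in> ?M" "\<forall>j\<in>A. f j = f' j"
      show "f j = f' j"
      proof (cases "j \<in> A")
        case False
        then have "f j = 0" "f' j = 0" using f unfolding A_def by (auto simp: in_keys_iff)
        then show ?thesis by simp
      qed (use f in auto)
    qed
    show "Poly_Mapping.lookup m0 \<in> ?M" using m0 by blast
    show "c (Poly_Mapping.lookup m0) \<noteq> 0" using m0 c by (simp add: in_keys_iff)
  qed auto
  then obtain x where "(\<Sum>f\<in>?M. c f * (\<Prod>j\<in>A. x j ^ f j)) \<noteq> 0" by blast
  moreover have "(\<Sum>f\<in>?M. c f * (\<Prod>j\<in>A. x j ^ f j)) = peval x p"
    unfolding sum.reindex[OF inj] o_def c peval_def
    by (intro sum.cong refl arg_cong2[where f = "(*)"] monomial_value_superset[symmetric] fA) (auto simp: A_def)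
  ultimately show ?thesis using that by metis
qed

lemma peval_line:
  fixes p :: "('j, 'k::field_char_0) mpoly"
  shows "\<exists>r. \<forall>s. poly r s = peval (\<lambda>i. x i + s * y i) p"
proof
  show "\<forall>s. poly (\<Sum>m\<in>Poly_Mapping.keys p. smult (Poly_Mapping.lookup p m)
     (\<Prod>i\<in>Poly_Mapping.keys m. [:x i, y i:] ^ Poly_Mapping.lookup m i)) s = peval (\<lambda>i. x i + s * y i) p"
    unfolding peval_def monomial_value_def by (simp add: poly_sum poly_prod)
qed

lemma finite_zeros_on_line:
  fixes p :: "('j, 'k::field_char_0) mpoly"
  assumes "peval (\<lambda>i. x i + s0 * y i) p \<noteq> 0"
  shows "finite {s. peval (\<lambda>i. x i + s * y i) p = 0}"
proof -
  obtain r where r: "\<And>s. poly r s = peval (\<lambda>i. x i + s * y i) p" using peval_line by blast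
  then have "r \<noteq> 0" using assms by (metis poly_0)
  then have "finite {s. poly r s = 0}" by (rule poly_roots_finite)
  then show ?thesis unfolding r .
qed

lemma common_nonvanishing_on_line:
  fixes p q :: "('j, 'k::field_char_0) mpoly"
  assumes "peval x p \<noteq> 0" "peval y q \<noteq> 0"
  obtains s where "peval (\<lambda>i. x i + s * (y i - x i)) p \<noteq> 0" "peval (\<lambda>i. x i + s * (y i - x i)) q \<noteq> 0"
proof -
  have "finite {s. peval (\<lambda>i. x i + s * (y i - x i)) p = 0}"
    by (rule finite_zeros_on_line[of _ 0]) (use assms in simp)
  moreover have "finite {s. peval (\<lambda>i. x i + s * (y i - x i)) q = 0}"
    by (rule finite_zeros_on_line[of _ 1]) (use assms in simp)
  ultimately have "finite ({s. peval (\<lambda>i. x i + s * (y i - x i)) p = 0} \<union> {s. peval (\<lambda>i. x i + s * (y i - x i)) q = 0})"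
    by (rule finite_UnI)
  then obtain s where "s \<notin> {s. peval (\<lambda>i. x i + s * (y i - x i)) p = 0} \<union> {s. peval (\<lambda>i. x i + s * (y i - x i)) q = 0}"
    using ex_new_if_finite[OF infinite_UNIV_char_0] by blast
  then show ?thesis using that by blast
qed

lemma mpoly_mult_nonzero:
  fixes p q :: "('j, 'k::field_char_0) mpoly"
  assumes "p \<noteq> 0" "q \<noteq> 0" shows "p * q \<noteq> 0"
proof
  assume 0: "p * q = 0"
  obtain x where x: "peval x p \<noteq> 0" using mpoly_nonvanishing[OF assms(1)] .
  obtain y where y: "peval y q \<noteq> 0" using mpoly_nonvanishing[OF assms(2)] .
  obtain s where "peval (\<lambda>i. x i + s * (y i - x i)) p \<noteq> 0" "peval (\<lambda>i. x i + s * (y i - x i)) q \<noteq> 0"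
    using common_nonvanishing_on_line[OF x y] .
  then have "peval (\<lambda>i. x i + s * (y i - x i)) (p * q) \<noteq> 0" by (simp add: peval_mult)
  then show False using 0 by simp
qed

section \<open>Images of polynomial maps\<close>

text \<open>
Gaussian elimination: an equation in which \<open>u0\<close> occurs is used to eliminate \<open>u0\<close> from the others.
\<close>
lemma homogeneous_system:
  fixes a :: "'e \<Rightarrow> 'u \<Rightarrow> 'k::field"
  assumes "finite E" "finite U" "card E < card U"
  shows "\<exists>c. (\<exists>u\<in>U. c u \<noteq> 0) \<and> (\<forall>e\<in>E. (\<Sum>u\<in>U. c u * a e u) = 0)"
  using assms
proof (induction E arbitrary: U a rule: finite_induct)
  case empty
  then have "U \<noteq> {}" by auto
  then show ?case by (intro exI[of _ "\<lambda>_. 1"]) auto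
next
  case (insert e E)
  show ?case
  proof (cases "\<forall>u\<in>U. a e u = 0")
    case True
    have "card E < card U" using insert by simp
    then obtain c where "\<exists>u\<in>U. c u \<noteq> 0" "\<forall>e\<in>E. (\<Sum>u\<in>U. c u * a e u) = 0"
      using insert.IH[OF insert.prems(1), of a] by blast
    then show ?thesis using True by (intro exI[of _ c]) auto
  next
    case False
    then obtain u0 where u0: "u0 \<in> U" "a e u0 \<noteq> 0" by blast
    define U' where "U' = U - {u0}"
    have U: "finite U'" "u0 \<notin> U'" "U = insert u0 U'" using insert.prems(1) u0 unfolding U'_def by auto
    have "card E < card U'" using insert.prems insert.hyps U by simp
    then obtain c' where c': "\<exists>u\<in>U'. c' u \<noteq> 0"
      "\<forall>e'\<in>E. (\<Sum>u\<in>U'. c' u * (a e' u - a e' u0 * (a e u / a e u0))) = 0"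
      using insert.IH[OF U(1), of "\<lambda>e' u. a e' u - a e' u0 * (a e u / a e u0)"] by blast
    define t where "t = (\<Sum>u\<in>U'. c' u * (a e u / a e u0))"
    \<comment> \<open>The value at \<open>u0\<close> is determined by the equation \<open>e\<close>.\<close>
  define c where "c u = (if u = u0 then - t else c' u)" for u
    have s: "(\<Sum>u\<in>U. c u * a e' u) = - t * a e' u0 + (\<Sum>u\<in>U'. c' u * a e' u)" for e'
    proof -
      have "(\<Sum>u\<in>U. c u * a e' u) = c u0 * a e' u0 + (\<Sum>u\<in>U'. c u * a e' u)"
        unfolding U(3) using U(1,2) by simp
      also have "(\<Sum>u\<in>U'. c u * a e' u) = (\<Sum>u\<in>U'. c' u * a e' u)"
        using U(2) unfolding c_def by (intro sum.cong) auto
      finally show ?thesis unfolding c_def by simp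
    qed
    have "(\<Sum>u\<in>U. c u * a e u) = 0"
      unfolding s t_def using u0(2) by (simp add: sum_distrib_right)
    moreover have "(\<Sum>u\<in>U. c u * a e' u) = 0" if "e' \<in> E" for e'
    proof -
      have "0 = (\<Sum>u\<in>U'. c' u * a e' u) - (\<Sum>u\<in>U'. c' u * (a e u / a e u0) * a e' u0)"
        using c'(2) that by (simp add: right_diff_distrib sum_subtractf mult_ac)
      then show ?thesis unfolding s t_def by (simp add: sum_distrib_right)
    qed
    moreover have "\<exists>u\<in>U. c u \<noteq> 0" using c'(1) U(2,3) unfolding c_def by (metis insertCI)
    ultimately show ?thesis by (intro exI[of _ c]) auto
  qed
qed

lemma peval_prod: "peval x (\<Prod>a\<in>A. f a) = (\<Prod>a\<in>A. peval x (f a))"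
  by (induction A rule: infinite_finite_induct) (auto simp: peval_mult)

lemma peval_power: "peval x (p ^ n) = peval x p ^ n"
  by (induction n) (auto simp: peval_mult)

lemma peval_uminus: "peval x (- p) = - peval x p" for p :: "('j, 'k::comm_ring_1) mpoly"
  using peval_add[of x p "- p"] by (simp add: eq_neg_iff_add_eq_0 add.commute)

lemma peval_diff: "peval x (p - q) = peval x p - peval x q" for p q :: "('j, 'k::comm_ring_1) mpoly"
  using peval_add[of x "p - q" q] by simp

definition bounded_polys :: "'i set \<Rightarrow> nat \<Rightarrow> ('i, 'k::zero) mpoly set" where
  "bounded_polys I e = {p. \<forall>m\<in>Poly_Mapping.keys p. Poly_Mapping.keys m \<subseteq> I \<and> (\<forall>i. Poly_Mapping.lookup m i \<le> e)}"

text \<open>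
The polynomials in the variables \<open>I\<close>.
\<close>
definition polys_in :: "'i set \<Rightarrow> ('i, 'k::zero) mpoly set" where
  "polys_in I = {p. \<forall>m\<in>Poly_Mapping.keys p. Poly_Mapping.keys m \<subseteq> I}"

lemma bounded_polys_mult:
  fixes p q :: "('i, 'k::comm_semiring_1) mpoly"
  assumes "p \<in> bounded_polys I a" "q \<in> bounded_polys I b"
  shows "p * q \<in> bounded_polys I (a + b)"
  unfolding bounded_polys_def
proof (intro CollectI ballI)
  fix m assume "m \<in> Poly_Mapping.keys (p * q)"
  then obtain k l where m: "m = k + l" "k \<in> Poly_Mapping.keys p" "l \<in> Poly_Mapping.keys q"
    using keys_mult by blast
  have "Poly_Mapping.keys m \<subseteq> I"
    using assms m keys_add[of k l] unfolding bounded_polys_def by blast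
  moreover have "Poly_Mapping.lookup m i \<le> a + b" for i
    using assms m unfolding bounded_polys_def by (simp add: lookup_add add_mono)
  ultimately show "Poly_Mapping.keys m \<subseteq> I \<and> (\<forall>i. Poly_Mapping.lookup m i \<le> a + b)" by blast
qed

lemma bounded_polys_one: "(1 :: ('i, 'k::comm_semiring_1) mpoly) \<in> bounded_polys I 0"
  unfolding bounded_polys_def by simp

lemma bounded_polys_power:
  fixes p :: "('i, 'k::comm_semiring_1) mpoly"
  shows "p \<in> bounded_polys I a \<Longrightarrow> p ^ n \<in> bounded_polys I (n * a)"
  by (induction n) (auto simp: bounded_polys_one intro: bounded_polys_mult)

lemma bounded_polys_mono: "a \<le> b \<Longrightarrow> bounded_polys I a \<subseteq> bounded_polys I b"
  unfolding bounded_polys_def by (auto intro: order_trans)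

lemma bounded_polys_prod:
  fixes p :: "'j \<Rightarrow> ('i, 'k::comm_semiring_1) mpoly"
  assumes "finite J" "\<And>j. j \<in> J \<Longrightarrow> p j \<in> bounded_polys I a"
  shows "(\<Prod>j\<in>J. p j) \<in> bounded_polys I (card J * a)"
  using assms by (induction J rule: finite_induct) (auto simp: bounded_polys_one intro: bounded_polys_mult)

lemma polys_in_bounded:
  assumes "finite J" "\<And>j. j \<in> J \<Longrightarrow> q j \<in> polys_in I"
  shows "\<exists>e. \<forall>j\<in>J. q j \<in> bounded_polys I e"
proof -
  define e where "e = (\<Sum>j\<in>J. \<Sum>m\<in>Poly_Mapping.keys (q j). \<Sum>i\<in>Poly_Mapping.keys m. Poly_Mapping.lookup m i)"
  have "Poly_Mapping.lookup m i \<le> e" if j: "j \<in> J" and m: "m \<in> Poly_Mapping.keys (q j)" for j m i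
  proof (cases "i \<in> Poly_Mapping.keys m")
    case True
    have "Poly_Mapping.lookup m i \<le> (\<Sum>i\<in>Poly_Mapping.keys m. Poly_Mapping.lookup m i)"
      by (rule member_le_sum[OF True]) auto
    also have "\<dots> \<le> (\<Sum>m\<in>Poly_Mapping.keys (q j). \<Sum>i\<in>Poly_Mapping.keys m. Poly_Mapping.lookup m i)"
      by (rule member_le_sum[OF m]) auto
    also have "\<dots> \<le> e" unfolding e_def by (rule member_le_sum[OF j _ assms(1)]) auto
    finally show ?thesis .
  qed (simp add: in_keys_iff)
  then show ?thesis using assms(2) unfolding bounded_polys_def polys_in_def by (intro exI[of _ e]) blast
qed

text \<open>
There are \<open>(D + 1) ^ card J\<close> monomials in the \<open>q j\<close> with exponents at most \<open>D\<close>. Their expansions involve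
at most \<open>(card J * D * e + 1) ^ card I\<close> monomials, if \<open>e\<close> bounds the exponents in the \<open>q j\<close>. For large
\<open>D\<close> this is smaller, so there is a linear relation between the monomials in the \<open>q j\<close>, and its
coefficients are those of \<open>P\<close>.
\<close>
lemma polynomial_image_in_hypersurface:
  fixes q :: "'j \<Rightarrow> ('i, 'k::field_char_0) mpoly"
  assumes I: "finite I" and J: "finite J" "card I < card J" and q: "\<And>j. j \<in> J \<Longrightarrow> q j \<in> polys_in I"
  obtains P :: "('j, 'k) mpoly" where "P \<noteq> 0" "P \<in> polys_in J" "\<And>x. peval (\<lambda>j. peval x (q j)) P = 0"
proof -
  obtain e where e: "\<And>j. j \<in> J \<Longrightarrow> q j \<in> bounded_polys I e" using polys_in_bounded[OF J(1), of q I] q by blast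
  \<comment> \<open>\<open>C * (D + 1)\<close> bounds the number of exponents \<open>0, \<dots>, card J * D * e\<close>, and \<open>C ^ card I < D + 1\<close>.\<close>
  define C where "C = card J * e + 1"
  define D where "D = C ^ card I"
  define e' where "e' = card J * (D * e)"
  define U where "U = (\<Pi>\<^sub>E j\<in>J. {..D})"
  define E where "E = {m :: 'i \<Rightarrow>\<^sub>0 nat. Poly_Mapping.keys m \<subseteq> I \<and> (\<forall>i. Poly_Mapping.lookup m i \<le> e')}"
  have fU: "finite U" unfolding U_def using J(1) by (intro finite_PiE) auto
  have cU: "card U = (D + 1) ^ card J" unfolding U_def using J(1) by (simp add: card_PiE)
  have inj: "inj_on (\<lambda>m. restrict (Poly_Mapping.lookup m) I) E"
  proof (rule inj_onI, rule poly_mapping_eqI)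
    fix m m' :: "'i \<Rightarrow>\<^sub>0 nat" and i
    assume m: "m \<in> E" "m' \<in> E" "restrict (Poly_Mapping.lookup m) I = restrict (Poly_Mapping.lookup m') I"
    show "Poly_Mapping.lookup m i = Poly_Mapping.lookup m' i"
    proof (cases "i \<in> I")
      case True then show ?thesis using fun_cong[OF m(3), of i] by simp
    next
      case False
      then have "i \<notin> Poly_Mapping.keys m" "i \<notin> Poly_Mapping.keys m'" using m unfolding E_def by auto
      then show ?thesis by (simp add: in_keys_iff)
    qed
  qed
  have sub: "(\<lambda>m. restrict (Poly_Mapping.lookup m) I) ` E \<subseteq> (\<Pi>\<^sub>E i\<in>I. {..e'})"
    unfolding E_def by auto
  have fP: "finite (\<Pi>\<^sub>E i\<in>I. {..e'})" using I by (intro finite_PiE) auto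
  have fE: "finite E" using finite_imageD[OF finite_subset[OF sub fP] inj] .
  have "card E \<le> card (\<Pi>\<^sub>E i\<in>I. {..e'})" by (rule card_inj_on_le[OF inj sub fP])
  also have "\<dots> = (e' + 1) ^ card I" using I by (simp add: card_PiE)
  also have "\<dots> \<le> (C * (D + 1)) ^ card I"
    unfolding e'_def C_def by (intro power_mono) (auto simp: algebra_simps)
  also have "\<dots> = D * (D + 1) ^ card I" unfolding D_def by (simp only: power_mult_distrib)
  also have "\<dots> < (D + 1) ^ Suc (card I)" by simp
  also have "\<dots> \<le> (D + 1) ^ card J" using J(2) by (intro power_increasing) auto
  finally have card: "card E < card U" unfolding cU .
  define \<psi> where "\<psi> \<mu> = (\<Prod>j\<in>J. q j ^ \<mu> j)" for \<mu> :: "'j \<Rightarrow> nat"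
  have \<psi>: "Poly_Mapping.keys (\<psi> \<mu>) \<subseteq> E" if "\<mu> \<in> U" for \<mu>
  proof -
    have "q j ^ \<mu> j \<in> bounded_polys I (D * e)" if j: "j \<in> J" for j
    proof -
      have "\<mu> j \<le> D" using \<open>\<mu> \<in> U\<close> j unfolding U_def by auto
      then have "\<mu> j * e \<le> D * e" by simp
      then show ?thesis using bounded_polys_power[OF e[OF j]] bounded_polys_mono by blast
    qed
    then have "\<psi> \<mu> \<in> bounded_polys I e'" unfolding \<psi>_def e'_def by (intro bounded_polys_prod J(1))
    then show ?thesis unfolding bounded_polys_def E_def by blast
  qed
  obtain c where c: "\<exists>u\<in>U. c u \<noteq> 0" "\<forall>m\<in>E. (\<Sum>\<mu>\<in>U. c \<mu> * Poly_Mapping.lookup (\<psi> \<mu>) m) = 0"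
    using homogeneous_system[OF fE fU card, of "\<lambda>m \<mu>. Poly_Mapping.lookup (\<psi> \<mu>) m"] by blast
  define Mn :: "('j \<Rightarrow> nat) \<Rightarrow> 'j \<Rightarrow>\<^sub>0 nat" where "Mn \<mu> = (\<Sum>j\<in>J. Poly_Mapping.single j (\<mu> j))" for \<mu>
  have lMn: "Poly_Mapping.lookup (Mn \<mu>) j = (if j \<in> J then \<mu> j else 0)" for \<mu> j
  proof -
    have "Poly_Mapping.lookup (Mn \<mu>) j = (\<Sum>i\<in>J. if i = j then \<mu> i else 0)"
      unfolding Mn_def lookup_sum lookup_single when_def ..
    then show ?thesis using J(1) by simp
  qed
  have kMn: "Poly_Mapping.keys (Mn \<mu>) \<subseteq> J" for \<mu> by (auto simp: in_keys_iff lMn split: if_splits)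
  have injM: "inj_on Mn U"
  proof (rule inj_onI, rule PiE_ext)
    fix \<mu> \<nu> assume "\<mu> \<in> U" "\<nu> \<in> U" "Mn \<mu> = Mn \<nu>"
    then show "\<mu> \<in> (\<Pi>\<^sub>E j\<in>J. {..D})" "\<nu> \<in> (\<Pi>\<^sub>E j\<in>J. {..D})" unfolding U_def by auto
    show "\<mu> j = \<nu> j" if "j \<in> J" for j using arg_cong[OF \<open>Mn \<mu> = Mn \<nu>\<close>, of "\<lambda>m. Poly_Mapping.lookup m j"] that by (simp add: lMn)
  qed
  define P where "P = (\<Sum>\<mu>\<in>U. Poly_Mapping.single (Mn \<mu>) (c \<mu>))"
  have lP: "Poly_Mapping.lookup P m = (\<Sum>\<mu>\<in>U. if Mn \<mu> = m then c \<mu> else 0)" for m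
    unfolding P_def lookup_sum lookup_single when_def ..
  have "Poly_Mapping.lookup P (Mn u) = c u" if "u \<in> U" for u
  proof -
    have "Poly_Mapping.lookup P (Mn u) = (\<Sum>\<mu>\<in>U. if \<mu> = u then c \<mu> else 0)"
      unfolding lP using injM that by (intro sum.cong) (auto simp: inj_on_def)
    then show ?thesis using fU that by simp
  qed
  then have "P \<noteq> 0" using c(1) by (metis lookup_zero)
  moreover have "P \<in> polys_in J" unfolding polys_in_def
  proof (intro CollectI ballI)
    fix m assume "m \<in> Poly_Mapping.keys P"
    then have "(\<Sum>\<mu>\<in>U. if Mn \<mu> = m then c \<mu> else 0) \<noteq> 0" by (simp add: in_keys_iff lP)
    moreover have "(\<Sum>\<mu>\<in>U. if Mn \<mu> = m then c \<mu> else 0) = 0" if "\<nexists>\<mu>. Mn \<mu> = m"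
      by (rule sum.neutral) (use that in auto)
    ultimately have "\<exists>\<mu>. Mn \<mu> = m" by blast
    then show "Poly_Mapping.keys m \<subseteq> J" using kMn by blast
  qed
  moreover have "peval (\<lambda>j. peval x (q j)) P = 0" for x
  proof -
    have mv: "monomial_value y (Mn \<mu>) = (\<Prod>j\<in>J. y j ^ \<mu> j)" for y :: "'j \<Rightarrow> 'k" and \<mu>
      unfolding monomial_value_superset[OF J(1) kMn] by (intro prod.cong) (auto simp: lMn)
    have "peval (\<lambda>j. peval x (q j)) P = (\<Sum>\<mu>\<in>U. c \<mu> * peval x (\<psi> \<mu>))"
      unfolding P_def \<psi>_def by (simp add: peval_sum mv peval_prod peval_power)
    also have "\<dots> = (\<Sum>\<mu>\<in>U. c \<mu> * (\<Sum>m\<in>E. Poly_Mapping.lookup (\<psi> \<mu>) m * monomial_value x m))"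
      by (intro sum.cong refl arg_cong2[where f = "(*)"] peval_superset fE \<psi>)
    also have "\<dots> = (\<Sum>m\<in>E. (\<Sum>\<mu>\<in>U. c \<mu> * Poly_Mapping.lookup (\<psi> \<mu>) m) * monomial_value x m)"
      unfolding sum_distrib_left sum_distrib_right by (subst sum.swap) (simp add: mult_ac)
    also have "\<dots> = 0" using c(2) by simp
    finally show ?thesis .
  qed
  ultimately show ?thesis by (rule that)
qed

lemma polys_in_simps:
  fixes p q :: "('i, 'k::comm_ring_1) mpoly"
  shows "p \<in> polys_in I \<Longrightarrow> q \<in> polys_in I \<Longrightarrow> p + q \<in> polys_in I"
    and polys_in_mult: "p \<in> polys_in I \<Longrightarrow> q \<in> polys_in I \<Longrightarrow> p * q \<in> polys_in I"
    and "p \<in> polys_in I \<Longrightarrow> - p \<in> polys_in I"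
    and "Poly_Mapping.keys m \<subseteq> I \<Longrightarrow> Poly_Mapping.single m a \<in> polys_in I"
    and "(0 :: ('i, 'k) mpoly) \<in> polys_in I" and polys_in_one: "(1 :: ('i, 'k) mpoly) \<in> polys_in I"
proof -
  show "p \<in> polys_in I \<Longrightarrow> q \<in> polys_in I \<Longrightarrow> p + q \<in> polys_in I"
    using keys_add[of p q] unfolding polys_in_def by blast
  show "p * q \<in> polys_in I" if pq: "p \<in> polys_in I" "q \<in> polys_in I"
    unfolding polys_in_def
  proof (intro CollectI ballI)
    fix m assume "m \<in> Poly_Mapping.keys (p * q)"
    then obtain k l where m: "m = k + l" "k \<in> Poly_Mapping.keys p" "l \<in> Poly_Mapping.keys q"
      using keys_mult by blast
    then show "Poly_Mapping.keys m \<subseteq> I" using pq keys_add[of k l] unfolding polys_in_def by blast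
  qed
  show "p \<in> polys_in I \<Longrightarrow> - p \<in> polys_in I" unfolding polys_in_def by simp
  show "Poly_Mapping.keys m \<subseteq> I \<Longrightarrow> Poly_Mapping.single m a \<in> polys_in I" unfolding polys_in_def by simp
  show "(0 :: ('i, 'k) mpoly) \<in> polys_in I" "(1 :: ('i, 'k) mpoly) \<in> polys_in I" unfolding polys_in_def by simp_all
qed

lemma polys_in_sum:
  fixes f :: "'a \<Rightarrow> ('i, 'k::comm_ring_1) mpoly"
  shows "(\<And>a. a \<in> A \<Longrightarrow> f a \<in> polys_in I) \<Longrightarrow> (\<Sum>a\<in>A. f a) \<in> polys_in I"
  by (induction A rule: infinite_finite_induct) (auto intro: polys_in_simps)

text \<open>
The variables \<open>Inl m\<close> stand for coefficients, the variables \<open>Inr i\<close> for the coordinates of a point. The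
\<open>card A + 1\<close> equations can be solved for the coefficients at the pivots \<open>p0\<close> and \<open>p k\<close>, as polynomials
in the other coefficients and the point. As the point has \<open>card A\<close> coordinates, the solutions
depend on \<open>card J - 1\<close> parameters.
\<close>
lemma pivot_elimination:
  fixes v :: "'m \<Rightarrow> ('m + 'z, 'k::field_char_0) mpoly" and w :: "'z \<Rightarrow> 'm \<Rightarrow> ('m + 'z, 'k) mpoly"
  assumes J: "finite J" and A: "finite A"
    and v: "\<And>m. m \<in> J \<Longrightarrow> v m \<in> polys_in (Inr ` A)"
    and w: "\<And>j m. j \<in> A \<Longrightarrow> m \<in> J \<Longrightarrow> w j m \<in> polys_in (Inr ` A)"
    and p: "p0 \<in> J" "p ` A \<subseteq> J" "inj_on p A" "p0 \<notin> p ` A"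
    and piv: "v p0 = 1" "\<And>j. j \<in> A \<Longrightarrow> w j p0 = 0"
      "\<And>j k. j \<in> A \<Longrightarrow> k \<in> A \<Longrightarrow> w j (p k) = (if j = k then 1 else 0)"
  obtains P :: "('m, 'k) mpoly" where "P \<noteq> 0" "P \<in> polys_in J"
    "\<And>c z. (\<Sum>m\<in>J. c m * peval (case_sum c z) (v m)) = 0 \<Longrightarrow>
       (\<And>j. j \<in> A \<Longrightarrow> (\<Sum>m\<in>J. c m * peval (case_sum c z) (w j m)) = 0) \<Longrightarrow> peval c P = 0"
proof -
  define R where "R = J - insert p0 (p ` A)"
  define I :: "('m + 'z) set" where "I = Inl ` R \<union> Inr ` A"
  define X :: "'m \<Rightarrow> ('m + 'z, 'k) mpoly" where "X m = Poly_Mapping.single (Poly_Mapping.single (Inl m) 1) 1" for m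
  define Q where "Q k = - (\<Sum>m\<in>R. X m * w k m)" for k
  define q where "q m = (if m \<in> R then X m else if m = p0 then - (\<Sum>m\<in>R. X m * v m) + - (\<Sum>k\<in>A. Q k * v (p k))
     else Q (inv_into A p m))" for m
  have pX: "peval x (X m) = x (Inl m)" for x m unfolding X_def by simp
  have RJ: "R \<subseteq> J" "finite R" unfolding R_def using J by auto
  have Jeq: "J = R \<union> insert p0 (p ` A)" "R \<inter> insert p0 (p ` A) = {}" unfolding R_def using p by auto
  have sumJ: "(\<Sum>m\<in>J. F m) = (\<Sum>m\<in>R. F m) + F p0 + (\<Sum>k\<in>A. F (p k))" for F :: "'m \<Rightarrow> 'k"
  proof -
    have "(\<Sum>m\<in>J. F m) = (\<Sum>m\<in>R. F m) + (\<Sum>m\<in>insert p0 (p ` A). F m)"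
      unfolding Jeq(1) using RJ A Jeq(2) by (intro sum.union_disjoint) auto
    also have "(\<Sum>m\<in>insert p0 (p ` A). F m) = F p0 + (\<Sum>k\<in>A. F (p k))"
      using A p(3,4) by (simp add: sum.reindex)
    finally show ?thesis by (simp add: add.assoc)
  qed
  have fI: "finite I" unfolding I_def using RJ A by simp
  have "card I = card R + card A"
    unfolding I_def using RJ A by (subst card_Un_disjoint) (auto simp: card_image inj_on_def)
  moreover have "card J = card R + (card A + 1)"
    using Jeq RJ A p(3,4) by (metis card_Un_disjoint card_image card_insert_disjoint finite_imageI finite_insert Suc_eq_plus1)
  ultimately have card: "card I < card J" by simp
  have inI: "a \<in> polys_in (Inr ` A) \<Longrightarrow> a \<in> polys_in I" for a :: "('m + 'z, 'k) mpoly"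
    unfolding polys_in_def I_def by blast
  have XI: "X m \<in> polys_in I" if "m \<in> R" for m
    unfolding X_def using that by (intro polys_in_simps) (auto simp: I_def)
  have QI: "Q k \<in> polys_in I" if "k \<in> A" for k
    unfolding Q_def by (intro polys_in_simps polys_in_sum XI inI w that) (use RJ in auto)
  have qI: "q m \<in> polys_in I" if "m \<in> J" for m
  proof -
    have m: "m \<in> R \<or> m = p0 \<or> m \<in> p ` A" using that unfolding Jeq(1) by blast
    consider "m \<in> R" | "m \<notin> R" "m = p0" | "m \<notin> R" "m \<noteq> p0" "m \<in> p ` A"  using m by blast
    then show ?thesis
    proof cases
      case 1 then show ?thesis unfolding q_def using XI by simp
    next
      case 2
      have "- (\<Sum>m\<in>R. X m * v m) + - (\<Sum>k\<in>A. Q k * v (p k)) \<in> polys_in I"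
        by (intro polys_in_simps polys_in_sum XI QI inI v) (use RJ p in auto)
      then show ?thesis unfolding q_def using 2 by simp
    next
      case 3
      then show ?thesis unfolding q_def using QI[OF inv_into_into[OF 3(3)]] by simp
    qed
  qed
  obtain P :: "('m, 'k) mpoly" where P: "P \<noteq> 0" "P \<in> polys_in J" "\<forall>x. peval (\<lambda>j. peval x (q j)) P = 0"
  proof (rule polynomial_image_in_hypersurface[OF fI J card qI])
    fix P :: "('m, 'k) mpoly"
    assume "P \<noteq> 0" "P \<in> polys_in J" "\<And>x. peval (\<lambda>j. peval x (q j)) P = 0"
    then show thesis by (intro that) auto
  qed
  show ?thesis
  proof (rule that[OF P(1,2)])
    fix c :: "'m \<Rightarrow> 'k" and z :: "'z \<Rightarrow> 'k"
    let ?x = "case_sum c z"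
    assume 0: "(\<Sum>m\<in>J. c m * peval ?x (v m)) = 0" and 1: "\<And>j. j \<in> A \<Longrightarrow> (\<Sum>m\<in>J. c m * peval ?x (w j m)) = 0"
    have Qk: "peval ?x (Q k) = c (p k)" if k: "k \<in> A" for k
    proof -
      have "(\<Sum>l\<in>A. c (p l) * peval ?x (w k (p l))) = (\<Sum>l\<in>A. if l = k then c (p k) else 0)"
        using k piv(3) by (intro sum.cong) auto
      then have "(\<Sum>m\<in>J. c m * peval ?x (w k m)) = (\<Sum>m\<in>R. c m * peval ?x (w k m)) + c (p k)"
        unfolding sumJ using A k piv(2) by simp
      then have "c (p k) = - (\<Sum>m\<in>R. c m * peval ?x (w k m))" using 1[OF k] by (simp add: eq_neg_iff_add_eq_0 add.commute)
      then show ?thesis unfolding Q_def by (simp add: peval_uminus peval_sum peval_mult pX)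
    qed
    have "peval ?x (q m) = c m" if "m \<in> J" for m
    proof -
      have m: "m \<in> R \<or> m = p0 \<or> m \<in> p ` A" using that unfolding Jeq(1) by blast
    consider "m \<in> R" | "m \<notin> R" "m = p0" | "m \<notin> R" "m \<noteq> p0" "m \<in> p ` A"  using m by blast
      then show ?thesis
      proof cases
        case 1 then show ?thesis unfolding q_def by (simp add: pX)
      next
        case 2
        have "(\<Sum>m\<in>R. c m * peval ?x (v m)) + c p0 + (\<Sum>k\<in>A. c (p k) * peval ?x (v (p k))) = 0"
          using 0 unfolding sumJ piv(1) by simp
        then have "c p0 = - (\<Sum>m\<in>R. c m * peval ?x (v m)) + - (\<Sum>k\<in>A. c (p k) * peval ?x (v (p k)))"
          by (simp add: algebra_simps eq_neg_iff_add_eq_0)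
        then show ?thesis unfolding q_def using 2
          by (simp add: peval_uminus peval_diff peval_sum peval_mult pX Qk)
      next
        case 3
        then show ?thesis unfolding q_def using Qk[OF inv_into_into[OF 3(3)]] f_inv_into_f[OF 3(3)] by simp
      qed
    qed
    then have qc: "c i = peval ?x (q i)" if "i \<in> J" for i using that by simp
    have "peval c P = peval (\<lambda>j. peval ?x (q j)) P"
      by (rule peval_cong, rule qc) (use P(2) in \<open>auto simp: polys_in_def\<close>)
    then show "peval c P = 0" using P(3) by simp
  qed
qed

section \<open>Degenerate polynomials\<close>

text \<open>
The monomial \<open>m\<close> in the coordinates of the point, with those outside \<open>A\<close> set to \<open>1\<close>.
\<close>
definition point_monomial :: "'n set \<Rightarrow> ('n::finite \<Rightarrow>\<^sub>0 nat) \<Rightarrow> ('m + 'n \<Rightarrow>\<^sub>0 nat)" where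
  "point_monomial A m = (\<Sum>i\<in>A. Poly_Mapping.single (Inr i) (Poly_Mapping.lookup m i))"

lemma lookup_point_monomial:
  "Poly_Mapping.lookup (point_monomial A m) y = (case y of Inl _ \<Rightarrow> 0 | Inr i \<Rightarrow> if i \<in> A then Poly_Mapping.lookup m i else 0)"
proof -
  have "Poly_Mapping.lookup (point_monomial A m) y = (\<Sum>i\<in>A. if Inr i = y then Poly_Mapping.lookup m i else 0)"
    unfolding point_monomial_def lookup_sum lookup_single when_def ..
  then show ?thesis by (cases y) auto
qed

lemma keys_point_monomial: "Poly_Mapping.keys (point_monomial A m) \<subseteq> Inr ` A"
proof
  fix y assume "y \<in> Poly_Mapping.keys (point_monomial A m)"
  then show "y \<in> Inr ` A" by (cases y) (auto simp: in_keys_iff lookup_point_monomial split: if_splits)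
qed

lemma monomial_value_point_monomial:
  fixes z :: "'k::field ^ 'n::finite" and m :: "'n \<Rightarrow>\<^sub>0 nat"
  assumes "\<And>i. i \<notin> A \<Longrightarrow> z $ i = 1"
  shows "monomial_value (case_sum c (($) z)) (point_monomial A m) = monomial_value (($) z) m"
proof -
  have "monomial_value (case_sum c (($) z)) (point_monomial A m) = (\<Prod>y\<in>Inr ` A. case_sum c (($) z) y ^ Poly_Mapping.lookup (point_monomial A m) y)"
    by (rule monomial_value_superset[OF _ keys_point_monomial]) simp
  also have "\<dots> = (\<Prod>i\<in>A. z $ i ^ Poly_Mapping.lookup m i)"
    by (subst prod.reindex) (auto simp: lookup_point_monomial inj_on_def)
  also have "\<dots> = (\<Prod>i\<in>UNIV. z $ i ^ Poly_Mapping.lookup m i)"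
    by (rule prod.mono_neutral_left) (use assms in auto)
  finally show ?thesis unfolding monomial_value_UNIV .
qed

lemma point_monomial_0: "(\<And>i. i \<in> A \<Longrightarrow> Poly_Mapping.lookup m i = 0) \<Longrightarrow> point_monomial A m = 0"
  unfolding point_monomial_def by (rule sum.neutral) simp

lemma singular_at_point_in_hypersurface:
  fixes J :: "('n::finite \<Rightarrow>\<^sub>0 nat) set"
  assumes J: "finite J" and p: "p0 \<in> J" "p ` A \<subseteq> J" "inj_on p A" "p0 \<notin> p ` A"
    and p0: "\<And>j. j \<in> A \<Longrightarrow> Poly_Mapping.lookup p0 j = 0"
    and pk: "\<And>j k. j \<in> A \<Longrightarrow> k \<in> A \<Longrightarrow> Poly_Mapping.lookup (p k) j = (if j = k then 1 else 0)"
  obtains P :: "('n \<Rightarrow>\<^sub>0 nat, 'k::field_char_0) mpoly" where "P \<noteq> 0" "P \<in> polys_in J"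
    "\<And>c z. (\<And>i. i \<notin> A \<Longrightarrow> z $ i = 1) \<Longrightarrow> (\<Sum>m\<in>J. c m * monomial_value (($) z) m) = 0 \<Longrightarrow>
       (\<And>j. j \<in> A \<Longrightarrow> (\<Sum>m\<in>J. c m * (of_nat (Poly_Mapping.lookup m j) * monomial_value (($) z) (m - Poly_Mapping.single j 1))) = 0)
       \<Longrightarrow> peval c P = 0"
proof -
  define v :: "('n \<Rightarrow>\<^sub>0 nat) \<Rightarrow> (('n \<Rightarrow>\<^sub>0 nat) + 'n, 'k) mpoly" where
    "v m = Poly_Mapping.single (point_monomial A m) 1" for m
  define w :: "'n \<Rightarrow> ('n \<Rightarrow>\<^sub>0 nat) \<Rightarrow> (('n \<Rightarrow>\<^sub>0 nat) + 'n, 'k) mpoly" where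
    "w j m = Poly_Mapping.single (point_monomial A (m - Poly_Mapping.single j 1)) (of_nat (Poly_Mapping.lookup m j))" for j m
  show ?thesis
  proof (rule pivot_elimination[OF J, of A v w p0 p])
    show "finite A" by simp
    show "v m \<in> polys_in (Inr ` A)" for m unfolding v_def by (intro polys_in_simps keys_point_monomial)
    show "w j m \<in> polys_in (Inr ` A)" for j m unfolding w_def by (intro polys_in_simps keys_point_monomial)
    show "p0 \<in> J" "p ` A \<subseteq> J" "inj_on p A" "p0 \<notin> p ` A" by fact+
    show "v p0 = 1" unfolding v_def by (simp add: point_monomial_0 p0)
    show "w j p0 = 0" if "j \<in> A" for j unfolding w_def using p0[OF that] by simp
    show "w j (p k) = (if j = k then 1 else 0)" if jk: "j \<in> A" "k \<in> A" for j k
    proof (cases "j = k")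
      case True
      have "point_monomial A (p k - Poly_Mapping.single k 1) = (0 :: ('n \<Rightarrow>\<^sub>0 nat) + 'n \<Rightarrow>\<^sub>0 nat)"
        by (rule point_monomial_0) (use pk jk in \<open>auto simp: lookup_minus lookup_single when_def\<close>)
      then show ?thesis unfolding w_def using True pk[OF jk] by simp
    next
      case False
      then show ?thesis unfolding w_def using pk[OF jk] by simp
    qed
    fix P :: "('n \<Rightarrow>\<^sub>0 nat, 'k) mpoly"
    assume P: "P \<noteq> 0" "P \<in> polys_in J" and Pz: "\<And>c z. (\<Sum>m\<in>J. c m * peval (case_sum c z) (v m)) = 0 \<Longrightarrow>
       (\<And>j. j \<in> A \<Longrightarrow> (\<Sum>m\<in>J. c m * peval (case_sum c z) (w j m)) = 0) \<Longrightarrow> peval c P = 0"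
    show thesis
    proof (rule that[OF P])
      fix c and z :: "'k ^ 'n"
      assume z: "\<And>i. i \<notin> A \<Longrightarrow> z $ i = 1" and a: "(\<Sum>m\<in>J. c m * monomial_value (($) z) m) = 0"
       "\<And>j. j \<in> A \<Longrightarrow> (\<Sum>m\<in>J. c m * (of_nat (Poly_Mapping.lookup m j) * monomial_value (($) z) (m - Poly_Mapping.single j 1))) = 0"
      have mv: "monomial_value (case_sum c (($) z)) (point_monomial A m) = monomial_value (($) z) m" for m
        by (rule monomial_value_point_monomial) (rule z)
      show "peval c P = 0"
        by (rule Pz[of c "($) z"]) (use a in \<open>simp_all add: v_def w_def mv\<close>)
    qed
  qed
qed

text \<open>
The equation \<open>f z = 0\<close> determines the constant coefficient, and the vanishing of the \<open>k\<close>-th derivative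
determines the coefficient of the \<open>k\<close>-th variable.
\<close>
lemma affine_singularity_hypersurface:
  assumes d: "d \<ge> 1"
  obtains P :: "('n::finite \<Rightarrow>\<^sub>0 nat, 'k::field_char_0) mpoly" where "P \<noteq> 0" "P \<in> polys_in (monomials_le d)"
    "\<And>c z. homog d c 1 z = 0 \<Longrightarrow> (\<And>j. homog_deriv d c j 1 z = 0) \<Longrightarrow> peval c P = 0"
proof (rule singular_at_point_in_hypersurface[OF finite_monomials_le[of d], of 0 "\<lambda>k. Poly_Mapping.single k 1" UNIV])
  show "0 \<in> monomials_le d" "range (\<lambda>k. Poly_Mapping.single k 1) \<subseteq> (monomials_le d :: ('n \<Rightarrow>\<^sub>0 nat) set)"
    using d unfolding monomials_le_def by auto
  show "inj (\<lambda>k::'n. Poly_Mapping.single k (1::nat))"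
    by (rule injI) (metis lookup_single_eq lookup_single_not_eq zero_neq_one)
  show "0 \<notin> range (\<lambda>k::'n. Poly_Mapping.single k (1::nat))"
    by (metis (no_types, lifting) imageE lookup_single_eq lookup_zero zero_neq_one)
  show "Poly_Mapping.lookup (Poly_Mapping.single k (1::nat)) j = (if j = k then 1 else 0)" for j k :: 'n
    by (simp add: lookup_single when_def)
  show "Poly_Mapping.lookup 0 j = 0" for j :: 'n by simp
  fix P :: "('n \<Rightarrow>\<^sub>0 nat, 'k) mpoly"
  assume P: "P \<noteq> 0" "P \<in> polys_in (monomials_le d)" and Pz: "\<And>c z. (\<And>i. i \<notin> UNIV \<Longrightarrow> z $ i = 1) \<Longrightarrow> (\<Sum>m\<in>monomials_le d. c m * monomial_value (($) z) m) = 0 \<Longrightarrow>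
       (\<And>j. j \<in> UNIV \<Longrightarrow> (\<Sum>m\<in>monomials_le d. c m * (of_nat (Poly_Mapping.lookup m j) * monomial_value (($) z) (m - Poly_Mapping.single j 1))) = 0)
       \<Longrightarrow> peval c P = 0"
  show thesis
  proof (rule that[OF P])
    fix c and z :: "'k ^ 'n" assume "homog d c 1 z = 0" "\<And>j. homog_deriv d c j 1 z = 0"
    then show "peval c P = 0" by (intro Pz[of z c]) (auto simp: homog_def homog_deriv_def)
  qed
qed

text \<open>
On the form of degree \<open>d\<close> the pivots are \<open>x\<^sub>i ^ d\<close> and \<open>x\<^sub>i ^ (d - 1) * x\<^sub>k\<close> for \<open>k \<noteq> i\<close>. Setting \<open>z $ i = 1\<close>
removes one coordinate of the point. The equations are the vanishing of the form and of its derivatives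
in the directions \<open>k \<noteq> i\<close>, which by Euler's relation imply the vanishing of the \<open>i\<close>-th one.
\<close>
lemma infinite_singularity_hypersurface:
  fixes i :: "'n::finite"
  assumes d: "d \<ge> 1"
  obtains P :: "('n::finite \<Rightarrow>\<^sub>0 nat, 'k::field_char_0) mpoly" where "P \<noteq> 0" "P \<in> polys_in (monomials_le d)"
    "\<And>c z. z $ i = 1 \<Longrightarrow> homog d c 0 z = 0 \<Longrightarrow> (\<And>j. homog_deriv d c j 0 z = 0) \<Longrightarrow> peval c P = 0"
proof -
  define J :: "('n \<Rightarrow>\<^sub>0 nat) set" where "J = {m. monomial_degree m = d}"
  have Jm: "J \<subseteq> monomials_le d" unfolding J_def monomials_le_def by auto
  have fJ: "finite J" using finite_subset[OF Jm finite_monomials_le] .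
  have Jsum: "(\<Sum>m\<in>monomials_le d. c m * 0 ^ (d - monomial_degree m) * F m) = (\<Sum>m\<in>J. c m * F m)" for c F :: "('n \<Rightarrow>\<^sub>0 nat) \<Rightarrow> 'k"
  proof -
    have "(\<Sum>m\<in>J. c m * F m) = (\<Sum>m\<in>J. c m * 0 ^ (d - monomial_degree m) * F m)"
      unfolding J_def by (intro sum.cong) auto
    also have "\<dots> = (\<Sum>m\<in>monomials_le d. c m * 0 ^ (d - monomial_degree m) * F m)"
      by (rule sum.mono_neutral_left[OF finite_monomials_le Jm]) (auto simp: J_def monomials_le_def power_0_left)
    finally show ?thesis ..
  qed
  define A where "A = UNIV - {i}"
  define p where "p k = Poly_Mapping.single i (d - 1) + Poly_Mapping.single k 1" for k :: 'n
  have lp: "Poly_Mapping.lookup (p k) j = (if j = k then 1 else 0)" if "j \<in> A" for j k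
    using that unfolding p_def A_def by (simp add: lookup_add lookup_single when_def)
  show ?thesis
  proof (rule singular_at_point_in_hypersurface[OF fJ, of "Poly_Mapping.single i d" p A])
    show "Poly_Mapping.single i d \<in> J" "p ` A \<subseteq> J"
      using d unfolding J_def p_def by (auto simp: monomial_degree_add)
    show "inj_on p A" using lp by (metis inj_onI zero_neq_one)
    have "Poly_Mapping.single i d \<noteq> p k" if "k \<in> A" for k
    proof
      assume "Poly_Mapping.single i d = p k"
      from arg_cong[OF this, of "\<lambda>m. Poly_Mapping.lookup m k"] show False
        using lp[OF that, of k] that unfolding A_def by (simp add: lookup_single when_def)
    qed
    then show "Poly_Mapping.single i d \<notin> p ` A" by blast
    show "Poly_Mapping.lookup (Poly_Mapping.single i d) j = 0" if "j \<in> A" for j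
      using that unfolding A_def by (simp add: lookup_single when_def)
    show "Poly_Mapping.lookup (p k) j = (if j = k then 1 else 0)" if "j \<in> A" for j k by (rule lp[OF that])
    fix P :: "('n \<Rightarrow>\<^sub>0 nat, 'k) mpoly"
    assume P: "P \<noteq> 0" "P \<in> polys_in J" and Pz: "\<And>c z. (\<And>i. i \<notin> A \<Longrightarrow> z $ i = 1) \<Longrightarrow> (\<Sum>m\<in>J. c m * monomial_value (($) z) m) = 0 \<Longrightarrow>
         (\<And>j. j \<in> A \<Longrightarrow> (\<Sum>m\<in>J. c m * (of_nat (Poly_Mapping.lookup m j) * monomial_value (($) z) (m - Poly_Mapping.single j 1))) = 0)
         \<Longrightarrow> peval c P = 0"
    show thesis
    proof (rule that[OF P(1)])
      show "P \<in> polys_in (monomials_le d)" using P(2) Jm unfolding polys_in_def by blast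
      fix c and z :: "'k ^ 'n" assume z: "z $ i = 1" and "homog d c 0 z = 0" "\<And>j. homog_deriv d c j 0 z = 0"
      then show "peval c P = 0" unfolding homog_def homog_deriv_def Jsum by (intro Pz[of z c]) (auto simp: A_def)
    qed
  qed
qed

lemma polys_in_prod:
  fixes f :: "'a \<Rightarrow> ('i, 'k::comm_ring_1) mpoly"
  shows "(\<And>a. a \<in> A \<Longrightarrow> f a \<in> polys_in I) \<Longrightarrow> (\<Prod>a\<in>A. f a) \<in> polys_in I"
  by (induction A rule: infinite_finite_induct) (auto intro: polys_in_mult polys_in_one)

lemma mpoly_prod_nonzero:
  fixes f :: "'a \<Rightarrow> ('i, 'k::field_char_0) mpoly"
  assumes "finite A" "\<And>a. a \<in> A \<Longrightarrow> f a \<noteq> 0"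
  shows "(\<Prod>a\<in>A. f a) \<noteq> 0"
  using assms
proof (induction A rule: finite_induct)
  case (insert a A)
  then have "f a * prod f A \<noteq> 0" by (intro mpoly_mult_nonzero) auto
  then show ?case using insert.hyps by simp
qed simp

text \<open>
By homogeneity a degenerate zero can be scaled so that \<open>\<mu> = 1\<close>, or, if \<open>\<mu> = 0\<close>, so that one of its
coordinates is \<open>1\<close>.
\<close>
lemma generic_nondegenerate:
  assumes d: "d \<ge> 1"
  obtains P :: "('n::finite \<Rightarrow>\<^sub>0 nat, 'k::field_char_0) mpoly" where "P \<noteq> 0" "P \<in> polys_in (monomials_le d)"
    "\<And>c. peval c P \<noteq> 0 \<Longrightarrow> nondegenerate d c"
proof -
  obtain Pa :: "('n \<Rightarrow>\<^sub>0 nat, 'k) mpoly" where Pa: "Pa \<noteq> 0" "Pa \<in> polys_in (monomials_le d)"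
    and Pa0: "\<forall>c z. homog d c 1 z = 0 \<longrightarrow> (\<forall>j. homog_deriv d c j 1 z = 0) \<longrightarrow> peval c Pa = 0"
  proof (rule affine_singularity_hypersurface[OF d])
    fix P :: "('n \<Rightarrow>\<^sub>0 nat, 'k) mpoly"
    assume P: "P \<noteq> 0" "P \<in> polys_in (monomials_le d)"
      "\<And>c z. homog d c 1 z = 0 \<Longrightarrow> (\<And>j. homog_deriv d c j 1 z = 0) \<Longrightarrow> peval c P = 0"
    show thesis by (rule that[OF P(1,2)]) (intro allI impI, rule P(3), auto)
  qed
  have "\<exists>P :: ('n \<Rightarrow>\<^sub>0 nat, 'k) mpoly. P \<noteq> 0 \<and> P \<in> polys_in (monomials_le d) \<and>
    (\<forall>c z. z $ i = 1 \<longrightarrow> homog d c 0 z = 0 \<longrightarrow> (\<forall>j. homog_deriv d c j 0 z = 0) \<longrightarrow> peval c P = 0)" for i :: 'n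
  proof (rule infinite_singularity_hypersurface[OF d, of i])
    fix P :: "('n \<Rightarrow>\<^sub>0 nat, 'k) mpoly"
    assume P: "P \<noteq> 0" "P \<in> polys_in (monomials_le d)"
      "\<And>c z. z $ i = 1 \<Longrightarrow> homog d c 0 z = 0 \<Longrightarrow> (\<And>j. homog_deriv d c j 0 z = 0) \<Longrightarrow> peval c P = 0"
    show ?thesis by (intro exI[of _ P] conjI P(1,2) allI impI) (rule P(3), auto)
  qed
  then obtain Pi :: "'n \<Rightarrow> ('n \<Rightarrow>\<^sub>0 nat, 'k) mpoly" where Pi: "\<And>i. Pi i \<noteq> 0" "\<And>i. Pi i \<in> polys_in (monomials_le d)"
    and Pi0: "\<forall>i c z. z $ i = 1 \<longrightarrow> homog d c 0 z = 0 \<longrightarrow> (\<forall>j. homog_deriv d c j 0 z = 0) \<longrightarrow> peval c (Pi i) = 0" by metis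
  define P where "P = Pa * (\<Prod>i\<in>UNIV. Pi i)"
  show ?thesis
  proof (rule that[of P])
    show "P \<noteq> 0" unfolding P_def using Pa Pi by (intro mpoly_mult_nonzero mpoly_prod_nonzero) auto
    show "P \<in> polys_in (monomials_le d)" unfolding P_def using Pa Pi by (intro polys_in_mult polys_in_prod) auto
    fix c assume "peval c P \<noteq> 0"
    then have a: "peval c Pa \<noteq> 0" and i: "peval c (Pi i) \<noteq> 0" for i
      unfolding P_def by (auto simp: peval_mult peval_prod)
    show "nondegenerate d c" unfolding nondegenerate_def
    proof (intro allI impI, rule ccontr)
      fix \<mu> :: 'k and z :: "'k ^ 'n"
      assume nz: "\<mu> \<noteq> 0 \<or> z \<noteq> 0" and H: "homog d c \<mu> z = 0" and "\<nexists>i. homog_deriv d c i \<mu> z \<noteq> 0"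
      then have dH: "homog_deriv d c j \<mu> z = 0" for j by blast
      show False
      proof (cases "\<mu> = 0")
        case False
        define y where "y = (\<chi> i. z $ i / \<mu>)"
        have zy: "z $ i = \<mu> * y $ i" for i unfolding y_def using False by simp
        have "homog d c 1 y = 0" using homog_scale[OF zy, of d c 1] H False by simp
        moreover have "homog_deriv d c j 1 y = 0" for j using homog_deriv_scale[OF zy, of d c j 1] dH[of j] False by simp
        ultimately show False using Pa0 a by blast
      next
        case True
        then have "z \<noteq> 0" using nz by simp
        then obtain k where k: "z $ k \<noteq> 0" by (auto simp: vec_eq_iff)
        define y where "y = (\<chi> i. z $ i / z $ k)"
        have zy: "z $ i = z $ k * y $ i" for i unfolding y_def using k by simp
        have "homog d c 0 y = 0" using homog_scale[OF zy, of d c 0] H k True by simp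
        moreover have "homog_deriv d c j 0 y = 0" for j using homog_deriv_scale[OF zy, of d c j 0] dH[of j] k True by simp
        moreover have "y $ k = 1" unfolding y_def using k by simp
        ultimately show False using Pi0 i by blast
      qed
    qed
  qed
qed

section \<open>Reducible polynomials\<close>

text \<open>
Multiplication by \<open>x ^ b\<close> and by \<open>y ^ a\<close> embeds the two sets of monomials into the third one. The images
share at most the monomial \<open>x ^ b * y ^ a\<close>, and both of them miss the two monomials \<open>1\<close> and \<open>w\<close>.
\<close>
lemma card_monomials_le_add_less:
  assumes n: "CARD('n::finite) \<ge> 3" and ab: "1 \<le> a" "1 \<le> b"
  shows "card (monomials_le a :: ('n \<Rightarrow>\<^sub>0 nat) set) + card (monomials_le b :: ('n \<Rightarrow>\<^sub>0 nat) set) < card (monomials_le (a + b) :: ('n \<Rightarrow>\<^sub>0 nat) set)"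
proof -
  obtain X :: "'n set" where "card X = 3" using obtain_subset_with_card_n[OF n] by blast
  then obtain x y w :: 'n where xyw: "x \<noteq> y" "x \<noteq> w" "y \<noteq> w" by (auto simp: card_3_iff)
  let ?s = "Poly_Mapping.single :: 'n \<Rightarrow> nat \<Rightarrow> _"
  define F where "F = (\<lambda>m. m + ?s x b) ` monomials_le a"
  define G where "G = (\<lambda>m. m + ?s y a) ` monomials_le b"
  have cF: "card F = card (monomials_le a :: ('n \<Rightarrow>\<^sub>0 nat) set)" unfolding F_def by (rule card_image) (auto simp: inj_on_def)
  have cG: "card G = card (monomials_le b :: ('n \<Rightarrow>\<^sub>0 nat) set)" unfolding G_def by (rule card_image) (auto simp: inj_on_def)
  have fin: "finite F" "finite G" unfolding F_def G_def using finite_monomials_le by auto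
  have FG: "F \<inter> G \<subseteq> {?s y a + ?s x b}"
  proof
    fix m assume "m \<in> F \<inter> G"
    then obtain k l where k: "k \<in> monomials_le a" "m = k + ?s x b" and l: "m = l + ?s y a" unfolding F_def G_def by auto
    have ky: "a \<le> Poly_Mapping.lookup k y"
      using arg_cong[OF trans[OF k(2)[symmetric] l], of "\<lambda>m. Poly_Mapping.lookup m y"] xyw
      by (simp add: lookup_add lookup_single when_def)
    have deg: "Poly_Mapping.lookup k y + (\<Sum>i\<in>UNIV - {y}. Poly_Mapping.lookup k i) \<le> a"
      using k(1) sum.remove[of UNIV y "Poly_Mapping.lookup k"] unfolding monomials_le_def monomial_degree_UNIV by simp
    then have z: "(\<Sum>i\<in>UNIV - {y}. Poly_Mapping.lookup k i) = 0" "Poly_Mapping.lookup k y = a" using ky by linarith+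
    have "k = ?s y a"
    proof (rule poly_mapping_eqI)
      fix i show "Poly_Mapping.lookup k i = Poly_Mapping.lookup (?s y a) i"
        using z by (cases "i = y") (auto simp: lookup_single when_def)
    qed
    then show "m \<in> {?s y a + ?s x b}" using k(2) by simp
  qed
  have "card (F \<inter> G) \<le> 1" using card_mono[OF _ FG] by simp
  moreover have "card (F \<union> G) + card (F \<inter> G) = card F + card G" using card_Un_Int[OF fin] by simp
  moreover have "card (F \<union> G \<union> {0, ?s w 1}) = card (F \<union> G) + 2"
  proof -
    have "0 \<notin> F \<union> G" "?s w 1 \<notin> F \<union> G"
    proof -
      have Fx: "Poly_Mapping.lookup m x \<ge> 1" if "m \<in> F" for m
        using that ab unfolding F_def by (auto simp: lookup_add)
      have Gy: "Poly_Mapping.lookup m y \<ge> 1" if "m \<in> G" for m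
        using that ab unfolding G_def by (auto simp: lookup_add)
      show "0 \<notin> F \<union> G" using Fx[of 0] Gy[of 0] by auto
      show "?s w 1 \<notin> F \<union> G" using Fx[of "?s w 1"] Gy[of "?s w 1"] xyw by (auto simp: lookup_single when_def)
    qed
    moreover have "(0 :: 'n \<Rightarrow>\<^sub>0 nat) \<noteq> ?s w 1" by (metis lookup_single_eq lookup_zero zero_neq_one)
    ultimately have "(F \<union> G) \<inter> {0, ?s w 1} = {}" "card {0, ?s w 1} = 2" by auto
    then show ?thesis using fin by (subst card_Un_disjoint) auto
  qed
  moreover have "card (F \<union> G \<union> {0, ?s w 1}) \<le> card (monomials_le (a + b) :: ('n \<Rightarrow>\<^sub>0 nat) set)"
    by (rule card_mono[OF finite_monomials_le]) (use ab in \<open>auto simp: F_def G_def monomials_le_def monomial_degree_add\<close>)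
  ultimately show ?thesis using cF cG by linarith
qed

lemma mpoly_eq_sum_single:
  assumes "p \<in> polys_le a"
  shows "p = (\<Sum>k\<in>monomials_le a. Poly_Mapping.single k (Poly_Mapping.lookup p k))"
proof (rule poly_mapping_eqI)
  fix m
  have "Poly_Mapping.lookup (\<Sum>k\<in>monomials_le a. Poly_Mapping.single k (Poly_Mapping.lookup p k)) m =
     (\<Sum>k\<in>monomials_le a. if k = m then Poly_Mapping.lookup p m else 0)"
    unfolding lookup_sum lookup_single when_def by (intro sum.cong) auto
  also have "\<dots> = Poly_Mapping.lookup p m"
  proof (cases "m \<in> monomials_le a")
    case False
    then have 0: "Poly_Mapping.lookup p m = 0" using assms unfolding polys_le_iff_keys by (auto simp: in_keys_iff)
    have "(\<Sum>k\<in>monomials_le a. if k = m then Poly_Mapping.lookup p m else 0) = 0"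
      by (rule sum.neutral) (use 0 in auto)
    then show ?thesis using 0 by simp
  qed (simp add: finite_monomials_le)
  finally show "Poly_Mapping.lookup p m = Poly_Mapping.lookup (\<Sum>k\<in>monomials_le a. Poly_Mapping.single k (Poly_Mapping.lookup p k)) m" ..
qed

lemma lookup_mult_monomials_le:
  fixes g h :: "('n::finite, 'k::comm_semiring_1) mpoly"
  assumes "g \<in> polys_le a" "h \<in> polys_le b"
  shows "Poly_Mapping.lookup (g * h) m = (\<Sum>k\<in>monomials_le a. \<Sum>l\<in>monomials_le b.
     if k + l = m then Poly_Mapping.lookup g k * Poly_Mapping.lookup h l else 0)"
proof -
  have "g * h = (\<Sum>k\<in>monomials_le a. \<Sum>l\<in>monomials_le b. Poly_Mapping.single (k + l) (Poly_Mapping.lookup g k * Poly_Mapping.lookup h l))"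
    by (subst mpoly_eq_sum_single[OF assms(1)], subst mpoly_eq_sum_single[OF assms(2)])
       (simp add: sum_product mult_single)
  then show ?thesis by (simp add: lookup_sum lookup_single when_def)
qed

lemma reducible_in_hypersurface:
  assumes n: "CARD('n::finite) \<ge> 3" and ab: "1 \<le> a" "1 \<le> b"
  obtains P :: "('n::finite \<Rightarrow>\<^sub>0 nat, 'k::field_char_0) mpoly" where "P \<noteq> 0" "P \<in> polys_in (monomials_le (a + b))"
    "\<forall>g\<in>polys_le a. \<forall>h\<in>polys_le b. peval (Poly_Mapping.lookup (g * h)) P = 0"
proof -
  let ?J = "monomials_le (a + b) :: ('n \<Rightarrow>\<^sub>0 nat) set"
  define I :: "(('n \<Rightarrow>\<^sub>0 nat) + ('n \<Rightarrow>\<^sub>0 nat)) set" where "I = Inl ` monomials_le a \<union> Inr ` monomials_le b"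
  define X :: "('n \<Rightarrow>\<^sub>0 nat) + ('n \<Rightarrow>\<^sub>0 nat) \<Rightarrow> (('n \<Rightarrow>\<^sub>0 nat) + ('n \<Rightarrow>\<^sub>0 nat), 'k) mpoly" where
    "X i = Poly_Mapping.single (Poly_Mapping.single i 1) 1" for i
  define q where "q m = (\<Sum>k\<in>monomials_le a. \<Sum>l\<in>monomials_le b. if k + l = m then X (Inl k) * X (Inr l) else 0)" for m
  have XI: "X i \<in> polys_in I" if "i \<in> I" for i
    unfolding X_def using that by (intro polys_in_simps) auto
  have fI: "finite I" unfolding I_def using finite_monomials_le by auto
  have "card I = card (monomials_le a :: ('n \<Rightarrow>\<^sub>0 nat) set) + card (monomials_le b :: ('n \<Rightarrow>\<^sub>0 nat) set)"
    unfolding I_def using finite_monomials_le by (subst card_Un_disjoint) (auto simp: card_image inj_on_def)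
  then have card: "card I < card ?J" using card_monomials_le_add_less[OF n ab] by simp
  have qI: "q m \<in> polys_in I" for m
    unfolding q_def
  proof (intro polys_in_sum)
    fix k l :: "'n \<Rightarrow>\<^sub>0 nat" assume "k \<in> monomials_le a" "l \<in> monomials_le b"
    then have "X (Inl k) * X (Inr l) \<in> polys_in I" by (intro polys_in_mult XI) (auto simp: I_def)
    then show "(if k + l = m then X (Inl k) * X (Inr l) else 0) \<in> polys_in I" using polys_in_simps(5) by auto
  qed
  show ?thesis
  proof (rule polynomial_image_in_hypersurface[OF fI finite_monomials_le card qI])
    fix P :: "('n \<Rightarrow>\<^sub>0 nat, 'k) mpoly"
    assume P: "P \<noteq> 0" "P \<in> polys_in ?J" and Pz: "\<And>x. peval (\<lambda>j. peval x (q j)) P = 0"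
    show thesis
    proof (rule that[OF P], intro ballI)
      fix g h :: "('n, 'k) mpoly" assume gh: "g \<in> polys_le a" "h \<in> polys_le b"
      have "peval (case_sum (Poly_Mapping.lookup g) (Poly_Mapping.lookup h)) (q m) = Poly_Mapping.lookup (g * h) m" for m
        unfolding q_def lookup_mult_monomials_le[OF gh] peval_sum
        by (intro sum.cong refl) (simp add: X_def peval_mult)
      then show "peval (Poly_Mapping.lookup (g * h)) P = 0"
        using Pz[of "case_sum (Poly_Mapping.lookup g) (Poly_Mapping.lookup h)"] by simp
    qed
  qed
qed

lemma nondegenerate_degree:
  fixes f :: "('n::finite, 'k::field_char_0) mpoly"
  assumes "nondegenerate d (Poly_Mapping.lookup f)" "d \<ge> 1"
  shows "f \<notin> polys_le (d - 1)"
proof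
  assume f: "f \<in> polys_le (d - 1)"
  have 0: "Poly_Mapping.lookup f m * 0 ^ (d - monomial_degree m) = 0" for m :: "'n \<Rightarrow>\<^sub>0 nat"
  proof (cases "m \<in> Poly_Mapping.keys f")
    case True
    then have "monomial_degree m \<le> d - 1" using f unfolding polys_le_def by blast
    then show ?thesis using assms(2) by (simp add: power_0_left)
  qed (simp add: in_keys_iff)
  obtain i :: 'n where True by blast
  have "axis i 1 \<noteq> (0 :: 'k ^ 'n)" by (simp add: axis_eq_0_iff)
  moreover have "homog d (Poly_Mapping.lookup f) 0 (axis i 1) = 0" "homog_deriv d (Poly_Mapping.lookup f) j 0 (axis i 1) = 0" for j
    unfolding homog_def homog_deriv_def 0 by simp_all
  ultimately show False using assms(1) unfolding nondegenerate_def by blast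
qed

definition degree_part :: "nat \<Rightarrow> ('n, 'k::comm_monoid_add) mpoly \<Rightarrow> ('n, 'k) mpoly" where
  "degree_part e p = (\<Sum>m\<in>{m\<in>Poly_Mapping.keys p. monomial_degree m = e}. Poly_Mapping.single m (Poly_Mapping.lookup p m))"

text \<open>
The restriction of \<open>p\<close> to the line through the origin and \<open>x\<close>.
\<close>
definition ray_poly :: "('n \<Rightarrow> 'k::comm_semiring_1) \<Rightarrow> ('n, 'k) mpoly \<Rightarrow> 'k poly" where
  "ray_poly x p = (\<Sum>m\<in>Poly_Mapping.keys p. monom (Poly_Mapping.lookup p m * monomial_value x m) (monomial_degree m))"

lemma poly_ray_poly:
  fixes p :: "('n::finite, 'k::field_char_0) mpoly"
  shows "poly (ray_poly x p) t = peval (\<lambda>i. t * x i) p"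
  unfolding ray_poly_def peval_def
  by (simp add: poly_sum poly_monom monomial_value_scale[of "\<lambda>i. t * x i" t x] mult_ac)

lemma ray_poly_mult:
  fixes p q :: "('n::finite, 'k::field_char_0) mpoly"
  shows "ray_poly x (p * q) = ray_poly x p * ray_poly x q"
  unfolding poly_eq_poly_eq_iff[symmetric] by (rule ext) (simp add: poly_ray_poly peval_mult)

lemma coeff_ray_poly: "coeff (ray_poly x p) e = peval x (degree_part e p)"
  unfolding ray_poly_def degree_part_def peval_sum
  by (simp add: coeff_sum sum.inter_filter)

lemma degree_part_nonzero:
  assumes "m \<in> Poly_Mapping.keys p" "monomial_degree m = e"
  shows "degree_part e p \<noteq> 0"
proof
  assume "degree_part e p = 0"
  moreover have "Poly_Mapping.lookup (degree_part e p) m =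
     (\<Sum>k\<in>{m\<in>Poly_Mapping.keys p. monomial_degree m = e}. if k = m then Poly_Mapping.lookup p m else 0)"
    unfolding degree_part_def lookup_sum lookup_single when_def by (intro sum.cong) auto
  moreover have "\<dots> = Poly_Mapping.lookup p m" using assms by simp
  ultimately show False using assms(1) by (simp add: in_keys_iff)
qed

text \<open>
On a line through the origin on which the top-degree parts of both factors do not vanish, degrees of
univariate polynomials add up.
\<close>
lemma factor_degrees:
  fixes g h :: "('n::finite, 'k::field_char_0) mpoly"
  assumes "g * h \<in> polys_le D" "g \<noteq> 0" "h \<noteq> 0"
  obtains a b where "g \<in> polys_le a" "h \<in> polys_le b" "a + b \<le> D"
proof -
  have top: "\<exists>a. p \<in> polys_le a \<and> degree_part a p \<noteq> 0" if "p \<noteq> 0" for p :: "('n, 'k) mpoly"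
  proof -
    let ?S = "monomial_degree ` Poly_Mapping.keys p"
    have S: "finite ?S" "?S \<noteq> {}" using that by auto
    obtain m where m: "m \<in> Poly_Mapping.keys p" "Max ?S = monomial_degree m" using Max_in[OF S] by auto
    have "p \<in> polys_le (Max ?S)" unfolding polys_le_def using S by auto
    then show ?thesis using degree_part_nonzero[OF m(1)] m(2) by metis
  qed
  obtain a where a: "g \<in> polys_le a" "degree_part a g \<noteq> 0" using top[OF assms(2)] by blast
  obtain b where b: "h \<in> polys_le b" "degree_part b h \<noteq> 0" using top[OF assms(3)] by blast
  obtain x where "peval x (degree_part a g * degree_part b h) \<noteq> 0"
    using mpoly_nonvanishing[OF mpoly_mult_nonzero[OF a(2) b(2)]] .
  then have x: "coeff (ray_poly x g) a \<noteq> 0" "coeff (ray_poly x h) b \<noteq> 0" by (auto simp: peval_mult coeff_ray_poly)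
  have "a + b \<le> degree (ray_poly x g) + degree (ray_poly x h)" using x by (intro add_mono le_degree)
  also have "\<dots> = degree (ray_poly x (g * h))"
    unfolding ray_poly_mult using x by (intro degree_mult_eq[symmetric]) auto
  also have "\<dots> \<le> D"
    unfolding ray_poly_def
    by (rule degree_sum_le) (use assms(1) in \<open>auto simp: polys_le_def intro: order_trans[OF degree_monom_le]\<close>)
  finally show ?thesis using that a(1) b(1) by blast
qed

lemma polys_le_mono: "a \<le> b \<Longrightarrow> polys_le a \<subseteq> polys_le b"
  unfolding polys_le_def by (auto intro: order_trans)

lemma degree_0_unit:
  fixes g :: "('n::finite, 'k::field_char_0) mpoly"
  assumes "g \<in> polys_le 0" "g \<noteq> 0"
  shows "g dvd 1"
proof -
  have m0: "m = 0" if "monomial_degree m = 0" for m :: "'n \<Rightarrow>\<^sub>0 nat"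
    by (rule poly_mapping_eqI) (use that in \<open>auto simp: monomial_degree_UNIV\<close>)
  then have k: "Poly_Mapping.keys g \<subseteq> {0}" using assms(1) unfolding polys_le_def by auto
  define c where "c = Poly_Mapping.lookup g 0"
  have g: "g = Poly_Mapping.single 0 c"
  proof (rule poly_mapping_eqI)
    fix m show "Poly_Mapping.lookup g m = Poly_Mapping.lookup (Poly_Mapping.single 0 c) m"
      using k by (cases "m = 0") (auto simp: c_def lookup_single when_def in_keys_iff)
  qed
  then have "c \<noteq> 0" using assms(2) by auto
  then have "g * Poly_Mapping.single 0 (inverse c) = 1" unfolding g by (simp add: mult_single)
  then show ?thesis by (metis dvd_triv_left)
qed

lemma irreducible_of_no_factorization:
  fixes f :: "('n::finite, 'k::field_char_0) mpoly"
  assumes f: "f \<in> polys_le d" "f \<notin> polys_le (d - 1)"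
    and no: "\<And>a g h. 1 \<le> a \<Longrightarrow> a < d \<Longrightarrow> g \<in> polys_le a \<Longrightarrow> h \<in> polys_le (d - a) \<Longrightarrow> f \<noteq> g * h"
  shows "irreducible f"
proof (rule irreducibleI)
  have z: "0 \<in> polys_le a" for a unfolding polys_le_def by simp
  show f0: "f \<noteq> 0" using f(2) z by blast
  show "\<not> f dvd 1"
  proof
    assume "f dvd 1"
    then obtain k where k: "1 = f * k" by (rule dvdE)
    have "f * k \<in> polys_le 0" unfolding k[symmetric] polys_le_def by simp
    moreover have "k \<noteq> 0" using k by auto
    ultimately obtain a b where "f \<in> polys_le a" "a + b \<le> 0" using factor_degrees f0 by metis
    then show False using f(2) polys_le_mono[of a "d - 1"] by auto
  qed
  fix g h assume fgh: "f = g * h"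
  then have gh: "g \<noteq> 0" "h \<noteq> 0" using f0 by auto
  obtain a b where ab: "g \<in> polys_le a" "h \<in> polys_le b" "a + b \<le> d"
    using factor_degrees[of g h d] f(1) fgh gh by metis
  show "g dvd 1 \<or> h dvd 1"
  proof (cases "a = 0 \<or> b = 0")
    case True then show ?thesis using degree_0_unit ab gh by blast
  next
    case False
    then have "1 \<le> a" "a < d" "b \<le> d - a" using ab by auto
    then show ?thesis using no[of a g h] ab fgh polys_le_mono[of b "d - a"] by blast
  qed
qed

section \<open>Non-singularity\<close>

lemma polys_le_exists: "\<exists>D. p \<in> polys_le D"
proof
  show "p \<in> polys_le (\<Sum>m\<in>Poly_Mapping.keys p. monomial_degree m)"
    unfolding polys_le_def by (auto intro: member_le_sum)
qed

text \<open>
The chart provides curves in the zero locus through \<open>x\<close> whose velocities are the \<open>j\<close>-th coordinate vector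
minus a multiple of the \<open>i\<close>-th one, by implicit differentiation. Since \<open>p\<close> vanishes along them, so does
the derivative of \<open>p\<close> in these directions.
\<close>
lemma gradient_parallel:
  fixes f p :: "('n::finite, 'k::{real_normed_field, euclidean_space}) mpoly"
  assumes f: "f \<in> polys_le d" and x: "x \<in> zero_locus f" and i: "gradient f x $ i \<noteq> 0"
    and p: "p \<in> vanishing_ideal (zero_locus f)"
  shows "gradient p x = (gradient p x $ i / gradient f x $ i) *s gradient f x"
proof -
  let ?f = "Poly_Mapping.lookup f" and ?h = "\<lambda>_ :: 'n \<Rightarrow>\<^sub>0 nat. 0 :: 'k"
  let ?p0 = "(0 :: 'k, 1 :: real, x)"
  have gf: "gradient f x $ j = homog_deriv d ?f j 1 x" for j
    unfolding gradient_def by (simp add: peval_pderivative[OF f])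
  obtain D where D: "p \<in> polys_le D" using polys_le_exists by blast
  have gp: "gradient p x $ j = homog_deriv D (Poly_Mapping.lookup p) j 1 x" for j
    unfolding gradient_def by (simp add: peval_pderivative[OF D])
  have H0: "pencil d ?f ?h (0, 1, z) = peval (($) z) f" for z unfolding pencil_def by (simp add: peval_eq_homog[OF f])
  have nz: "homog_deriv d (\<lambda>m. ?f m + fst ?p0 * ?h m) i (of_real (fst (snd ?p0))) (snd (snd ?p0)) \<noteq> 0"
    using i gf by simp
  have Hp0: "pencil d ?f ?h ?p0 = 0" using x unfolding H0 zero_locus_def by simp
  have key: "gradient p x $ j = gradient p x $ i / gradient f x $ i * gradient f x $ j" for j
  proof (cases "j = i")
    case True then show ?thesis using i by simp
  next
    case False
    define \<Phi> where "\<Phi> = (\<lambda>x. x + (0, 0, axis i (pencil d ?f ?h x - snd (snd x) $ i)))"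
    obtain W g where W: "?p0 \<in> W" "open (\<Phi> ` W)" "\<forall>x\<in>W. g (\<Phi> x) = x" "smooth_on (\<Phi> ` W) g" "\<forall>y\<in>\<Phi> ` W. \<Phi> (g y) = y"
      and Dg: "\<forall>j. j \<noteq> i \<longrightarrow> frechet_derivative g (at (\<Phi> ?p0)) (0, 0, axis j 1) = (0, 0, axis j 1 - axis i
       (homog_deriv d (\<lambda>m. ?f m + fst ?p0 * ?h m) j (of_real (fst (snd ?p0))) (snd (snd ?p0))
        / homog_deriv d (\<lambda>m. ?f m + fst ?p0 * ?h m) i (of_real (fst (snd ?p0))) (snd (snd ?p0))))"
      by (rule pencil_chart[OF nz \<Phi>_def]) (rule that; assumption)
    define y where "y t = \<Phi> ?p0 + t *\<^sub>R (0, 0, axis j 1)" for t :: real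
    define u where "u = axis j 1 - axis i (gradient f x $ j / gradient f x $ i)"
    have p0V: "\<Phi> ?p0 \<in> \<Phi> ` W" using W(1) by blast
    have yc: "(y has_derivative (\<lambda>t. t *\<^sub>R (0, 0, axis j 1))) (at 0)"
      unfolding y_def by (auto intro!: derivative_eq_intros)
    have y0: "y 0 = \<Phi> ?p0" unfolding y_def by (simp flip: zero_prod_def)
    have gy0: "g (y 0) = ?p0" unfolding y0 using W(1,3) by blast
    have "(g has_derivative frechet_derivative g (at (y 0))) (at (y 0))"
      unfolding y0 by (rule smooth_on_derivative(1)[OF W(4) p0V])
    then have gyd: "((\<lambda>t. g (y t)) has_derivative (\<lambda>t. frechet_derivative g (at (y 0)) (t *\<^sub>R (0, 0, axis j 1)))) (at 0)"
      using diff_chain_at[OF yc] by (simp add: o_def)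
    have lin: "linear (frechet_derivative g (at (y 0)))"
      using \<open>(g has_derivative _) _\<close> has_derivative_linear by blast
    have zd: "((\<lambda>t. snd (snd (g (y t)))) has_derivative (\<lambda>t. t *\<^sub>R u)) (at 0)"
    proof -
      have "((\<lambda>t. snd (snd (g (y t)))) has_derivative (\<lambda>t. snd (snd (frechet_derivative g (at (y 0)) (t *\<^sub>R (0, 0, axis j 1)))))) (at 0)"
        by (intro has_derivative_snd gyd)
      moreover have "snd (snd (frechet_derivative g (at (y 0)) (t *\<^sub>R (0, 0, axis j 1)))) = t *\<^sub>R u" for t
        unfolding linear_cmul[OF lin] unfolding y0 Dg[rule_format, OF False] u_def using gf by simp
      ultimately show ?thesis by simp
    qed
    have "eventually (\<lambda>t. y t \<in> \<Phi> ` W) (at 0)"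
    proof -
      have "isCont y 0" using yc has_derivative_continuous by blast
      then have "(y \<longlongrightarrow> \<Phi> ?p0) (at 0)" unfolding isCont_def y0 .
      then show ?thesis using W(2) p0V topological_tendstoD by blast
    qed
    moreover have "peval (($) (snd (snd (g (y t))))) p = 0" if yt: "y t \<in> \<Phi> ` W" for t
    proof -
      have e: "\<Phi> (g (y t)) = y t" using W(5) yt by blast
      have yi: "fst (y t) = 0" "fst (snd (y t)) = 1" "snd (snd (y t)) $ i = 0"
        unfolding y_def \<Phi>_def using Hp0 False by (simp_all add: axis_def)
      have "fst (g (y t)) = 0" "fst (snd (g (y t))) = 1" "pencil d ?f ?h (g (y t)) = 0"
        using arg_cong[OF e, of fst] arg_cong[OF e, of "\<lambda>x. fst (snd x)"] arg_cong[OF e, of "\<lambda>x. snd (snd x) $ i"] yi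
        unfolding \<Phi>_def by auto
      then have "pencil d ?f ?h (0, 1, snd (snd (g (y t)))) = 0" by (metis prod.collapse)
      then have "snd (snd (g (y t))) \<in> zero_locus f" unfolding H0 zero_locus_def by simp
      then show ?thesis using p unfolding vanishing_ideal_def by blast
    qed
    ultimately have ev: "eventually (\<lambda>t. homog D (Poly_Mapping.lookup p) 1 (snd (snd (g (y t)))) = 0) (at 0)"
      unfolding peval_eq_homog[OF D] by (rule eventually_mono)
    have "(homog D (Poly_Mapping.lookup p) 1 has_derivative (\<lambda>v. \<Sum>k\<in>UNIV. v $ k * gradient p x $ k)) (at (snd (snd (g (y 0)))))"
      unfolding gp gy0 using has_derivative_homog by simp
    from diff_chain_at[OF zd this]
    have "((\<lambda>t. homog D (Poly_Mapping.lookup p) 1 (snd (snd (g (y t))))) has_derivative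
       (\<lambda>t. \<Sum>k\<in>UNIV. (t *\<^sub>R u) $ k * gradient p x $ k)) (at 0)"
      by (simp only: o_def)
    moreover have "((\<lambda>t. homog D (Poly_Mapping.lookup p) 1 (snd (snd (g (y t))))) has_derivative (\<lambda>t. 0)) (at 0)"
    proof (rule has_derivative_transform_eventually[OF has_derivative_const[of 0]])
      show "eventually (\<lambda>t. 0 = homog D (Poly_Mapping.lookup p) 1 (snd (snd (g (y t))))) (at 0)"
        using ev by (rule eventually_mono) simp
      have "x \<in> zero_locus f" by fact
      then have "peval (($) x) p = 0" using p unfolding vanishing_ideal_def by blast
      then show "0 = homog D (Poly_Mapping.lookup p) 1 (snd (snd (g (y 0))))" unfolding gy0 by (simp add: peval_eq_homog[OF D])
    qed simp
    ultimately have "(\<lambda>t::real. \<Sum>k\<in>UNIV. (t *\<^sub>R u) $ k * gradient p x $ k) = (\<lambda>t. 0)"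
      by (rule has_derivative_unique)
    from fun_cong[OF this, of 1] have s0: "(\<Sum>k\<in>UNIV. u $ k * gradient p x $ k) = 0" by simp
    have "(\<Sum>k\<in>UNIV. u $ k * gradient p x $ k) = (\<Sum>k\<in>{i, j}. u $ k * gradient p x $ k)"
      by (rule sum.mono_neutral_right) (auto simp: u_def axis_def)
    also have "\<dots> = - gradient f x $ j / gradient f x $ i * gradient p x $ i + gradient p x $ j"
      using False by (simp add: u_def axis_def)
    finally have "gradient p x $ j = - (- gradient f x $ j / gradient f x $ i * gradient p x $ i)"
      using s0 by (simp only: eq_neg_iff_add_eq_0 add.commute)
    then show ?thesis by simp
  qed
  then show ?thesis unfolding vec_eq_iff vector_smult_component by blast
qed

lemma nondegenerate_gradient:
  fixes f :: "('n::finite, 'k::field_char_0) mpoly"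
  assumes f: "f \<in> polys_le d" "nondegenerate d (Poly_Mapping.lookup f)" and x: "x \<in> zero_locus f"
  shows "\<exists>i. gradient f x $ i \<noteq> 0"
proof -
  have "homog d (Poly_Mapping.lookup f) 1 x = 0" using x by (simp add: zero_locus_def peval_eq_homog[OF f(1)])
  then obtain i where "homog_deriv d (Poly_Mapping.lookup f) i 1 x \<noteq> 0"
    using f(2) unfolding nondegenerate_def by (metis one_neq_zero)
  then show ?thesis unfolding gradient_def by (auto simp: peval_pderivative[OF f(1)])
qed

text \<open>
The gradients of the vanishing ideal span the line through the gradient of \<open>f\<close>, so that the rank is \<open>1\<close>
at every point.
\<close>
lemma nonsingular_nondegenerate:
  fixes f :: "('n::finite, 'k::{real_normed_field, euclidean_space}) mpoly"
  assumes f: "f \<in> polys_le d" "nondegenerate d (Poly_Mapping.lookup f)"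
  shows "nonsingular_variety (zero_locus f)"
proof -
  have "jacobian_rank (zero_locus f) x = 1" if x: "x \<in> zero_locus f" for x
  proof -
    obtain i where i: "gradient f x $ i \<noteq> 0" using nondegenerate_gradient[OF f x] by blast
    then have nz: "gradient f x \<noteq> 0" by auto
    have "f \<in> vanishing_ideal (zero_locus f)" unfolding vanishing_ideal_def zero_locus_def by simp
    then have 1: "{gradient f x} \<subseteq> (\<lambda>p. gradient p x) ` vanishing_ideal (zero_locus f)" by blast
    have 2: "(\<lambda>p. gradient p x) ` vanishing_ideal (zero_locus f) \<subseteq> vec.span {gradient f x}"
    proof (rule image_subsetI)
      fix p assume "p \<in> vanishing_ideal (zero_locus f)"
      from gradient_parallel[OF f(1) x i this] show "gradient p x \<in> vec.span {gradient f x}"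
        by (metis singletonI vec.span_base vec.span_scale)
    qed
    have 3: "vec.independent {gradient f x}" using nz by (simp add: vec.dependent_single)
    show ?thesis unfolding jacobian_rank_def by (rule vec.dim_unique[OF 1 2 3]) simp
  qed
  then show ?thesis unfolding nonsingular_variety_def singular_points_def by auto
qed

lemma zero_locus_eq_pencil_zeros:
  fixes f :: "('n::finite, 'k::{real_normed_field, euclidean_space}) mpoly"
  assumes "f \<in> polys_le d"
  shows "zero_locus f = pencil_zeros d (Poly_Mapping.lookup f) h 0"
    and "zero_locus f = {z. homog d (Poly_Mapping.lookup f) 1 z = 0}"
  unfolding zero_locus_def pencil_zeros_def pencil_def by (simp_all add: peval_eq_homog[OF assms])

section \<open>Generic hypersurfaces\<close>

text \<open>
A basic open neighbourhood of \<open>p\<close> is given by a polynomial \<open>Q\<close> that is nonzero at \<open>p\<close>. On the line from \<open>p\<close>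
to a point where \<open>P\<close> is nonzero, \<open>P\<close> and \<open>Q\<close> have finitely many zeros each.
\<close>
lemma zariski_open_dense:
  fixes P :: "('n::finite \<Rightarrow>\<^sub>0 nat, 'k::field_char_0) mpoly"
  assumes P: "P \<noteq> 0" "P \<in> polys_in (monomials_le d)"
  defines "U \<equiv> {p \<in> polys_le d. peval (Poly_Mapping.lookup p) P \<noteq> 0}"
  shows "openin (zariski_topology d) U" "zariski_topology d closure_of U = polys_le d"
proof -
  have "polys_le d - U = {p \<in> polys_le d. \<forall>Q\<in>{P}. peval (Poly_Mapping.lookup p) Q = 0}"
    unfolding U_def by auto
  then show op: "openin (zariski_topology d) U"
    unfolding openin_zariski_topology zariski_closed_def U_def by blast
  obtain x where x: "peval x P \<noteq> 0" using mpoly_nonvanishing[OF P(1)] .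
  define mk where "mk y = (\<Sum>m\<in>monomials_le d. Poly_Mapping.single m (y m))" for y :: "('n \<Rightarrow>\<^sub>0 nat) \<Rightarrow> 'k"
  have lmk: "Poly_Mapping.lookup (mk y) m = (if m \<in> monomials_le d then y m else 0)" for y m
  proof -
    have "Poly_Mapping.lookup (mk y) m = (\<Sum>k\<in>monomials_le d. if k = m then y k else 0)"
      unfolding mk_def lookup_sum lookup_single when_def ..
    then show ?thesis by (simp add: finite_monomials_le)
  qed
  have mk: "mk y \<in> polys_le d" for y
    unfolding polys_le_iff_keys by (auto simp: in_keys_iff lmk split: if_splits)
  define r where "r = mk x"
  have r: "peval (Poly_Mapping.lookup r) P \<noteq> 0"
  proof -
    have "peval (Poly_Mapping.lookup r) P = peval x P"
      by (rule peval_cong) (use P(2) in \<open>auto simp: polys_in_def r_def lmk\<close>)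
    then show ?thesis using x by simp
  qed
  have "p \<in> zariski_topology d closure_of U" if p: "p \<in> polys_le d" for p
    unfolding in_closure_of topspace_zariski_topology
  proof (intro conjI p allI impI, elim conjE)
    fix T assume pT: "p \<in> T" and T: "openin (zariski_topology d) T"
    obtain S :: "('n \<Rightarrow>\<^sub>0 nat, 'k) mpoly set" where S: "T \<subseteq> polys_le d"
      "polys_le d - T = {p \<in> polys_le d. \<forall>Q\<in>S. peval (Poly_Mapping.lookup p) Q = 0}"
      using T unfolding openin_zariski_topology zariski_closed_def by blast
    have "p \<notin> polys_le d - T" using pT by blast
    then obtain Q where Q: "Q \<in> S" "peval (Poly_Mapping.lookup p) Q \<noteq> 0" unfolding S(2) using p by blast
    obtain s where s: "peval (\<lambda>i. Poly_Mapping.lookup p i + s * (Poly_Mapping.lookup r i - Poly_Mapping.lookup p i)) Q \<noteq> 0"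
      "peval (\<lambda>i. Poly_Mapping.lookup p i + s * (Poly_Mapping.lookup r i - Poly_Mapping.lookup p i)) P \<noteq> 0"
      using common_nonvanishing_on_line[OF Q(2) r] .
    define y where "y = mk (\<lambda>i. Poly_Mapping.lookup p i + s * (Poly_Mapping.lookup r i - Poly_Mapping.lookup p i))"
    have "Poly_Mapping.lookup y = (\<lambda>i. Poly_Mapping.lookup p i + s * (Poly_Mapping.lookup r i - Poly_Mapping.lookup p i))"
    proof
      fix m
      show "Poly_Mapping.lookup y m = Poly_Mapping.lookup p m + s * (Poly_Mapping.lookup r m - Poly_Mapping.lookup p m)"
      proof (cases "m \<in> monomials_le d")
        case False
        then have "Poly_Mapping.lookup p m = 0" "Poly_Mapping.lookup r m = 0"
          using p unfolding polys_le_iff_keys r_def by (auto simp: lmk in_keys_iff)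
        then show ?thesis unfolding y_def lmk using False by simp
      qed (simp add: y_def lmk)
    qed
    then have yv: "peval (Poly_Mapping.lookup y) Q \<noteq> 0" "peval (Poly_Mapping.lookup y) P \<noteq> 0" using s by simp_all
    have yd: "y \<in> polys_le d" unfolding y_def by (rule mk)
    have "y \<in> U" unfolding U_def using yd yv by simp
    moreover have "y \<notin> polys_le d - T" unfolding S(2) using Q(1) yv(1) by blast
    ultimately show "\<exists>y. y \<in> U \<and> y \<in> T" using yd by blast
  qed
  moreover have "zariski_topology d closure_of U \<subseteq> polys_le d"
    using closure_of_subset_topspace[of "zariski_topology d" U] unfolding topspace_zariski_topology .
  ultimately show "zariski_topology d closure_of U = polys_le d" by blast
qed

lemma generic_polynomial:
  assumes n: "CARD('n::finite) \<ge> 3" and d: "d \<ge> 1"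
  obtains P :: "('n::finite \<Rightarrow>\<^sub>0 nat, 'k::field_char_0) mpoly" where "P \<noteq> 0" "P \<in> polys_in (monomials_le d)"
    "\<forall>c. peval c P \<noteq> 0 \<longrightarrow> nondegenerate d c"
    "\<forall>f\<in>polys_le d. peval (Poly_Mapping.lookup f) P \<noteq> 0 \<longrightarrow> irreducible f"
proof -
  obtain P0 :: "('n \<Rightarrow>\<^sub>0 nat, 'k) mpoly" where P0: "P0 \<noteq> 0" "P0 \<in> polys_in (monomials_le d)"
    "\<forall>c. peval c P0 \<noteq> 0 \<longrightarrow> nondegenerate d c"
  proof (rule generic_nondegenerate[OF d])
    fix P :: "('n \<Rightarrow>\<^sub>0 nat, 'k) mpoly"
    assume P: "P \<noteq> 0" "P \<in> polys_in (monomials_le d)" "\<And>c. peval c P \<noteq> 0 \<Longrightarrow> nondegenerate d c"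
    show thesis by (rule that[OF P(1,2)]) (use P(3) in blast)
  qed
  have "\<exists>P :: ('n \<Rightarrow>\<^sub>0 nat, 'k) mpoly. P \<noteq> 0 \<and> P \<in> polys_in (monomials_le d) \<and>
     (\<forall>g\<in>polys_le a. \<forall>h\<in>polys_le (d - a). peval (Poly_Mapping.lookup (g * h)) P = 0)" if "a \<in> {1..<d}" for a
  proof -
    have a: "1 \<le> a" "1 \<le> d - a" "a + (d - a) = d" using that by auto
    show ?thesis by (rule reducible_in_hypersurface[OF n a(1,2), unfolded a(3)]) blast
  qed
  then obtain Q :: "nat \<Rightarrow> ('n \<Rightarrow>\<^sub>0 nat, 'k) mpoly" where Q: "\<And>a. a \<in> {1..<d} \<Longrightarrow> Q a \<noteq> 0"
    "\<And>a. a \<in> {1..<d} \<Longrightarrow> Q a \<in> polys_in (monomials_le d)"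
    "\<And>a. a \<in> {1..<d} \<Longrightarrow> \<forall>g\<in>polys_le a. \<forall>h\<in>polys_le (d - a). peval (Poly_Mapping.lookup (g * h)) (Q a) = 0"
    by metis
  define P where "P = P0 * (\<Prod>a\<in>{1..<d}. Q a)"
  show ?thesis
  proof (rule that[of P])
    show "P \<noteq> 0" unfolding P_def using P0 Q by (intro mpoly_mult_nonzero mpoly_prod_nonzero) auto
    show "P \<in> polys_in (monomials_le d)" unfolding P_def using P0 Q by (intro polys_in_mult polys_in_prod) auto
    show g: "\<forall>c. peval c P \<noteq> 0 \<longrightarrow> nondegenerate d c"
      using P0(3) unfolding P_def by (auto simp: peval_mult)
    show "\<forall>f\<in>polys_le d. peval (Poly_Mapping.lookup f) P \<noteq> 0 \<longrightarrow> irreducible f"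
    proof (intro ballI impI)
    fix f :: "('n, 'k) mpoly" assume f: "f \<in> polys_le d" "peval (Poly_Mapping.lookup f) P \<noteq> 0"
    show "irreducible f"
    proof (rule irreducible_of_no_factorization[OF f(1) nondegenerate_degree[OF g[rule_format, OF f(2)] d]])
      fix a and g h :: "('n, 'k) mpoly" assume a: "1 \<le> a" "a < d" "g \<in> polys_le a" "h \<in> polys_le (d - a)"
      have "peval (Poly_Mapping.lookup f) (Q a) \<noteq> 0"
        using f(2) a(1,2) unfolding P_def by (auto simp: peval_mult peval_prod)
      then show "f \<noteq> g * h" using Q(3)[of a] a by auto
    qed
    qed
  qed
qed

text \<open>
The equation \<open>P\<close> of the complement is part of the conclusion because it is also evaluated on the
members of pencils.
\<close>
lemma generic_hypersurface:
  assumes n: "CARD('n::finite) \<ge> 3" and d: "d \<ge> 1"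
  obtains U :: "('n::finite, 'k::{real_normed_field, euclidean_space}) mpoly set" and P where "U = {f \<in> polys_le d. peval (Poly_Mapping.lookup f) P \<noteq> 0}"
    "openin (zariski_topology d) U" "zariski_topology d closure_of U = polys_le d"
    "U \<inter> polys_le (d - 1) = {}" "\<forall>c. peval c P \<noteq> 0 \<longrightarrow> nondegenerate d c"
    "\<forall>f\<in>U. irreducible f \<and> nonsingular_variety (zero_locus f) \<and>
       conic_at_infinity (zero_locus f) \<and> (\<forall>C\<in>components (zero_locus f). LNE C)"
proof -
  obtain P :: "('n \<Rightarrow>\<^sub>0 nat, 'k) mpoly" where P: "P \<noteq> 0" "P \<in> polys_in (monomials_le d)"
    and g: "\<forall>c. peval c P \<noteq> 0 \<longrightarrow> nondegenerate d c"
    and irr: "\<forall>f\<in>polys_le d. peval (Poly_Mapping.lookup f) P \<noteq> 0 \<longrightarrow> irreducible f"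
    using generic_polynomial[OF assms] by blast
  define U where "U = {f \<in> polys_le d. peval (Poly_Mapping.lookup f) P \<noteq> 0}"
  have gU: "f \<in> polys_le d" "nondegenerate d (Poly_Mapping.lookup f)" "irreducible f" if "f \<in> U" for f
    using that g irr unfolding U_def by auto
  show ?thesis
  proof (rule that[OF U_def _ _ _ g])
    show "openin (zariski_topology d) U" "zariski_topology d closure_of U = polys_le d"
      unfolding U_def by (rule zariski_open_dense[OF P])+
    show "U \<inter> polys_le (d - 1) = {}" using nondegenerate_degree[OF gU(2) d] by blast
    show "\<forall>f\<in>U. irreducible f \<and> nonsingular_variety (zero_locus f) \<and>
       conic_at_infinity (zero_locus f) \<and> (\<forall>C\<in>components (zero_locus f). LNE C)"
    proof (intro ballI conjI)
      fix f assume f: "f \<in> U"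
      show "irreducible f" "nonsingular_variety (zero_locus f)"
        using gU[OF f] nonsingular_nondegenerate by blast+
      show "conic_at_infinity (zero_locus f)"
        unfolding zero_locus_eq_pencil_zeros(2)[OF gU(1)[OF f]] by (rule conic_at_infinity_nondegenerate[OF gU(2)[OF f]])
      fix C assume "C \<in> components (zero_locus f)"
      then show "LNE C"
        using components_pencil_zeros_LNE[of d "Poly_Mapping.lookup f" 0 "\<lambda>_. 0" C] gU(2)[OF f]
        by (simp add: zero_locus_eq_pencil_zeros(1)[OF gU(1)[OF f], of "\<lambda>_. 0"])
    qed
  qed
qed

text \<open>
On the pencil of \<open>f\<close> and the Fermat polynomial, \<open>P\<close> is a polynomial in the parameter that is nonzero
at \<open>0\<close>. Thus only finitely many members can be degenerate.
\<close>
lemma complex_zero_locus_LNE: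
  fixes f :: "('n::finite, complex) mpoly"
  assumes n: "CARD('n) \<ge> 2" and d: "d \<ge> 1" and f: "f \<in> polys_le d" "peval (Poly_Mapping.lookup f) P \<noteq> 0"
    and P: "\<And>c. peval c P \<noteq> 0 \<Longrightarrow> nondegenerate d c"
  shows "LNE (zero_locus f)"
proof -
  let ?f = "Poly_Mapping.lookup f"
  define h :: "('n \<Rightarrow>\<^sub>0 nat) \<Rightarrow> complex" where "h = (\<lambda>m. fermat d m - ?f m)"
  define S where "S = {s. peval (\<lambda>m. ?f m + s * h m) P = 0}"
  have S: "finite S" unfolding S_def by (rule finite_zeros_on_line[of _ 0]) (use f(2) in simp)
  have gS: "nondegenerate d (\<lambda>m. ?f m + s * h m)" if "s \<notin> S" for s using that P unfolding S_def by blast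
  have "all_joined (pencil_zeros d ?f h 0)" by (rule all_joined_complex[OF d n P[OF f(2)] S h_def gS])
  moreover have "nondegenerate d (\<lambda>m. ?f m + 0 * h m)" using P[OF f(2)] by simp
  ultimately have "LNE (pencil_zeros d ?f h 0)" by (intro pencil_zeros_LNE)
  then show ?thesis unfolding zero_locus_eq_pencil_zeros(1)[OF f(1), of h] .
qed

theorem proposition6p2:
  fixes d :: nat
  assumes "CARD('n::finite) \<ge> 3" and "d \<ge> 1"
  shows
    "(\<exists>U :: ('n, real) mpoly set.
        openin (zariski_topology d) U \<and>
        zariski_topology d closure_of U = polys_le d \<and>
        U \<inter> polys_le (d - 1) = {} \<and>
        (\<forall>f\<in>U. irreducible f \<and>
           nonsingular_variety (zero_locus f) \<and>
           conic_at_infinity (zero_locus f) \<and>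
           (\<forall>C\<in>components (zero_locus f). LNE C))) \<and>
     (\<exists>U :: ('n, complex) mpoly set.
        openin (zariski_topology d) U \<and>
        zariski_topology d closure_of U = polys_le d \<and>
        U \<inter> polys_le (d - 1) = {} \<and>
        (\<forall>f\<in>U. irreducible f \<and>
           nonsingular_variety (zero_locus f) \<and>
           conic_at_infinity (zero_locus f) \<and>
           (\<forall>C\<in>components (zero_locus f). LNE C) \<and>
           LNE (zero_locus f)))"
proof (rule conjI, goal_cases)
  case 1
  show ?case
    by (rule generic_hypersurface[OF assms, where 'k = real]) (intro exI conjI; assumption)
next
  case 2
  obtain U :: "('n, complex) mpoly set" and P where U: "U = {f \<in> polys_le d. peval (Poly_Mapping.lookup f) P \<noteq> 0}"
    "openin (zariski_topology d) U" "zariski_topology d closure_of U = polys_le d"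
    "U \<inter> polys_le (d - 1) = {}" "\<forall>c. peval c P \<noteq> 0 \<longrightarrow> nondegenerate d c"
    "\<forall>f\<in>U. irreducible f \<and> nonsingular_variety (zero_locus f) \<and>
       conic_at_infinity (zero_locus f) \<and> (\<forall>C\<in>components (zero_locus f). LNE C)"
    by (rule generic_hypersurface[OF assms]) (rule that; assumption)
  have "LNE (zero_locus f)" if "f \<in> U" for f
    by (rule complex_zero_locus_LNE[of d f P]) (use that assms U(1,5) in auto)
  then show ?case using U(2-4,6) by (intro exI[of _ U]) blast
qed

end
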